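(* Let $n\ge 2$ be an integer. The $H(n)$-move is an unknotting operation for welded knots: every welded knot diagram can be transformed into a diagram of the trivial knot by a finite sequence of $H(n)$-moves and welded Reidemeister moves.
   Context: Welded knot diagrams. A virtual link diagram is a generic immersion of finitely many circles in the plane (considered up to planar isotopy), each of whose finitely many transverse double points is marked either as a classical crossing (with over/under information) or as a virtual crossing (no over/under information). A welded knot diagram is a virtual link diagram with one component, considered with respect to the welded Reidemeister moves. The trivial knot is the class of the crossingless diagram of one circle. Welded Reidemeister moves. The generalized Reidemeister moves are the classical Reidemeister moves R1, R2, R3 (involving only classical crossings), the virtual Reidemeister moves VR1, VR2, VR3 (the same moves with all crossings virtual), and the mixed move VR4 (an arc having two consecutive virtual crossings with the two strands of a classical crossing is moved across that classical crossing). The forbidden move $F_O$ moves an arc that passes over both strands of a virtual crossing, at two consecutive classical crossings, across that virtual crossing (the arc remains over). The welded Reidemeister moves are the generalized Reidemeister moves together with $F_O$. All moves may be used in both directions. $H(n)$-move ($n\ge 2$). Let $B$ be a disk in the plane meeting a diagram $D$ in exactly $n$ pairwise disjoint simple arcs with no crossings in $B$, whose $2n$ endpoints $p_1,\dots,p_{2n}$, in cyclic order on $\partial B$, are joined in pairs $p_{2i-1},p_{2i}$ ($1\le i\le n$). The $H(n)$-move replaces these arcs by $n$ pairwise disjoint simple arcs in $B$ joining $p_{2i}$ to $p_{2i+1}$ ($1\le i\le n$, indices mod $2n$), leaving $D$ unchanged outside $B$. An $H(n)$-move is required to preserve the number of components of the diagram. The move is performed on the underlying unoriented diagram; it need not preserve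 orientations outside $B$. *)

theory Defs
  imports "HOL-Analysis.Analysis"
begin

section \<open>Virtual link diagrams\<close>

text \<open>
  Everything is done in the topological category: immersions are locally injective continuous
  maps, and transversality at a double point is the existence of a chart of the plane taking the
  two branches to the two coordinate axes.  The circles of a diagram with \<open>c\<close> components are the
  sets \<open>{i} \<times> sphere 0 1\<close> for \<open>i < c\<close>; values of \<open>curve\<close> elsewhere are irrelevant.  The field
  \<open>virtuals\<close> holds the virtual crossings as points of the plane, whereas \<open>overs\<close> holds, for each
  classical crossing, the one of its two parameters at which the curve runs over.
\<close>

record diagram =
  ncomp :: nat
  curve :: "nat \<times> complex \<Rightarrow> complex"
  virtuals :: "complex set"
  overs :: "(nat \<times> complex) set"

definition circles :: "diagram \<Rightarrow> (nat \<times> complex) set" where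
  "circles D = {..<ncomp D} \<times> sphere 0 1"

definition crossings :: "diagram \<Rightarrow> complex set" where
  "crossings D = {x. \<exists>z\<in>circles D. \<exists>w\<in>circles D. z \<noteq> w \<and> curve D z = x \<and> curve D w = x}"

text \<open>
  The conditions below force \<open>x\<close> to have exactly the two parameters \<open>z\<close> and \<open>w\<close>.  That \<open>N\<close> and
  \<open>M\<close> are open in the circles is essential: it excludes two branches that touch at a corner.
\<close>

definition transverse_double_point :: "diagram \<Rightarrow> complex \<Rightarrow> bool" where
  "transverse_double_point D x \<longleftrightarrow>
    (\<exists>z w N M U h k.
       z \<noteq> w \<and> z \<in> N \<and> w \<in> M \<and> curve D z = x \<and> curve D w = x \<and> x \<in> U \<and>
       openin (top_of_set (circles D)) N \<and> openin (top_of_set (circles D)) M \<and>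
       inj_on (curve D) N \<and> inj_on (curve D) M \<and>
       open U \<and> {v \<in> circles D. curve D v \<in> U} = N \<union> M \<and>
       homeomorphism U (ball (0::complex) 1) h k \<and>
       h ` curve D ` N = {u \<in> ball 0 1. Im u = 0} \<and>
       h ` curve D ` M = {u \<in> ball 0 1. Re u = 0})"

definition generic_immersion :: "diagram \<Rightarrow> bool" where
  "generic_immersion D \<longleftrightarrow>
     continuous_on (circles D) (curve D) \<and>
     (\<forall>z\<in>circles D. \<exists>N. openin (top_of_set (circles D)) N \<and> z \<in> N \<and> inj_on (curve D) N) \<and>
     finite (crossings D) \<and>
     (\<forall>x\<in>crossings D. transverse_double_point D x)"

definition virtual_link_diagram :: "diagram \<Rightarrow> bool" where
  "virtual_link_diagram D \<longleftrightarrow>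
     generic_immersion D \<and>
     virtuals D \<subseteq> crossings D \<and>
     overs D \<subseteq> {z \<in> circles D. curve D z \<in> crossings D - virtuals D} \<and>
     (\<forall>x \<in> crossings D - virtuals D. \<exists>!z. z \<in> overs D \<and> curve D z = x)"

definition welded_knot_diagram :: "diagram \<Rightarrow> bool" where
  "welded_knot_diagram D \<longleftrightarrow> virtual_link_diagram D \<and> ncomp D = 1"


section \<open>Planar isotopy\<close>

text \<open>
  The homeomorphism \<open>\<phi>\<close> of the circles may permute them, reparametrise them and reverse their
  directions, so that diagrams are treated as unparametrised and unoriented.
\<close>

definition planar_isotopic :: "diagram \<Rightarrow> diagram \<Rightarrow> bool" where
  "planar_isotopic D D' \<longleftrightarrow>
     (\<exists>f \<phi> \<psi>.
        homotopic_with_canon (\<lambda>f. \<exists>g. homeomorphism (UNIV :: complex set) UNIV f g) UNIV UNIV id f \<and>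
        homeomorphism (circles D) (circles D') \<phi> \<psi> \<and>
        (\<forall>z\<in>circles D. curve D' (\<phi> z) = f (curve D z) \<and> (\<phi> z \<in> overs D' \<longleftrightarrow> z \<in> overs D)) \<and>
        virtuals D' = f ` virtuals D)"


section \<open>Replacing the part of a diagram inside a disk\<close>

text \<open>
  The part of \<open>D\<close> in the disk \<open>B\<close> consists of \<open>m\<close> strands with endpoints on the boundary circle and
  otherwise inside.  The strands \<open>q 0, \<dots>, q (m - 1)\<close> are given as disjoint arcs in the
  \<^emph>\<open>parameter\<close> circles; their images in the plane may cross themselves and each other.
\<close>

definition tangle :: "diagram \<Rightarrow> complex set \<Rightarrow> nat \<Rightarrow> (nat \<Rightarrow> real \<Rightarrow> nat \<times> complex) \<Rightarrow> bool" where
  "tangle D B m q \<longleftrightarrow>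
     B homeomorphic cball (0::complex) 1 \<and>
     crossings D \<inter> frontier B = {} \<and>
     (\<forall>i<m. arc (q i) \<and>
        curve D (pathstart (q i)) \<in> frontier B \<and>
        curve D (pathfinish (q i)) \<in> frontier B \<and>
        (\<forall>t\<in>{0<..<1}. curve D (q i t) \<in> interior B)) \<and>
     disjoint_family_on (\<lambda>i. path_image (q i)) {..<m} \<and>
     {z \<in> circles D. curve D z \<in> B} = (\<Union>i<m. path_image (q i))"

definition agree_outside :: "complex set \<Rightarrow> diagram \<Rightarrow> diagram \<Rightarrow> bool" where
  "agree_outside B D D' \<longleftrightarrow>
     (\<exists>\<phi> \<psi>.
        homeomorphism {z \<in> circles D. curve D z \<notin> interior B}
                      {z \<in> circles D'. curve D' z \<notin> interior B} \<phi> \<psi> \<and>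
        (\<forall>z\<in>circles D. curve D z \<notin> interior B \<longrightarrow>
           curve D' (\<phi> z) = curve D z \<and> (\<phi> z \<in> overs D' \<longleftrightarrow> z \<in> overs D)) \<and>
        virtuals D' - interior B = virtuals D - interior B)"

definition replacement ::
  "diagram \<Rightarrow> diagram \<Rightarrow> complex set \<Rightarrow> nat \<Rightarrow>
   (nat \<Rightarrow> real \<Rightarrow> nat \<times> complex) \<Rightarrow> (nat \<Rightarrow> real \<Rightarrow> nat \<times> complex) \<Rightarrow> bool" where
  "replacement D D' B m q q' \<longleftrightarrow> tangle D B m q \<and> tangle D' B m q' \<and> agree_outside B D D'"

definition replacement_rel_ends ::
  "diagram \<Rightarrow> diagram \<Rightarrow> complex set \<Rightarrow> nat \<Rightarrow>
   (nat \<Rightarrow> real \<Rightarrow> nat \<times> complex) \<Rightarrow> (nat \<Rightarrow> real \<Rightarrow> nat \<times> complex) \<Rightarrow> bool" where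
  "replacement_rel_ends D D' B m q q' \<longleftrightarrow>
     replacement D D' B m q q' \<and>
     (\<forall>i<m. curve D (pathstart (q i)) = curve D' (pathstart (q' i)) \<and>
            curve D (pathfinish (q i)) = curve D' (pathfinish (q' i)))"

definition strand_image :: "diagram \<Rightarrow> (real \<Rightarrow> nat \<times> complex) \<Rightarrow> complex set" where
  "strand_image D a = curve D ` path_image a"

definition simple_strand :: "diagram \<Rightarrow> (real \<Rightarrow> nat \<times> complex) \<Rightarrow> bool" where
  "simple_strand D a \<longleftrightarrow> inj_on (curve D) (path_image a)"

definition passes_over ::
  "diagram \<Rightarrow> (real \<Rightarrow> nat \<times> complex) \<Rightarrow> (real \<Rightarrow> nat \<times> complex) \<Rightarrow> bool" where
  "passes_over D a b \<longleftrightarrow> (\<forall>z\<in>path_image a. curve D z \<in> strand_image D b \<longrightarrow> z \<in> overs D)"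

definition passes_virtually ::
  "diagram \<Rightarrow> (real \<Rightarrow> nat \<times> complex) \<Rightarrow> (real \<Rightarrow> nat \<times> complex) \<Rightarrow> bool" where
  "passes_virtually D a b \<longleftrightarrow> strand_image D a \<inter> strand_image D b \<subseteq> virtuals D"


section \<open>Welded Reidemeister moves\<close>

text \<open>
  The moves are described by the crossing pattern of the strands in the disk.  By the Schoenflies
  theorem, the patterns below determine the usual pictures up to homeomorphism of the disk.
\<close>

definition R1 :: "diagram \<Rightarrow> diagram \<Rightarrow> bool" where
  "R1 D D' \<longleftrightarrow> (\<exists>B q q'. replacement_rel_ends D D' B 1 q q' \<and>
     (\<exists>x. crossings D \<inter> B = {x} \<and> x \<notin> virtuals D) \<and> crossings D' \<inter> B = {})"

definition VR1 :: "diagram \<Rightarrow> diagram \<Rightarrow> bool" where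
  "VR1 D D' \<longleftrightarrow> (\<exists>B q q'. replacement_rel_ends D D' B 1 q q' \<and>
     (\<exists>x. crossings D \<inter> B = {x} \<and> x \<in> virtuals D) \<and> crossings D' \<inter> B = {})"

definition bigon :: "diagram \<Rightarrow> (nat \<Rightarrow> real \<Rightarrow> nat \<times> complex) \<Rightarrow> bool" where
  "bigon D q \<longleftrightarrow> simple_strand D (q 0) \<and> simple_strand D (q 1) \<and>
     card (strand_image D (q 0) \<inter> strand_image D (q 1)) = 2"

definition R2 :: "diagram \<Rightarrow> diagram \<Rightarrow> bool" where
  "R2 D D' \<longleftrightarrow> (\<exists>B q q'. replacement_rel_ends D D' B 2 q q' \<and>
     bigon D q \<and> passes_over D (q 0) (q 1) \<and> crossings D' \<inter> B = {})"

definition VR2 :: "diagram \<Rightarrow> diagram \<Rightarrow> bool" where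
  "VR2 D D' \<longleftrightarrow> (\<exists>B q q'. replacement_rel_ends D D' B 2 q q' \<and>
     bigon D q \<and> passes_virtually D (q 0) (q 1) \<and> crossings D' \<inter> B = {})"

definition triangle :: "diagram \<Rightarrow> (nat \<Rightarrow> real \<Rightarrow> nat \<times> complex) \<Rightarrow> bool" where
  "triangle D q \<longleftrightarrow> (\<forall>i<3. simple_strand D (q i)) \<and>
     (\<forall>i<3. \<forall>j<3. i \<noteq> j \<longrightarrow> (\<exists>x. strand_image D (q i) \<inter> strand_image D (q j) = {x}))"

definition meets_before :: "diagram \<Rightarrow> (real \<Rightarrow> nat \<times> complex) \<Rightarrow>
    (real \<Rightarrow> nat \<times> complex) \<Rightarrow> (real \<Rightarrow> nat \<times> complex) \<Rightarrow> bool" where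
  "meets_before D a b c \<longleftrightarrow> (\<exists>s t. 0 \<le> s \<and> s < t \<and> t \<le> 1 \<and>
     curve D (a s) \<in> strand_image D b \<and> curve D (a t) \<in> strand_image D c)"

text \<open>
  Moving a strand across the crossing of the two others means that each strand meets the two
  others in the opposite order.  The predicate \<open>P\<close> records the kind of the three crossings, which
  is the same before and after the move.
\<close>

definition triangle_move ::
  "(diagram \<Rightarrow> (nat \<Rightarrow> real \<Rightarrow> nat \<times> complex) \<Rightarrow> bool) \<Rightarrow> diagram \<Rightarrow> diagram \<Rightarrow> bool" where
  "triangle_move P D D' \<longleftrightarrow> (\<exists>B q q'. replacement_rel_ends D D' B 3 q q' \<and>
     triangle D q \<and> triangle D' q' \<and> P D q \<and> P D' q' \<and>
     (\<forall>i<3. \<forall>j<3. \<forall>k<3. i \<noteq> j \<and> i \<noteq> k \<and> j \<noteq> k \<longrightarrow>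
        (meets_before D (q i) (q j) (q k) \<longleftrightarrow> meets_before D' (q' i) (q' k) (q' j))))"

definition R3 :: "diagram \<Rightarrow> diagram \<Rightarrow> bool" where
  "R3 = triangle_move (\<lambda>D q.
     passes_over D (q 0) (q 1) \<and> passes_over D (q 0) (q 2) \<and> passes_over D (q 1) (q 2))"

definition VR3 :: "diagram \<Rightarrow> diagram \<Rightarrow> bool" where
  "VR3 = triangle_move (\<lambda>D q. passes_virtually D (q 0) (q 1) \<and>
     passes_virtually D (q 0) (q 2) \<and> passes_virtually D (q 1) (q 2))"

definition VR4 :: "diagram \<Rightarrow> diagram \<Rightarrow> bool" where
  "VR4 = triangle_move (\<lambda>D q. passes_virtually D (q 0) (q 1) \<and>
     passes_virtually D (q 0) (q 2) \<and> passes_over D (q 1) (q 2))"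

definition F_O :: "diagram \<Rightarrow> diagram \<Rightarrow> bool" where
  "F_O = triangle_move (\<lambda>D q. passes_over D (q 0) (q 1) \<and>
     passes_over D (q 0) (q 2) \<and> passes_virtually D (q 1) (q 2))"

definition elementary_welded_move :: "diagram \<Rightarrow> diagram \<Rightarrow> bool" where
  "elementary_welded_move D D' \<longleftrightarrow> planar_isotopic D D' \<or>
     R1 D D' \<or> R2 D D' \<or> R3 D D' \<or>
     VR1 D D' \<or> VR2 D D' \<or> VR3 D D' \<or> VR4 D D' \<or> F_O D D'"

definition welded_move :: "diagram \<Rightarrow> diagram \<Rightarrow> bool" where
  "welded_move D D' \<longleftrightarrow> virtual_link_diagram D \<and> virtual_link_diagram D' \<and>
     (elementary_welded_move D D' \<or> elementary_welded_move D' D)"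

text \<open>
  By the Schoenflies theorem all crossingless diagrams of one circle are planar isotopic, so it
  does not matter which one is reached.
\<close>

definition trivial_knot_diagram :: "diagram \<Rightarrow> bool" where
  "trivial_knot_diagram D \<longleftrightarrow>
     (\<exists>E. welded_knot_diagram E \<and> crossings E = {} \<and> welded_move\<^sup>*\<^sup>* D E)"


section \<open>The move \<open>H(n)\<close>\<close>

text \<open>
  The \<open>2 * n\<close> endpoints, numbered from \<open>0\<close>, are \<open>c (\<theta> 0), \<dots>, c (\<theta> (2 * n - 1))\<close>, where \<open>c\<close>
  runs once around the boundary of the disk.
\<close>

definition H_move :: "nat \<Rightarrow> diagram \<Rightarrow> diagram \<Rightarrow> bool" where
  "H_move n D D' \<longleftrightarrow>
     virtual_link_diagram D \<and> virtual_link_diagram D' \<and> ncomp D' = ncomp D \<and>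
     (\<exists>B q q' c \<theta>. replacement D D' B n q q' \<and>
        crossings D \<inter> B = {} \<and> crossings D' \<inter> B = {} \<and>
        simple_path c \<and> pathfinish c = pathstart c \<and> path_image c = frontier B \<and>
        strict_mono_on {..<2 * n} \<theta> \<and> \<theta> ` {..<2 * n} \<subseteq> {0..<1::real} \<and>
        (\<forall>i<n. curve D (pathstart (q i)) = c (\<theta> (2 * i)) \<and>
               curve D (pathfinish (q i)) = c (\<theta> (2 * i + 1)) \<and>
               curve D' (pathstart (q' i)) = c (\<theta> (2 * i + 1)) \<and>
               curve D' (pathfinish (q' i)) = c (\<theta> ((2 * i + 2) mod (2 * n)))))"

end

theory Submission
  imports Defs
begin

text \<open>
  A crossing of a one-component diagram can be removed by smoothing it, and of its two smoothings
  exactly one has a single component again: the one that reverses one of the two arcs into which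
  the crossing cuts the curve.  This smoothing is an \<open>H(2)\<close>-move followed by a first Reidemeister
  move.  Cut the two arms by which the curve leaves the crossing and join the four ends the other
  way round: the two ends next to the crossing close up to a loop based at the crossing, which R1
  (or VR1, if the crossing is virtual) removes, and the two far ends are joined to each other.
  Nothing else changes, so the number of crossings drops by one (\<open>crossing_reduction\<close>), and
  induction on it ends in a crossingless diagram.

  For \<open>n > 2\<close> the \<open>H(2)\<close>-move is simulated by an \<open>H(n)\<close>-move up to virtual kinks.  Let an
  \<open>H(m)\<close>-move join \<open>p1 p2\<close>, \<open>p3 p4\<close>, \<dots> before and \<open>p2 p3\<close>, \<dots>, \<open>p(2m) p1\<close> after.  Put a virtual
  kink on the strand that leaves the disk at \<open>p2\<close>, curled in one sense before the move and in
  the mirrored sense after it.  The part of the kink next to the disk can be chosen so that below a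
  certain line both kinks are the same, and above this line there are, before as well as after,
  \<open>m + 1\<close> strands whose ends are matched as in an \<open>H(m + 1)\<close>-move.  Hence VR1, an
  \<open>H(m + 1)\<close>-move and VR1 again have the effect of the \<open>H(m)\<close>-move (\<open>H_config_kink\<close>), and
  iterating this reaches \<open>n\<close> (\<open>H_config_reach\<close>).

  All this happens inside a chart around the crossing, which transversality provides.  After a fixed
  piecewise linear change of coordinates the curve inside the chart is an explicit polygon, and every
  disk of a move is the image of a rectangle.
  That a modified diagram is again a generic immersion is a local question: outside the disk it
  inherits transversality from the old diagram (\<open>virtual_link_diagram_agree\<close>), and the only crossings
  that are ever created are those of the standard virtual kink (\<open>kinked_transverse\<close>).
\<close>

section \<open>Diagrams that agree outside a disk\<close>

text \<open>
  A continuous surjection from a compact space is a quotient map.  It is used to define maps on the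
  circle by formulas in an angle parameter, and maps on a strand by formulas in its parameter.
\<close>

lemma continuous_on_factor:
  fixes e :: "'a::t2_space \<Rightarrow> 'b::t2_space" and f :: "'b \<Rightarrow> 'c::t2_space"
  assumes "compact S" "continuous_on S e" "continuous_on S (f \<circ> e)"
  shows "continuous_on (e ` S) f"
proof -
  have "closedin (top_of_set (e ` S)) (e ` S \<inter> f -` C)" if "closed C" for C
  proof -
    have "closedin (top_of_set S) (S \<inter> (f \<circ> e) -` C)"
      using assms(3) that continuous_on_closed_vimage[of S "f \<circ> e"]
      by (meson continuous_closedin_preimage)
    then have "compact (S \<inter> (f \<circ> e) -` C)"
      using assms(1) closedin_compact by blast
    then have "compact (e ` (S \<inter> (f \<circ> e) -` C))"
      by (meson assms(2) compact_continuous_image continuous_on_subset inf_le1)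
    moreover have "e ` (S \<inter> (f \<circ> e) -` C) = e ` S \<inter> f -` C" by auto
    ultimately show ?thesis
      by (metis closed_subset compact_imp_closed inf_le1)
  qed
  then show ?thesis
    by (simp add: continuous_closedin_preimage_eq)
qed

lemma compact_circles: "compact (circles D)"
  unfolding circles_def by (intro compact_Times) (auto intro: finite_imp_compact)

lemma transverse_double_pointE:
  assumes "transverse_double_point D x"
  obtains z w N M U h k where
       "z \<noteq> w" "z \<in> N" "w \<in> M" "curve D z = x" "curve D w = x" "x \<in> U"
       "openin (top_of_set (circles D)) N" "openin (top_of_set (circles D)) M"
       "inj_on (curve D) N" "inj_on (curve D) M"
       "open U" "{v \<in> circles D. curve D v \<in> U} = N \<union> M"
       "homeomorphism U (ball (0::complex) 1) h k"
       "h ` curve D ` N = {u \<in> ball 0 1. Im u = 0}"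
       "h ` curve D ` M = {u \<in> ball 0 1. Re u = 0}"
proof -
  from assms show thesis unfolding transverse_double_point_def
    by (elim exE conjE) (rule that)
qed

text \<open>
  Local injectivity comes for free: away from the crossings it holds on the whole open set of
  parameters lying over the complement of the finite set of crossings, and at a crossing it is part
  of transversality.
\<close>

lemma generic_immersionI:
  assumes "continuous_on (circles D) (curve D)" "finite (crossings D)"
    "\<And>x. x \<in> crossings D \<Longrightarrow> transverse_double_point D x"
  shows "generic_immersion D"
proof -
  have "\<exists>N. openin (top_of_set (circles D)) N \<and> z \<in> N \<and> inj_on (curve D) N" if z: "z \<in> circles D" for z
  proof (cases "curve D z \<in> crossings D")
    case True
    show ?thesis
    proof (rule transverse_double_pointE[OF assms(3)[OF True]])
      fix N M U
      assume *: "openin (top_of_set (circles D)) N" "openin (top_of_set (circles D)) M"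
       "inj_on (curve D) N" "inj_on (curve D) M" "curve D z \<in> U"
       "{v \<in> circles D. curve D v \<in> U} = N \<union> M"
      then have "z \<in> N \<or> z \<in> M" using z by blast
      then show ?thesis using * by blast
    qed
  next
    case False
    let ?N = "circles D \<inter> curve D -` (- crossings D)"
    have "open (- crossings D)" using assms(2) by (simp add: finite_imp_closed open_Compl)
    then have "openin (top_of_set (circles D)) ?N"
      using assms(1) continuous_openin_preimage_gen by blast
    moreover have "inj_on (curve D) ?N"
      unfolding inj_on_def crossings_def by blast
    ultimately show ?thesis using False z by blast
  qed
  then show ?thesis unfolding generic_immersion_def using assms by blast
qed

text \<open>
  The chart of a transverse double point can be restricted to a round ball around the origin and
  rescaled, because the two axes are invariant under scaling.  Hence transversality is a local
  property in the plane.
\<close>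

lemma transverse_shrink:
  assumes "transverse_double_point D x" "open V" "x \<in> V" and cont: "continuous_on (circles D) (curve D)"
  obtains z w N M U h k where
       "z \<noteq> w" "z \<in> N" "w \<in> M" "curve D z = x" "curve D w = x" "x \<in> U" "U \<subseteq> V"
       "openin (top_of_set (circles D)) N" "openin (top_of_set (circles D)) M"
       "inj_on (curve D) N" "inj_on (curve D) M"
       "open U" "{v \<in> circles D. curve D v \<in> U} = N \<union> M"
       "homeomorphism U (ball (0::complex) 1) h k"
       "h ` curve D ` N = {u \<in> ball 0 1. Im u = 0}"
       "h ` curve D ` M = {u \<in> ball 0 1. Re u = 0}" "h x = 0"
proof -
  from assms(1) obtain z w N M U h k where *:
       "z \<noteq> w" "z \<in> N" "w \<in> M" "curve D z = x" "curve D w = x" "x \<in> U"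
       "openin (top_of_set (circles D)) N" "openin (top_of_set (circles D)) M"
       "inj_on (curve D) N" "inj_on (curve D) M"
       "open U" "{v \<in> circles D. curve D v \<in> U} = N \<union> M"
       "homeomorphism U (ball (0::complex) 1) h k"
       "h ` curve D ` N = {u \<in> ball 0 1. Im u = 0}"
       "h ` curve D ` M = {u \<in> ball 0 1. Re u = 0}"
    by (rule transverse_double_pointE)
  have "h x \<in> h ` curve D ` N" using imageI[OF imageI[OF *(2), of "curve D"], of h] *(4) by simp
  moreover have "h x \<in> h ` curve D ` M" using imageI[OF imageI[OF *(3), of "curve D"], of h] *(5) by simp
  ultimately have hx: "h x = 0" using *(14,15) by (simp add: complex_eq_iff)
  have hU: "h ` U = ball 0 1" "k ` ball 0 1 = U" using *(13) by (auto simp: homeomorphism_def)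
  have kh: "k (h y) = y" if "y \<in> U" for y using *(13) that by (auto simp: homeomorphism_def)
  have hk: "h (k y) = y" if "y \<in> ball 0 1" for y using *(13) that by (auto simp: homeomorphism_def)
  have "openin (top_of_set U) (U \<inter> V)" using assms(2) by (simp add: openin_open_Int)
  then have "openin (top_of_set (ball 0 1)) (h ` (U \<inter> V))"
    using *(13) homeomorphism_imp_open_map by blast
  then have "open (h ` (U \<inter> V))" by (simp add: openin_open_eq)
  moreover have "0 \<in> h ` (U \<inter> V)" using hx *(6) assms(3) by force
  ultimately obtain r0 where r0: "r0 > 0" "ball 0 r0 \<subseteq> h ` (U \<inter> V)"
    using open_contains_ball by blast
  have r0s: "ball 0 r0 \<subseteq> (ball 0 1 :: complex set)" using r0(2) hU by blast
  define r where "r = min r0 1"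
  have r: "r > 0" "r \<le> 1" "ball 0 r \<subseteq> h ` (U \<inter> V)" using r0 by (auto simp: r_def)
  define U' where "U' = k ` ball 0 r"
  define h' where "h' = (\<lambda>y. h y /\<^sub>R r)"
  define k' where "k' = (\<lambda>y. k (r *\<^sub>R y))"
  have rb: "ball 0 r \<subseteq> (ball 0 1::complex set)" using r by auto
  have U'eq: "U' = {y \<in> U. h y \<in> ball 0 r}"
  proof
    show "U' \<subseteq> {y \<in> U. h y \<in> ball 0 r}"
    proof
      fix y assume "y \<in> U'"
      then obtain v where v: "v \<in> ball 0 r" "y = k v" unfolding U'_def by blast
      then have "v \<in> ball 0 1" using rb by blast
      then show "y \<in> {y \<in> U. h y \<in> ball 0 r}" using v hk hU by auto
    qed
    show "{y \<in> U. h y \<in> ball 0 r} \<subseteq> U'"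
    proof
      fix y assume "y \<in> {y \<in> U. h y \<in> ball 0 r}"
      then show "y \<in> U'" unfolding U'_def using kh by (metis (mono_tags, lifting) imageI mem_Collect_eq)
    qed
  qed
  have "open U'"
  proof -
    have "openin (top_of_set U) U'" unfolding U'_def
      by (rule homeomorphism_imp_open_map[OF homeomorphism_symD[OF *(13)]])
         (use rb in \<open>simp add: open_subset\<close>)
    then show ?thesis using *(11) openin_open_trans by blast
  qed
  have U'V: "U' \<subseteq> V"
  proof
    fix y assume "y \<in> U'"
    then have y: "y \<in> U" "h y \<in> h ` (U \<inter> V)" unfolding U'eq using r(3) by blast+
    then obtain y' where "y' \<in> U" "y' \<in> V" "h y = h y'" by blast
    then show "y \<in> V" using kh y(1) by metis
  qed
  have U'U: "U' \<subseteq> U" unfolding U'eq by blast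
  have hom: "homeomorphism U' (ball 0 1) h' k'"
  proof -
    have a: "r *\<^sub>R y \<in> ball 0 r" if "y \<in> ball 0 1" for y :: complex using that r by simp
    have b: "inverse r *\<^sub>R y \<in> ball 0 1" if "y \<in> ball 0 r" for y :: complex using that r by (simp add: field_simps)
    have ch: "continuous_on U' h'" unfolding h'_def
      using *(13) U'U by (intro continuous_intros) (auto simp: homeomorphism_def intro: continuous_on_subset)
    have ck: "continuous_on (ball 0 1) k'" unfolding k'_def
      by (rule continuous_on_compose2[of "ball 0 1" k])
         (use *(13) a rb in \<open>auto simp: homeomorphism_def intro!: continuous_intros\<close>)
    show ?thesis
      unfolding homeomorphism_def
    proof (intro conjI ballI)
      show "h' ` U' = ball 0 1"
      proof
        show "h' ` U' \<subseteq> ball 0 1" unfolding h'_def U'eq using b by auto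
        show "ball 0 1 \<subseteq> h' ` U'"
        proof
          fix y :: complex assume y: "y \<in> ball 0 1"
          have "r *\<^sub>R y \<in> ball 0 1" using a[OF y] rb by blast
          then have "h' (k (r *\<^sub>R y)) = y" unfolding h'_def using hk r by simp
          then show "y \<in> h' ` U'" using a[OF y] unfolding U'_def by (metis imageI)
        qed
      qed
      show "k' ` ball 0 1 = U'"
      proof
        show "k' ` ball 0 1 \<subseteq> U'" unfolding k'_def U'_def using a by blast
        show "U' \<subseteq> k' ` ball 0 1"
        proof
          fix y assume "y \<in> U'"
          then obtain v where v: "v \<in> ball 0 r" "y = k v" unfolding U'_def by blast
          then have "k' (inverse r *\<^sub>R v) = y" unfolding k'_def using r by simp
          then show "y \<in> k' ` ball 0 1" using b[OF v(1)] by blast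
        qed
      qed
      fix y assume "y \<in> U'" then show "k' (h' y) = y" unfolding k'_def h'_def using r U'U kh by auto
    next
      fix y :: complex assume "y \<in> ball 0 1"
      then have "r *\<^sub>R y \<in> ball 0 1" using a rb by blast
      then show "h' (k' y) = y" unfolding k'_def h'_def using hk r by simp
    qed (use ch ck in auto)
  qed
  define N' where "N' = N \<inter> {v\<in>circles D. curve D v \<in> U'}"
  define M' where "M' = M \<inter> {v\<in>circles D. curve D v \<in> U'}"
  have op: "openin (top_of_set (circles D)) {v\<in>circles D. curve D v \<in> U'}"
    using continuous_openin_preimage_gen[OF cont \<open>open U'\<close>]
    by (simp add: Int_def vimage_def)
  have hN: "h ` curve D ` N = {u \<in> ball 0 1. Im u = 0}" "h ` curve D ` M = {u \<in> ball 0 1. Re u = 0}" by fact+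
  have NMU: "\<And>v. v \<in> N \<union> M \<Longrightarrow> v \<in> circles D \<and> curve D v \<in> U" using *(12) by blast
  have imN: "h' ` curve D ` (A \<inter> {v\<in>circles D. curve D v \<in> U'}) = {u \<in> ball 0 1. P u}"
    if A: "A \<subseteq> N \<union> M" and hA: "h ` curve D ` A = {u \<in> ball 0 1. P u}"
      and PP: "\<And>c u. c > 0 \<Longrightarrow> P (c *\<^sub>R u) = P u" for A P
  proof
    show "h' ` curve D ` (A \<inter> {v\<in>circles D. curve D v \<in> U'}) \<subseteq> {u \<in> ball 0 1. P u}"
    proof
      fix y assume "y \<in> h' ` curve D ` (A \<inter> {v\<in>circles D. curve D v \<in> U'})"
      then obtain v where v: "v \<in> A" "curve D v \<in> U'" "y = h' (curve D v)" by blast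
      have "h (curve D v) \<in> {u \<in> ball 0 1. P u}" using v hA by blast
      then have "P y" unfolding v(3) h'_def using PP r by simp
      then show "y \<in> {u \<in> ball 0 1. P u}" using hom v by (auto simp: homeomorphism_def)
    qed
    show "{u \<in> ball 0 1. P u} \<subseteq> h' ` curve D ` (A \<inter> {v\<in>circles D. curve D v \<in> U'})"
    proof
      fix y assume y: "y \<in> {u \<in> ball 0 1. P u}"
      then have ry: "r *\<^sub>R y \<in> ball 0 r" "P (r *\<^sub>R y)" using r PP by auto
      then have "r *\<^sub>R y \<in> {u \<in> ball 0 1. P u}" using rb by blast
      then have "r *\<^sub>R y \<in> h ` curve D ` A" using hA by simp
      then obtain v where v: "v \<in> A" "h (curve D v) = r *\<^sub>R y" by auto
      then have vN: "v \<in> circles D" "curve D v \<in> U" using A NMU by blast+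
      then have "curve D v \<in> U'" unfolding U'eq using ry v by simp
      moreover have "h' (curve D v) = y" unfolding h'_def using v r by simp
      ultimately show "y \<in> h' ` curve D ` (A \<inter> {v\<in>circles D. curve D v \<in> U'})" using v(1) vN(1) by blast
    qed
  qed
  have zw: "z \<in> circles D" "w \<in> circles D" using NMU *(2,3) by blast+
  have xU': "x \<in> U'" unfolding U'eq using *(6) hx r by simp
  show thesis
  proof (rule that[of z w N' M' U' h' k'])
    show "z \<in> N'" "w \<in> M'" unfolding N'_def M'_def using *(2-5) zw xU' by auto
    show "openin (top_of_set (circles D)) N'" "openin (top_of_set (circles D)) M'"
      unfolding N'_def M'_def using op *(7,8) by auto
    show "inj_on (curve D) N'" "inj_on (curve D) M'" unfolding N'_def M'_def using *(9,10) by (auto intro: inj_on_subset)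
    show "{v \<in> circles D. curve D v \<in> U'} = N' \<union> M'" unfolding N'_def M'_def using *(12) U'U by blast
    show "h' ` curve D ` N' = {u \<in> ball 0 1. Im u = 0}"
      unfolding N'_def by (rule imN) (use hN in auto)
    show "h' ` curve D ` M' = {u \<in> ball 0 1. Re u = 0}"
      unfolding M'_def by (rule imN) (use hN in auto)
    show "h' x = 0" unfolding h'_def hx by simp
  qed (fact *(1) *(4) *(5) U'V xU' \<open>open U'\<close> hom)+
qed

lemma transverse_transfer:
  assumes T: "transverse_double_point D x" and V: "open V" "x \<in> V"
    and cD: "continuous_on (circles D) (curve D)" and cE: "continuous_on (circles E) (curve E)"
    and hom: "homeomorphism {z \<in> circles D. curve D z \<in> V} {z \<in> circles E. curve E z \<in> V} f g"
    and eq: "\<And>z. z \<in> circles D \<Longrightarrow> curve D z \<in> V \<Longrightarrow> curve E (f z) = curve D z"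
  shows "transverse_double_point E x"
proof -
  obtain z w N M U h k where *:
       "z \<noteq> w" "z \<in> N" "w \<in> M" "curve D z = x" "curve D w = x" "x \<in> U" "U \<subseteq> V"
       "openin (top_of_set (circles D)) N" "openin (top_of_set (circles D)) M"
       "inj_on (curve D) N" "inj_on (curve D) M"
       "open U" "{v \<in> circles D. curve D v \<in> U} = N \<union> M"
       "homeomorphism U (ball (0::complex) 1) h k"
       "h ` curve D ` N = {u \<in> ball 0 1. Im u = 0}"
       "h ` curve D ` M = {u \<in> ball 0 1. Re u = 0}"
    by (rule transverse_shrink[OF T V cD])
  let ?S = "{z \<in> circles D. curve D z \<in> V}" and ?S' = "{z \<in> circles E. curve E z \<in> V}"
  have f: "f ` ?S = ?S'" "\<And>v. v \<in> ?S \<Longrightarrow> g (f v) = v" "\<And>v. v \<in> ?S' \<Longrightarrow> f (g v) = v" "g ` ?S' = ?S"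
    using hom by (auto simp: homeomorphism_def)
  have NM: "N \<union> M \<subseteq> ?S" using *(7,13) by blast
  have NS: "N \<subseteq> ?S" and MS: "M \<subseteq> ?S" using NM by blast+
  have opS': "openin (top_of_set (circles E)) ?S'"
    using continuous_openin_preimage_gen[OF cE V(1)] by (simp add: Int_def vimage_def)
  have op: "openin (top_of_set (circles E)) (f ` A)" if "openin (top_of_set (circles D)) A" "A \<subseteq> ?S" for A
  proof -
    have "openin (top_of_set ?S) A" using that openin_subset_trans by blast
    then have "openin (top_of_set ?S') (f ` A)" using hom homeomorphism_imp_open_map by blast
    then show ?thesis using opS' openin_trans by blast
  qed
  have inj: "inj_on (curve E) (f ` A)" if "inj_on (curve D) A" "A \<subseteq> ?S" for A
  proof -
    have "curve E (f v) = curve D v" if "v \<in> A" for v using that \<open>A \<subseteq> ?S\<close> eq by blast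
    then show ?thesis using that(1) unfolding inj_on_def by (metis (no_types) imageE)
  qed
  have im: "curve E ` f ` A = curve D ` A" if "A \<subseteq> ?S" for A
  proof -
    have "curve E (f v) = curve D v" if "v \<in> A" for v using that \<open>A \<subseteq> ?S\<close> eq by blast
    then show ?thesis by (simp add: image_image cong: image_cong)
  qed
  have all: "{v \<in> circles E. curve E v \<in> U} = f ` N \<union> f ` M"
  proof -
    have "{v \<in> circles E. curve E v \<in> U} = f ` {v \<in> circles D. curve D v \<in> U}"
    proof
      show "f ` {v \<in> circles D. curve D v \<in> U} \<subseteq> {v \<in> circles E. curve E v \<in> U}"
      proof
        fix v assume "v \<in> f ` {v \<in> circles D. curve D v \<in> U}"
        then obtain u where u: "u \<in> circles D" "curve D u \<in> U" "v = f u" by blast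
        then have "u \<in> ?S" using *(7) by blast
        then have "v \<in> ?S'" using f(1) u(3) by blast
        moreover have "curve E v = curve D u" using eq[of u] u \<open>u \<in> ?S\<close> by simp
        ultimately show "v \<in> {v \<in> circles E. curve E v \<in> U}" using u by simp
      qed
      show "{v \<in> circles E. curve E v \<in> U} \<subseteq> f ` {v \<in> circles D. curve D v \<in> U}"
      proof
        fix v assume v: "v \<in> {v \<in> circles E. curve E v \<in> U}"
        then have "v \<in> ?S'" using *(7) by auto
        then have g: "g v \<in> ?S" "f (g v) = v" using f(3,4) by blast+
        then have "curve D (g v) = curve E v" using eq[of "g v"] by simp
        then have "g v \<in> {v \<in> circles D. curve D v \<in> U}" using g v by simp
        then show "v \<in> f ` {v \<in> circles D. curve D v \<in> U}" using g(2) by (metis imageI)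
      qed
    qed
    then show ?thesis unfolding *(13) image_Un .
  qed
  show ?thesis unfolding transverse_double_point_def
  proof (intro exI conjI)
    show "f z \<noteq> f w" using *(1) f(2)[of z] f(2)[of w] subsetD[OF NS *(2)] subsetD[OF MS *(3)] by metis
    show "f z \<in> f ` N" "f w \<in> f ` M" using *(2,3) by auto
    show "curve E (f z) = x" "curve E (f w) = x" using *(4,5) eq[of z] eq[of w] subsetD[OF NS *(2)] subsetD[OF MS *(3)] by simp_all
    show "homeomorphism U (ball (0::complex) 1) h k" by fact
    show "x \<in> U" "open U" by fact+
    show "openin (top_of_set (circles E)) (f ` N)" "openin (top_of_set (circles E)) (f ` M)"
      using op[OF *(8) NS] op[OF *(9) MS] .
    show "inj_on (curve E) (f ` N)" "inj_on (curve E) (f ` M)" using inj[OF *(10) NS] inj[OF *(11) MS] .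
    show "{v \<in> circles E. curve E v \<in> U} = f ` N \<union> f ` M" by fact
    show "h ` curve E ` f ` N = {u \<in> ball 0 1. Im u = 0}" "h ` curve E ` f ` M = {u \<in> ball 0 1. Re u = 0}"
      by (simp_all only: im[OF NS] im[OF MS] *(15,16))
  qed
qed

lemma homeomorphism_apply:
  assumes "homeomorphism S T f g"
  shows "x \<in> S \<Longrightarrow> f x \<in> T" "x \<in> S \<Longrightarrow> g (f x) = x" "y \<in> T \<Longrightarrow> g y \<in> S" "y \<in> T \<Longrightarrow> f (g y) = y"
  using assms unfolding homeomorphism_def by blast+

lemma agree_outsideE:
  assumes "agree_outside B D E"
  obtains f g where
    "homeomorphism {z \<in> circles D. curve D z \<notin> interior B} {z \<in> circles E. curve E z \<notin> interior B} f g"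
    "\<And>z. z \<in> circles D \<Longrightarrow> curve D z \<notin> interior B \<Longrightarrow> curve E (f z) = curve D z"
    "\<And>z. z \<in> circles D \<Longrightarrow> curve D z \<notin> interior B \<Longrightarrow> f z \<in> overs E \<longleftrightarrow> z \<in> overs D"
    "virtuals E - interior B = virtuals D - interior B"
proof -
  from assms show thesis unfolding agree_outside_def
    by (elim exE conjE) (rule that, assumption, simp_all)
qed

lemma agree_outside_sym:
  assumes "agree_outside B D E" shows "agree_outside B E D"
proof (rule agree_outsideE[OF assms])
  fix f g
  assume h: "homeomorphism {z \<in> circles D. curve D z \<notin> interior B} {z \<in> circles E. curve E z \<notin> interior B} f g"
    and e: "\<And>z. z \<in> circles D \<Longrightarrow> curve D z \<notin> interior B \<Longrightarrow> curve E (f z) = curve D z"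
    and o: "\<And>z. z \<in> circles D \<Longrightarrow> curve D z \<notin> interior B \<Longrightarrow> f z \<in> overs E \<longleftrightarrow> z \<in> overs D"
    and v: "virtuals E - interior B = virtuals D - interior B"
  have g: "g z \<in> circles D \<and> curve D (g z) \<notin> interior B \<and> f (g z) = z"
    if "z \<in> circles E" "curve E z \<notin> interior B" for z
    using homeomorphism_apply(3,4)[OF h, of z] that by simp
  have "curve D (g z) = curve E z \<and> (g z \<in> overs D \<longleftrightarrow> z \<in> overs E)"
    if "z \<in> circles E" "curve E z \<notin> interior B" for z
    using g[OF that] e[of "g z"] o[of "g z"] by simp
  then show ?thesis unfolding agree_outside_def using homeomorphism_symD[OF h] v by blast
qed

text \<open>
  All modifications made below, except for the reconnection at a crossing, keep the parameters, so the identity serves as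
  the homeomorphism of parameters.
\<close>

lemma agree_outside_same_parameters:
  assumes "circles E = circles D"
    and "\<And>z. z \<in> circles D \<Longrightarrow> curve D z \<notin> interior B \<Longrightarrow> z \<in> overs E \<longleftrightarrow> z \<in> overs D"
    and "\<And>z. z \<in> circles D \<Longrightarrow> curve D z \<notin> interior B \<longleftrightarrow> curve E z \<notin> interior B"
    and "\<And>z. z \<in> circles D \<Longrightarrow> curve D z \<notin> interior B \<Longrightarrow> curve E z = curve D z"
    and "virtuals E - interior B = virtuals D - interior B"
  shows "agree_outside B D E"
proof -
  have eq: "{z \<in> circles E. curve E z \<notin> interior B} = {z \<in> circles D. curve D z \<notin> interior B}"
    using assms(1,3) by blast
  show ?thesis unfolding agree_outside_def eq
    by (rule exI[of _ id], rule exI[of _ id]) (use assms in \<open>auto simp: homeomorphism_def\<close>)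
qed

lemma agree_outside_crossings:
  assumes "agree_outside B D E"
  shows "crossings E - interior B = crossings D - interior B"
proof -
  have *: "crossings E - interior B \<subseteq> crossings D - interior B" if "agree_outside B D E" for D E
  proof (rule agree_outsideE[OF that])
    fix f g
    assume h: "homeomorphism {z \<in> circles D. curve D z \<notin> interior B} {z \<in> circles E. curve E z \<notin> interior B} f g"
      and e: "\<And>z. z \<in> circles D \<Longrightarrow> curve D z \<notin> interior B \<Longrightarrow> curve E (f z) = curve D z"
    have g: "g z \<in> circles D \<and> curve D (g z) \<notin> interior B \<and> f (g z) = z \<and> curve D (g z) = curve E z"
      if "z \<in> circles E" "curve E z \<notin> interior B" for z
    proof -
      have "g z \<in> circles D" "curve D (g z) \<notin> interior B" "f (g z) = z"
        using homeomorphism_apply(3,4)[OF h, of z] that by simp_all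
      then show ?thesis using e[of "g z"] by simp
    qed
    show "crossings E - interior B \<subseteq> crossings D - interior B"
    proof
      fix x assume "x \<in> crossings E - interior B"
      then obtain z w where zw: "z \<in> circles E" "w \<in> circles E" "z \<noteq> w" "curve E z = x" "curve E w = x" "x \<notin> interior B"
        unfolding crossings_def by blast
      then have "g z \<noteq> g w" using g by metis
      moreover have "g z \<in> circles D" "g w \<in> circles D" "curve D (g z) = x" "curve D (g w) = x"
        using zw g[of z] g[of w] by simp_all
      ultimately have "x \<in> crossings D" unfolding crossings_def by blast
      then show "x \<in> crossings D - interior B" using zw(6) by simp
    qed
  qed
  show ?thesis using *[OF assms] *[OF agree_outside_sym[OF assms]] by blast
qed

lemma virtual_link_diagramD:
  assumes "virtual_link_diagram D"
  shows "continuous_on (circles D) (curve D)" "finite (crossings D)"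
    "\<And>x. x \<in> crossings D \<Longrightarrow> transverse_double_point D x"
    "virtuals D \<subseteq> crossings D" "overs D \<subseteq> {z \<in> circles D. curve D z \<in> crossings D - virtuals D}"
    "\<And>x. x \<in> crossings D - virtuals D \<Longrightarrow> \<exists>!z. z \<in> overs D \<and> curve D z = x"
  using assms unfolding virtual_link_diagram_def generic_immersion_def by blast+

text \<open>
  The disk may contain only virtual crossings of the new diagram; then the over-information at the
  classical crossings is inherited from the old one, and only the transversality of the crossings
  inside the disk has to be checked.
\<close>

lemma virtual_link_diagram_agree:
  assumes D: "virtual_link_diagram D" and ag: "agree_outside B D E" and B: "closed B"
    and cE: "continuous_on (circles E) (curve E)"
    and fin: "finite (crossings E \<inter> B)" and tr: "\<And>x. x \<in> crossings E \<inter> B \<Longrightarrow> transverse_double_point E x"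
    and virt: "crossings E \<inter> B = virtuals E \<inter> B"
    and ov: "\<And>z. z \<in> overs E \<Longrightarrow> z \<in> circles E \<and> curve E z \<notin> B"
  shows "virtual_link_diagram E"
proof (rule agree_outsideE[OF ag])
  fix f g
  assume h: "homeomorphism {z \<in> circles D. curve D z \<notin> interior B} {z \<in> circles E. curve E z \<notin> interior B} f g"
    and e: "\<And>z. z \<in> circles D \<Longrightarrow> curve D z \<notin> interior B \<Longrightarrow> curve E (f z) = curve D z"
    and o: "\<And>z. z \<in> circles D \<Longrightarrow> curve D z \<notin> interior B \<Longrightarrow> f z \<in> overs E \<longleftrightarrow> z \<in> overs D"
    and v: "virtuals E - interior B = virtuals D - interior B"
  note Dv = virtual_link_diagramD[OF D]
  have cr: "crossings E - interior B = crossings D - interior B" by (rule agree_outside_crossings[OF ag])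
  have iB: "interior B \<subseteq> B" by (rule interior_subset)
  have "crossings E \<subseteq> crossings D \<union> (crossings E \<inter> B)" using cr iB by blast
  then have finE: "finite (crossings E)" using Dv(2) fin finite_subset by blast
  have fim: "f ` {z \<in> circles D. curve D z \<in> - B} = {z \<in> circles E. curve E z \<in> - B}"
  proof
    show "f ` {z \<in> circles D. curve D z \<in> - B} \<subseteq> {z \<in> circles E. curve E z \<in> - B}"
    proof
      fix y assume "y \<in> f ` {z \<in> circles D. curve D z \<in> - B}"
      then obtain z where z: "z \<in> circles D" "curve D z \<notin> B" "y = f z" by blast
      then have "curve D z \<notin> interior B" using iB by blast
      then have "f z \<in> circles E" "curve E (f z) = curve D z"
        using homeomorphism_apply(1)[OF h, of z] z e by simp_all
      then show "y \<in> {z \<in> circles E. curve E z \<in> - B}" using z by simp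
    qed
    show "{z \<in> circles E. curve E z \<in> - B} \<subseteq> f ` {z \<in> circles D. curve D z \<in> - B}"
    proof
      fix y assume y: "y \<in> {z \<in> circles E. curve E z \<in> - B}"
      then have "y \<in> {z \<in> circles E. curve E z \<notin> interior B}" using iB by blast
      then have "y \<in> f ` {z \<in> circles D. curve D z \<notin> interior B}" using h by (simp add: homeomorphism_def)
      then obtain z where z: "z \<in> circles D" "curve D z \<notin> interior B" "y = f z" by blast
      then have "curve D z \<in> - B" using e[OF z(1,2)] y by simp
      then show "y \<in> f ` {z \<in> circles D. curve D z \<in> - B}" using z by blast
    qed
  qed
  have hV: "homeomorphism {z \<in> circles D. curve D z \<in> - B} {z \<in> circles E. curve E z \<in> - B} f g"
    by (rule homeomorphism_of_subsets[OF h _ _ fim]) (use iB in blast)+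
  have trE: "transverse_double_point E x" if x: "x \<in> crossings E" for x
  proof (cases "x \<in> B")
    case True then show ?thesis using tr x by blast
  next
    case False
    then have "x \<in> crossings D" using cr x iB by blast
    moreover have "curve E (f z) = curve D z" if "z \<in> circles D" "curve D z \<in> - B" for z
      using e[of z] that iB by blast
    ultimately show ?thesis
      using transverse_transfer[OF Dv(3) _ _ Dv(1) cE hV] False B by (simp add: open_Compl)
  qed
  have gi: "generic_immersion E" by (rule generic_immersionI[OF cE finE trE])
  have vE: "virtuals E \<subseteq> crossings E" using virt v cr Dv(4) iB by blast
  have fg: "\<exists>z'. z' \<in> circles D \<and> curve D z' = curve E z \<and> z = f z' \<and> (z \<in> overs E \<longleftrightarrow> z' \<in> overs D)"
    if z: "z \<in> circles E" "curve E z \<notin> interior B" for z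
  proof -
    have "z \<in> f ` {z \<in> circles D. curve D z \<notin> interior B}" using h z by (simp add: homeomorphism_def)
    then obtain z' where "z' \<in> circles D" "curve D z' \<notin> interior B" "z = f z'" by blast
    then show ?thesis using e[of z'] o[of z'] by (intro exI[of _ z']) simp
  qed
  have oE: "overs E \<subseteq> {z \<in> circles E. curve E z \<in> crossings E - virtuals E}"
  proof
    fix z assume z: "z \<in> overs E"
    then have zE: "z \<in> circles E" "curve E z \<notin> B" using ov by blast+
    then obtain z' where z': "curve D z' = curve E z" "z' \<in> overs D" using fg[of z] z iB by blast
    then have "curve E z \<in> crossings D - virtuals D" using Dv(5) by (metis (no_types, lifting) mem_Collect_eq subsetD)
    then show "z \<in> {z \<in> circles E. curve E z \<in> crossings E - virtuals E}" using zE cr v iB by blast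
  qed
  have uE: "\<exists>!z. z \<in> overs E \<and> curve E z = x" if x: "x \<in> crossings E - virtuals E" for x
  proof -
    have xB: "x \<notin> B" using x virt by blast
    then have xi: "x \<notin> interior B" using iB by blast
    have "x \<in> crossings D - virtuals D" using x xi cr v by blast
    then obtain z where z: "z \<in> overs D" "curve D z = x" and uq: "\<And>w. w \<in> overs D \<Longrightarrow> curve D w = x \<Longrightarrow> w = z"
      using Dv(6) by blast
    have "z \<in> circles D" using z Dv(5) by blast
    then have "f z \<in> overs E" "curve E (f z) = x" using e[of z] o[of z] z xi by simp_all
    moreover have "w = f z" if w: "w \<in> overs E" "curve E w = x" for w
    proof -
      have "w \<in> circles E" using ov w by blast
      then obtain w' where "curve D w' = x" "w = f w'" "w' \<in> overs D" using fg[of w] w xi by blast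
      then show ?thesis using uq by blast
    qed
    ultimately show ?thesis by blast
  qed
  show ?thesis unfolding virtual_link_diagram_def using gi vE oE uE by blast
qed

section \<open>Charts of the plane and tangles inside them\<close>

text \<open>
  By invariance of domain such a map is a homeomorphism onto an open set, hence no inverse needs
  to be carried along.
\<close>

definition plane_chart :: "complex set \<Rightarrow> (complex \<Rightarrow> complex) \<Rightarrow> bool" where
  "plane_chart Q k \<longleftrightarrow> open Q \<and> continuous_on Q k \<and> inj_on k Q"

lemma plane_chart_open: "plane_chart Q k \<Longrightarrow> open V \<Longrightarrow> V \<subseteq> Q \<Longrightarrow> open (k ` V)"
  unfolding plane_chart_def
  by (meson continuous_on_subset inj_on_subset invariance_of_domain)

lemma plane_chart_mem: "plane_chart Q k \<Longrightarrow> A \<subseteq> Q \<Longrightarrow> x \<in> Q \<Longrightarrow> k x \<in> k ` A \<longleftrightarrow> x \<in> A"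
  unfolding plane_chart_def by (meson inj_on_image_mem_iff)

lemma plane_chart_inj: "plane_chart Q k \<Longrightarrow> x \<in> Q \<Longrightarrow> y \<in> Q \<Longrightarrow> k x = k y \<longleftrightarrow> x = y"
  unfolding plane_chart_def by (meson inj_on_eq_iff)

lemma plane_chart_interior:
  assumes "plane_chart Q k" "C \<subseteq> Q"
  shows "interior (k ` C) = k ` interior C"
proof
  have iC: "interior C \<subseteq> C" by (rule interior_subset)
  show "k ` interior C \<subseteq> interior (k ` C)"
    by (rule interior_maximal) (use assms iC plane_chart_open in \<open>auto simp: subset_eq\<close>)
  have o: "open (Q \<inter> k -` interior (k ` C))"
    using assms(1) unfolding plane_chart_def by (auto intro: continuous_open_preimage)
  have "Q \<inter> k -` interior (k ` C) \<subseteq> C"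
  proof
    fix x assume x: "x \<in> Q \<inter> k -` interior (k ` C)"
    then have "k x \<in> k ` C" using interior_subset by blast
    then show "x \<in> C" using plane_chart_mem[OF assms, of x] x by simp
  qed
  then have "Q \<inter> k -` interior (k ` C) \<subseteq> interior C" using o interior_maximal by blast
  moreover have "interior (k ` C) \<subseteq> k ` Q" using assms(2) interior_subset by blast
  ultimately show "interior (k ` C) \<subseteq> k ` interior C" by blast
qed

lemma plane_chart_compact:
  assumes "plane_chart Q k" "C \<subseteq> Q" "compact C"
  shows "compact (k ` C)"
  using assms unfolding plane_chart_def by (meson compact_continuous_image continuous_on_subset)

lemma plane_chart_frontier:
  assumes "plane_chart Q k" "C \<subseteq> Q" "compact C"
  shows "frontier (k ` C) = k ` frontier C"
proof -
  have cC: "closed C" "closed (k ` C)"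
    using assms plane_chart_compact compact_imp_closed by blast+
  have "k ` (C - interior C) = k ` C - k ` interior C"
    using assms(1,2) interior_subset[of C] unfolding plane_chart_def by (auto simp: inj_on_def subset_iff)
  then show ?thesis unfolding frontier_def using cC plane_chart_interior[OF assms(1,2)] by simp
qed

lemma plane_chart_disk:
  assumes "plane_chart Q k" "C \<subseteq> Q" "compact C" "convex C" "interior C \<noteq> {}"
  shows "k ` C homeomorphic cball (0::complex) 1"
proof -
  have "C homeomorphic k ` C"
    using assms(1-3) unfolding plane_chart_def
    by (meson homeomorphic_compact continuous_on_subset inj_on_subset)
  moreover have "C homeomorphic cball (0::complex) 1"
    using assms(3-5) by (simp add: homeomorphic_convex_compact_cball)
  ultimately show ?thesis using homeomorphic_sym homeomorphic_trans by blast
qed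

text \<open>
  Where there are no crossings, a diagram is determined by its image in the plane: strands in the
  parameter circles can be recovered from arcs in the plane.
\<close>

lemma crossing_free_parametrisation:
  assumes D: "continuous_on (circles D) (curve D)" and c: "crossings D \<inter> B = {}" and B: "closed B"
  obtains v where "homeomorphism {z \<in> circles D. curve D z \<in> B} (curve D ` circles D \<inter> B) (curve D) v"
proof -
  let ?Z = "{z \<in> circles D. curve D z \<in> B}"
  have Z: "?Z = circles D \<inter> curve D -` B" by blast
  have "closedin (top_of_set (circles D)) ?Z"
    unfolding Z using D B continuous_closedin_preimage by blast
  then have "compact ?Z" using compact_circles closedin_compact by blast
  moreover have "continuous_on ?Z (curve D)" by (rule continuous_on_subset[OF D]) blast
  moreover have "inj_on (curve D) ?Z"
  proof (rule inj_onI)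
    fix z w assume *: "z \<in> ?Z" "w \<in> ?Z" "curve D z = curve D w"
    show "z = w"
    proof (rule ccontr)
      assume "z \<noteq> w"
      then have "curve D z \<in> crossings D" using * unfolding crossings_def by auto
      then show False using c * by blast
    qed
  qed
  moreover have "curve D ` ?Z = curve D ` circles D \<inter> B" by blast
  ultimately obtain v where "homeomorphism ?Z (curve D ` circles D \<inter> B) (curve D) v"
    using homeomorphism_compact by blast
  then show thesis by (rule that)
qed

text \<open>
  This reduces the tangle condition, which speaks of arcs in the parameter circles, to a statement on
  arcs in a convex subset of a chart.
\<close>

lemma tangle_of_arcs:
  assumes D: "continuous_on (circles D) (curve D)"
    and k: "plane_chart Q k" "C \<subseteq> Q" "compact C" "convex C" "interior C \<noteq> {}"
    and c: "crossings D \<inter> k ` C = {}"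
    and g: "\<And>i. i < m \<Longrightarrow> arc (g i)" "\<And>i. i < m \<Longrightarrow> pathstart (g i) \<in> frontier C"
      "\<And>i. i < m \<Longrightarrow> pathfinish (g i) \<in> frontier C"
      "\<And>i t. i < m \<Longrightarrow> 0 < t \<Longrightarrow> t < 1 \<Longrightarrow> g i t \<in> interior C"
      "\<And>i j. i < m \<Longrightarrow> j < m \<Longrightarrow> i \<noteq> j \<Longrightarrow> path_image (g i) \<inter> path_image (g j) = {}"
    and im: "curve D ` circles D \<inter> k ` C = (\<Union>i<m. k ` path_image (g i))"
  obtains q where "tangle D (k ` C) m q" "\<And>i t. i < m \<Longrightarrow> 0 \<le> t \<Longrightarrow> t \<le> 1 \<Longrightarrow> curve D (q i t) = k (g i t)"
proof -
  let ?B = "k ` C"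
  let ?Z = "{z \<in> circles D. curve D z \<in> ?B}"
  have cl: "closed ?B" using plane_chart_compact[OF k(1-3)] compact_imp_closed by blast
  obtain v where v: "homeomorphism ?Z (curve D ` circles D \<inter> ?B) (curve D) v"
    by (rule crossing_free_parametrisation[OF D c cl])
  define q where "q i t = v (k (g i t))" for i t
  have gC: "path_image (g i) \<subseteq> C" if i: "i < m" for i
  proof
    fix x assume "x \<in> path_image (g i)"
    then obtain t where t: "0 \<le> t" "t \<le> 1" "x = g i t" by (auto simp: path_image_def)
    have fC: "frontier C \<subseteq> C" "interior C \<subseteq> C"
      using k(3) by (simp_all add: frontier_subset_closed compact_imp_closed interior_subset)
    consider "t = 0" | "t = 1" | "0 < t" "t < 1" using t by linarith
    then show "x \<in> C"
    proof cases
      case 1 then show ?thesis using t g(2)[OF i] fC by (auto simp: pathstart_def)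
    next
      case 2 then show ?thesis using t g(3)[OF i] fC by (auto simp: pathfinish_def)
    next
      case 3 then show ?thesis using t g(4)[OF i] fC by blast
    qed
  qed
  have gim: "k (g i t) \<in> curve D ` circles D \<inter> ?B" if "i < m" "0 \<le> t" "t \<le> 1" for i t
  proof -
    have "g i t \<in> path_image (g i)" using that by (simp add: path_image_def)
    then show ?thesis unfolding im using that(1) by blast
  qed
  have qv: "curve D (q i t) = k (g i t)" if "i < m" "0 \<le> t" "t \<le> 1" for i t
    unfolding q_def by (rule homeomorphism_apply(4)[OF v gim[OF that]])
  have qpi: "path_image (q i) = v ` k ` path_image (g i)" for i
    by (auto simp: path_image_def q_def image_image)
  have vinj: "inj_on v (curve D ` circles D \<inter> ?B)"
    by (rule inj_on_inverseI[of _ "curve D"]) (rule homeomorphism_apply(4)[OF v])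
  have kinj: "inj_on k C" and kc: "continuous_on C k"
    using k(1,2) unfolding plane_chart_def by (auto intro: inj_on_subset continuous_on_subset)
  have kgs: "k ` path_image (g i) \<subseteq> curve D ` circles D \<inter> ?B" if "i < m" for i
    unfolding im using that by blast
  have qarc: "arc (q i)" if i: "i < m" for i
  proof -
    have gi: "continuous_on {0..1} (g i)" "inj_on (g i) {0..1}" using g(1)[OF i] by (auto simp: arc_def path_def)
    have a: "g i ` {0..1} \<subseteq> C" using gC[OF i] by (simp add: path_image_def)
    have "continuous_on {0..1} (\<lambda>t. k (g i t))"
      by (rule continuous_on_compose2[OF kc gi(1) a])
    note cont = continuous_on_compose2[OF homeomorphism_cont2[OF v] this]
    have "continuous_on {0..1} (\<lambda>t. v (k (g i t)))"
      by (rule cont) (rule image_subsetI, rule gim[OF i], simp_all)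
    moreover have "inj_on (q i) {0..1}"
    proof (rule inj_onI)
      fix s t assume st: "s \<in> {0..1}" "t \<in> {0..1}" "q i s = q i t"
      then have "k (g i s) = k (g i t)" using qv[OF i, of s] qv[OF i, of t] by simp
      moreover have "g i s \<in> C" "g i t \<in> C" using a st by blast+
      ultimately have "g i s = g i t" using kinj by (simp add: inj_on_eq_iff)
      then show "s = t" using gi(2) st by (simp add: inj_on_eq_iff)
    qed
    moreover have "q i = (\<lambda>t. v (k (g i t)))" by (rule ext) (simp add: q_def)
    ultimately show ?thesis unfolding arc_def path_def by metis
  qed
  have "tangle D ?B m q" unfolding tangle_def
  proof (intro conjI allI impI ballI)
    show "?B homeomorphic cball (0::complex) 1" by (rule plane_chart_disk[OF k])
    show "crossings D \<inter> frontier ?B = {}" using c cl frontier_subset_closed by blast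
    fix i assume i: "i < m"
    show "arc (q i)" by (rule qarc[OF i])
    have fr: "frontier ?B = k ` frontier C" by (rule plane_chart_frontier[OF k(1-3)])
    show "curve D (pathstart (q i)) \<in> frontier ?B"
      using qv[OF i, of 0] g(2)[OF i] unfolding fr by (simp add: pathstart_def)
    show "curve D (pathfinish (q i)) \<in> frontier ?B"
      using qv[OF i, of 1] g(3)[OF i] unfolding fr by (simp add: pathfinish_def)
    fix t :: real assume "t \<in> {0<..<1}"
    then show "curve D (q i t) \<in> interior ?B"
      using qv[OF i, of t] g(4)[OF i, of t] plane_chart_interior[OF k(1,2)] by simp
  next
    show "disjoint_family_on (\<lambda>i. path_image (q i)) {..<m}"
      unfolding disjoint_family_on_def
    proof (intro ballI impI)
      fix i j assume ij: "i \<in> {..<m}" "j \<in> {..<m}" "i \<noteq> j"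
      have "k ` path_image (g i) \<inter> k ` path_image (g j) = {}"
        using g(5)[of i j] ij gC[of i] gC[of j] kinj inj_on_image_Int[OF kinj, of "path_image (g i)" "path_image (g j)"] by simp
      then show "path_image (q i) \<inter> path_image (q j) = {}"
        unfolding qpi using kgs[of i] kgs[of j] ij
          inj_on_image_Int[OF vinj, of "k ` path_image (g i)" "k ` path_image (g j)"] by simp
    qed
    have "?Z = v ` (curve D ` circles D \<inter> ?B)" using homeomorphism_image2[OF v] by simp
    then show "?Z = (\<Union>i<m. path_image (q i))" unfolding im qpi by blast
  qed
  then show thesis using that qv by blast
qed

section \<open>Inserting a virtual kink\<close>

text \<open>
  The kink is the polygon with vertices \<open>(0,0)\<close>, \<open>(0,3)\<close>, \<open>(2,3)\<close>, \<open>(2,1)\<close>, \<open>(-2,1)\<close>, \<open>(-2,3)\<close>,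
  \<open>(0,8)\<close>; the third and later vertices are reached at the times \<open>4\<close>, \<open>5\<close>, \<open>6\<close>, \<open>7\<close>, \<open>8\<close>.  It
  crosses itself at \<open>\<i>\<close>, at the times \<open>1\<close> and \<open>11/2\<close>, along two axis-parallel segments.  Its part at
  height at most \<open>5/2\<close> is symmetric about the vertical axis: it consists of the first piece of the
  vertical strand and of the bridge under it.  In the strip of height \<open>2\<close> to \<open>5/2\<close> it consists of three
  vertical segments, at \<open>-2\<close>, \<open>0\<close> and \<open>2\<close>.
\<close>

definition kink_x :: "real \<Rightarrow> real" where
  "kink_x u = (if u \<le> 3 then 0 else if u \<le> 4 then 2 * (u - 3) else if u \<le> 5 then 2
     else if u \<le> 6 then 2 - 4 * (u - 5) else if u \<le> 7 then - 2 else 2 * (u - 7) - 2)"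

definition kink_y :: "real \<Rightarrow> real" where
  "kink_y u = (if u \<le> 3 then u else if u \<le> 4 then 3 else if u \<le> 5 then 3 - 2 * (u - 4)
     else if u \<le> 6 then 1 else if u \<le> 7 then 1 + 2 * (u - 6) else 3 + 5 * (u - 7))"

definition kink :: "real \<Rightarrow> complex" where
  "kink u = Complex (kink_x u) (kink_y u)"

definition kink_box :: "complex set" where
  "kink_box = cbox (Complex (-3) 0) (Complex 3 8)"

text \<open>
  The case distinctions are rewritten with minima and maxima, for which continuity is a matter of
  syntax.
\<close>

lemma continuous_kink: "continuous_on S kink"
proof -
  have 1: "kink_x = (\<lambda>u. 2 * max 0 (min 1 (u - 3)) - 4 * max 0 (min 1 (u - 5)) + 2 * max 0 (u - 7))"
    by (rule ext) (simp add: kink_x_def max_def min_def)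
  have 2: "kink_y = (\<lambda>u. min u 3 - 2 * max 0 (min 1 (u - 4)) + 2 * max 0 (min 1 (u - 6)) + 5 * max 0 (u - 7))"
    by (rule ext) (simp add: kink_y_def max_def min_def)
  have "continuous_on S (\<lambda>u. Complex (kink_x u) (kink_y u))"
    unfolding 1 2 by (intro continuous_intros)
  then show ?thesis unfolding kink_def .
qed

lemma kink_eq_iff:
  assumes "0 \<le> u" "u \<le> 8" "0 \<le> w" "w \<le> 8"
  shows "kink u = kink w \<longleftrightarrow> u = w \<or> (u = 1 \<and> w = 11/2) \<or> (u = 11/2 \<and> w = 1)"
proof
  assume "kink u = kink w"
  then have "kink_x u = kink_x w" "kink_y u = kink_y w" by (auto simp: kink_def)
  then show "u = w \<or> (u = 1 \<and> w = 11/2) \<or> (u = 11/2 \<and> w = 1)"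
    using assms unfolding kink_x_def kink_y_def by (auto split: if_splits)
qed (auto simp: kink_def kink_x_def kink_y_def)

lemma kink_ends: "kink 0 = Complex 0 0" "kink 8 = Complex 0 8" "kink 1 = \<i>" "kink (11/2) = \<i>"
  by (auto simp: kink_def kink_x_def kink_y_def complex_eq_iff)

lemma kink_inside: "0 < u \<Longrightarrow> u < 8 \<Longrightarrow> kink u \<in> box (Complex (-3) 0) (Complex 3 8)"
  by (auto simp: kink_def kink_x_def kink_y_def in_box_complex_iff)

lemma kink_in_box: "0 \<le> u \<Longrightarrow> u \<le> 8 \<Longrightarrow> kink u \<in> kink_box"
  by (auto simp: kink_def kink_x_def kink_y_def in_cbox_complex_iff kink_box_def)

lemma kink_near_crossing:
  assumes "0 \<le> u" "u \<le> 8" 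
  shows "kink u \<in> ball \<i> (1/2) \<longleftrightarrow> (1/2 < u \<and> u < 3/2) \<or> (43/8 < u \<and> u < 45/8)"
proof
  {
    assume "kink u \<in> ball \<i> (1/2)"
    then have "norm (kink u - \<i>) < 1/2" by (simp add: dist_norm norm_minus_commute)
    then have "\<bar>Re (kink u - \<i>)\<bar> < 1/2" "\<bar>Im (kink u - \<i>)\<bar> < 1/2"
      using abs_Re_le_cmod[of "kink u - \<i>"] abs_Im_le_cmod[of "kink u - \<i>"] by linarith+
    then have "\<bar>kink_x u\<bar> < 1/2" "\<bar>kink_y u - 1\<bar> < 1/2" by (auto simp: kink_def)
    then have "- (1/2) < kink_x u" "kink_x u < 1/2" "1/2 < kink_y u" "kink_y u < 3/2" by linarith+
    then show "(1/2 < u \<and> u < 3/2) \<or> (43/8 < u \<and> u < 45/8)"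
      using assms unfolding kink_x_def kink_y_def by (auto split: if_splits)
  }
  assume a: "(1/2 < u \<and> u < 3/2) \<or> (43/8 < u \<and> u < 45/8)"
  then have "kink_x u = 0 \<and> \<bar>kink_y u - 1\<bar> < 1/2 \<or> \<bar>kink_x u\<bar> < 1/2 \<and> kink_y u = 1"
    unfolding kink_x_def kink_y_def by (auto simp: abs_if)
  then have "norm (kink u - \<i>) < 1/2"
  proof
    assume "kink_x u = 0 \<and> \<bar>kink_y u - 1\<bar> < 1/2"
    then have "kink u - \<i> = Complex 0 (kink_y u - 1)" "\<bar>kink_y u - 1\<bar> < 1/2" by (auto simp: kink_def complex_eq_iff)
    then show ?thesis using cmod_le[of "kink u - \<i>"] by (simp)
  next
    assume "\<bar>kink_x u\<bar> < 1/2 \<and> kink_y u = 1"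
    then have "kink u - \<i> = Complex (kink_x u) 0" "\<bar>kink_x u\<bar> < 1/2" by (auto simp: kink_def complex_eq_iff)
    then show ?thesis using cmod_le[of "kink u - \<i>"] by (simp)
  qed
  then show "kink u \<in> ball \<i> (1/2)" by (simp add: dist_norm norm_minus_commute)
qed

text \<open>
  The straight strand in the box is parametrised by its height, and the point at height \<open>u\<close> is moved to
  the point of the kink at time \<open>u\<close>.  Composing the curve with this map of the plane leaves its parameter
  circles unchanged.
\<close>

definition kinked :: "(complex \<Rightarrow> complex) \<Rightarrow> diagram \<Rightarrow> diagram" where
  "kinked k D = D\<lparr>curve := (\<lambda>z. if curve D z \<in> k ` kink_box
       then k (kink (Im (the_inv_into kink_box k (curve D z)))) else curve D z),
     virtuals := insert (k \<i>) (virtuals D)\<rparr>"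

locale flat_strand =
  fixes D :: diagram and Q :: "complex set" and k :: "complex \<Rightarrow> complex"
  assumes vld: "virtual_link_diagram D"
    and chart: "plane_chart Q k" and box: "kink_box \<subseteq> Q"
    and free: "crossings D \<inter> k ` kink_box = {}"
    and flat: "curve D ` circles D \<inter> k ` kink_box = (\<lambda>y. k (Complex 0 y)) ` {0..8}"
begin

lemma k_inj: "x \<in> kink_box \<Longrightarrow> y \<in> kink_box \<Longrightarrow> k x = k y \<longleftrightarrow> x = y"
  using plane_chart_inj[OF chart] box by blast

lemma k_inj_on: "inj_on k kink_box"
  using chart box unfolding plane_chart_def by (auto intro: inj_on_subset)

lemma k_cont: "continuous_on kink_box k"
  using chart box unfolding plane_chart_def by (auto intro: continuous_on_subset)

lemma compact_kink_box: "compact kink_box" "convex kink_box" "interior kink_box = box (Complex (-3) 0) (Complex 3 8)"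
  "frontier kink_box = kink_box - box (Complex (-3) 0) (Complex 3 8)"
  unfolding kink_box_def by (auto simp: frontier_cbox interior_cbox)

lemma inside_subset: "box (Complex (-3) 0) (Complex 3 8) \<subseteq> kink_box"
  unfolding kink_box_def by (rule box_subset_cbox)

lemma interior_kB: "interior (k ` kink_box) = k ` box (Complex (-3) 0) (Complex 3 8)"
  using plane_chart_interior[OF chart box] compact_kink_box(3) by simp

lemma closed_kB: "closed (k ` kink_box)" "compact (k ` kink_box)"
  using plane_chart_compact[OF chart box compact_kink_box(1)] compact_imp_closed by auto

lemma kB_interior_iff: "x \<in> kink_box \<Longrightarrow> k x \<in> interior (k ` kink_box) \<longleftrightarrow> x \<in> box (Complex (-3) 0) (Complex 3 8)"
  unfolding interior_kB using k_inj inside_subset by (auto simp: subset_iff)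

lemma axis_in_box: "0 \<le> y \<Longrightarrow> y \<le> 8 \<Longrightarrow> Complex 0 y \<in> kink_box"
  by (simp add: kink_box_def in_cbox_complex_iff)

lemma axis_inside: "Complex 0 y \<in> box (Complex (-3) 0) (Complex 3 8) \<longleftrightarrow> 0 < y \<and> y < 8"
  by (simp add: in_box_complex_iff)

lemma strand_exists: "\<exists>v. continuous_on {0..8} v \<and> v ` {0..8} = {z \<in> circles D. curve D z \<in> k ` kink_box} \<and>
   (\<forall>y\<in>{0..8}. curve D (v y) = k (Complex 0 y))"
proof (rule crossing_free_parametrisation[OF virtual_link_diagramD(1)[OF vld] free closed_kB(1)])
  fix v assume v: "homeomorphism {z \<in> circles D. curve D z \<in> k ` kink_box} (curve D ` circles D \<inter> k ` kink_box) (curve D) v"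
  note v' = v[unfolded flat]
  have "continuous_on {0..8} (\<lambda>y. k (Complex 0 y))"
    by (rule continuous_on_compose2[OF k_cont]) (auto intro!: continuous_intros axis_in_box)
  note c = continuous_on_compose2[OF homeomorphism_cont2[OF v'] this]
  show ?thesis
  proof (intro exI[of _ "\<lambda>y. v (k (Complex 0 y))"] conjI ballI)
    show "continuous_on {0..8} (\<lambda>y. v (k (Complex 0 y)))" by (rule c) simp
    show "(\<lambda>y. v (k (Complex 0 y))) ` {0..8} = {z \<in> circles D. curve D z \<in> k ` kink_box}"
      using homeomorphism_image2[OF v'] by (simp add: image_image)
    fix y :: real assume "y \<in> {0..8}"
    then show "curve D (v (k (Complex 0 y))) = k (Complex 0 y)"
      by (intro homeomorphism_apply(4)[OF v']) (rule imageI)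
  qed
qed

definition v where "v = (SOME v. continuous_on {0..8} v \<and> v ` {0..8} = {z \<in> circles D. curve D z \<in> k ` kink_box} \<and>
   (\<forall>y\<in>{0..8}. curve D (v y) = k (Complex 0 y)))"

lemma v: "continuous_on {0..8} v" "v ` {0..8} = {z \<in> circles D. curve D z \<in> k ` kink_box}"
  "\<And>y. 0 \<le> y \<Longrightarrow> y \<le> 8 \<Longrightarrow> curve D (v y) = k (Complex 0 y)"
  using someI_ex[OF strand_exists] unfolding v_def[symmetric] by simp_all

lemma v_circles: "0 \<le> y \<Longrightarrow> y \<le> 8 \<Longrightarrow> v y \<in> circles D"
  using v(2) by (metis (no_types, lifting) atLeastAtMost_iff imageI mem_Collect_eq)

lemma v_inj: "0 \<le> y \<Longrightarrow> y \<le> 8 \<Longrightarrow> 0 \<le> y' \<Longrightarrow> y' \<le> 8 \<Longrightarrow> v y = v y' \<longleftrightarrow> y = y'"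
  using v(3)[of y] v(3)[of y'] k_inj[OF axis_in_box axis_in_box, of y y'] by auto

lemma v_cases:
  assumes "z \<in> circles D"
  obtains (strand) y where "0 \<le> y" "y \<le> 8" "z = v y" "curve D z = k (Complex 0 y)" "curve (kinked k D) z = k (kink y)"
  | (outside) "curve D z \<notin> k ` kink_box" "curve (kinked k D) z = curve D z"
proof (cases "curve D z \<in> k ` kink_box")
  case True
  then have "z \<in> v ` {0..8}" using v(2) assms by simp
  then obtain y where y: "0 \<le> y" "y \<le> 8" "z = v y" by auto
  then have c: "curve D z = k (Complex 0 y)" using v(3) by simp
  then have "curve (kinked k D) z = k (kink y)"
    using y by (simp add: kinked_def axis_in_box the_inv_into_f_f[OF k_inj_on])
  then show thesis using strand y c by blast
next
  case False
  then show thesis by (intro outside) (simp_all add: kinked_def)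
qed

lemma kinked_v: "0 \<le> y \<Longrightarrow> y \<le> 8 \<Longrightarrow> curve (kinked k D) (v y) = k (kink y)"
  by (simp add: kinked_def v(3) axis_in_box the_inv_into_f_f[OF k_inj_on])

lemma kinked_simps [simp]: "circles (kinked k D) = circles D" "overs (kinked k D) = overs D"
  "virtuals (kinked k D) = insert (k \<i>) (virtuals D)" "ncomp (kinked k D) = ncomp D"
  by (simp_all add: kinked_def circles_def)

lemma kinked_outside: "curve D z \<notin> k ` kink_box \<Longrightarrow> curve (kinked k D) z = curve D z"
  by (simp add: kinked_def)

lemma kinked_mem: "z \<in> circles D \<Longrightarrow> curve (kinked k D) z \<in> k ` kink_box \<longleftrightarrow> curve D z \<in> k ` kink_box"
  by (erule v_cases) (auto simp: kink_in_box axis_in_box)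

lemma kinked_interior:
  assumes "z \<in> circles D"
  shows "curve (kinked k D) z \<in> interior (k ` kink_box) \<longleftrightarrow> curve D z \<in> interior (k ` kink_box)"
  using assms
proof (cases rule: v_cases)
  case (strand y)
  have "kink y \<in> box (Complex (-3) 0) (Complex 3 8) \<longleftrightarrow> 0 < y \<and> y < 8"
  proof
    assume "kink y \<in> box (Complex (-3) 0) (Complex 3 8)"
    then have "y \<noteq> 0" "y \<noteq> 8" by (auto simp: kink_ends axis_inside)
    then show "0 < y \<and> y < 8" using strand by simp
  qed (use kink_inside in auto)
  then show ?thesis
    using strand kB_interior_iff[OF kink_in_box, of y] kB_interior_iff[OF axis_in_box, of y] axis_inside by simp
qed (auto)

lemma kinked_agree: "agree_outside (k ` kink_box) D (kinked k D)"
proof (rule agree_outside_same_parameters)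
  fix z assume z: "z \<in> circles D"
  show "curve D z \<notin> interior (k ` kink_box) \<longleftrightarrow> curve (kinked k D) z \<notin> interior (k ` kink_box)"
    using kinked_interior[OF z] by simp
  assume n: "curve D z \<notin> interior (k ` kink_box)"
  from z show "curve (kinked k D) z = curve D z"
  proof (cases rule: v_cases)
    case (strand y)
    then have "\<not> (0 < y \<and> y < 8)" using n kB_interior_iff[OF axis_in_box, of y] axis_inside by simp
    then have "y = 0 \<or> y = 8" using strand by auto
    then show ?thesis using strand kink_ends by auto
  qed
next
  have "k \<i> \<in> interior (k ` kink_box)"
    using kB_interior_iff[of \<i>] kink_inside[of 1] kink_ends(3) kink_in_box[of 1] by simp
  then show "virtuals (kinked k D) - interior (k ` kink_box) = virtuals D - interior (k ` kink_box)" by auto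
qed simp_all

lemma closed_circle_part: "closed {z \<in> circles D. curve D z \<in> C}" if "closed C"
proof -
  have "{z \<in> circles D. curve D z \<in> C} = circles D \<inter> curve D -` C" by blast
  then show ?thesis using continuous_closedin_preimage[OF virtual_link_diagramD(1)[OF vld] that]
    by (simp add: closedin_closed_eq compact_circles compact_imp_closed)
qed

lemma kinked_continuous: "continuous_on (circles D) (curve (kinked k D))"
proof -
  let ?Z = "{z \<in> circles D. curve D z \<in> k ` kink_box}" and ?W = "{z \<in> circles D. curve D z \<in> - interior (k ` kink_box)}"
  have "?Z \<union> ?W = circles D" using interior_subset by blast
  moreover have "continuous_on ?Z (curve (kinked k D))"
    unfolding v(2)[symmetric]
  proof (rule continuous_on_factor)
    have "continuous_on {0..8} (\<lambda>y. k (kink y))"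
      by (rule continuous_on_compose2[OF k_cont continuous_kink]) (auto intro: kink_in_box)
    then show "continuous_on {0..8} (curve (kinked k D) \<circ> v)"
      by (rule continuous_on_eq) (simp add: kinked_v)
  qed (use v(1) in auto)
  moreover have "continuous_on ?W (curve (kinked k D))"
  proof (rule continuous_on_eq)
    show "continuous_on ?W (curve D)" by (rule continuous_on_subset[OF virtual_link_diagramD(1)[OF vld]]) blast
    fix z assume "z \<in> ?W"
    then have z: "z \<in> circles D" "curve D z \<notin> interior (k ` kink_box)" by simp_all
    from z(1) show "curve D z = curve (kinked k D) z"
    proof (cases rule: v_cases)
      case (strand y)
      then have "\<not> (0 < y \<and> y < 8)" using z kB_interior_iff[OF axis_in_box, of y] axis_inside by simp
      then have "y = 0 \<or> y = 8" using strand by auto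
      then show ?thesis using strand kink_ends by auto
    qed simp
  qed
  ultimately show ?thesis
    using continuous_on_closed_Un[OF closed_circle_part[OF closed_kB(1)] closed_circle_part, of "- interior (k ` kink_box)" "curve (kinked k D)"]
    by (simp add: closed_Compl)
qed

lemma kinked_crossings: "crossings (kinked k D) = insert (k \<i>) (crossings D)"
proof
  have in0: "0 \<le> (1::real)" "(1::real) \<le> 8" "0 \<le> (11/2::real)" "(11/2::real) \<le> 8" by simp_all
  have "v 1 \<noteq> v (11/2)" using v_inj[OF in0] by simp
  moreover have "curve (kinked k D) (v 1) = k \<i>" "curve (kinked k D) (v (11/2)) = k \<i>"
    using kinked_v[OF in0(1,2)] kinked_v[OF in0(3,4)] kink_ends by simp_all
  ultimately have "k \<i> \<in> crossings (kinked k D)"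
    unfolding crossings_def using v_circles[OF in0(1,2)] v_circles[OF in0(3,4)] kinked_simps(1) by blast
  moreover have "crossings D \<subseteq> crossings (kinked k D)"
  proof
    fix x assume x: "x \<in> crossings D"
    then obtain z w where zw: "z \<in> circles D" "w \<in> circles D" "z \<noteq> w" "curve D z = x" "curve D w = x"
      unfolding crossings_def by blast
    have "x \<notin> k ` kink_box" using free x by blast
    then have "curve (kinked k D) z = x" "curve (kinked k D) w = x" using zw kinked_outside by simp_all
    then show "x \<in> crossings (kinked k D)" unfolding crossings_def using zw kinked_simps(1) by blast
  qed
  ultimately show "insert (k \<i>) (crossings D) \<subseteq> crossings (kinked k D)" by blast
  show "crossings (kinked k D) \<subseteq> insert (k \<i>) (crossings D)"
  proof
    fix x assume "x \<in> crossings (kinked k D)"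
    then obtain z w where zw: "z \<in> circles D" "w \<in> circles D" "z \<noteq> w" "curve (kinked k D) z = x" "curve (kinked k D) w = x"
      unfolding crossings_def kinked_simps(1) by blast
    show "x \<in> insert (k \<i>) (crossings D)"
    proof (cases "x \<in> k ` kink_box")
      case True
      then have "z \<in> v ` {0..8}" "w \<in> v ` {0..8}" using kinked_mem[OF zw(1)] kinked_mem[OF zw(2)] zw(1,2,4,5) v(2) by simp_all
      then obtain y y' where y: "0 \<le> y" "y \<le> 8" "z = v y" "0 \<le> y'" "y' \<le> 8" "w = v y'" by auto
      then have "k (kink y) = k (kink y')" using zw kinked_v by simp
      then have "kink y = kink y'" using k_inj kink_in_box y by simp
      moreover have "y \<noteq> y'" using y zw by auto
      ultimately have "y = 1 \<or> y = 11/2" using kink_eq_iff y by blast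
      then have "kink y = \<i>" using kink_ends(3,4) by (elim disjE) (simp_all only:)
      then show ?thesis using kinked_v[OF y(1,2)] y(3) zw(4) by simp
    next
      case False
      then have "curve D z \<notin> k ` kink_box" "curve D w \<notin> k ` kink_box" using kinked_mem[OF zw(1)] kinked_mem[OF zw(2)] zw(4,5) by simp_all
      then have "curve D z = x" "curve D w = x" using zw kinked_outside by simp_all
      then show ?thesis unfolding crossings_def using zw by blast
    qed
  qed
qed

lemma ball_in_box: "ball \<i> (1/2) \<subseteq> kink_box"
proof
  fix w assume "w \<in> ball \<i> (1/2)"
  then have "norm (w - \<i>) < 1/2" by (simp add: dist_norm norm_minus_commute)
  then have "\<bar>Re (w - \<i>)\<bar> < 1/2" "\<bar>Im (w - \<i>)\<bar> < 1/2"
    using abs_Re_le_cmod[of "w - \<i>"] abs_Im_le_cmod[of "w - \<i>"] by linarith+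
  then have "\<bar>Re w\<bar> < 1/2" "\<bar>Im w - 1\<bar> < 1/2" by simp_all
  then have "- (1/2) < Re w" "Re w < 1/2" "1/2 < Im w" "Im w < 3/2" by linarith+
  then show "w \<in> kink_box" by (auto simp: kink_box_def in_cbox_complex_iff)
qed

text \<open>
  On the disk of radius \<open>1/2\<close> around the crossing the kink consists of two perpendicular diameters, so the
  chart, recentred and scaled by \<open>2\<close>, has the shape that transversality asks for.
\<close>

lemma kinked_transverse: "transverse_double_point (kinked k D) (k \<i>)"
proof -
  define U where "U = k ` ball \<i> (1/2)"
  define P where "P = {z \<in> circles D. curve (kinked k D) z \<in> U}"
  define h where "h x = 2 * (the_inv_into kink_box k x - \<i>)" for x
  define l where "l u = k (\<i> + u / 2)" for u
  have oU: "open U" unfolding U_def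
    by (rule plane_chart_open[OF chart]) (use ball_in_box box in auto)
  have UB: "U \<subseteq> k ` kink_box" unfolding U_def using ball_in_box by blast
  have P: "P = v ` ({1/2<..<3/2} \<union> {43/8<..<45/8})"
  proof
    show "P \<subseteq> v ` ({1/2<..<3/2} \<union> {43/8<..<45/8})"
    proof
      fix z assume z: "z \<in> P"
      then have "z \<in> circles D" "curve (kinked k D) z \<in> k ` kink_box" using UB unfolding P_def by blast+
      then have "z \<in> v ` {0..8}" using kinked_mem v(2) by simp
      then obtain y where y: "0 \<le> y" "y \<le> 8" "z = v y" by auto
      then have "k (kink y) \<in> k ` ball \<i> (1/2)" using z kinked_v unfolding P_def U_def by simp
      then have "kink y \<in> ball \<i> (1/2)"
        using plane_chart_mem[OF chart, of "ball \<i> (1/2)" "kink y"] ball_in_box box kink_in_box[OF y(1,2)] by blast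
      then show "z \<in> v ` ({1/2<..<3/2} \<union> {43/8<..<45/8})"
        using kink_near_crossing[OF y(1,2)] y(3) by auto
    qed
    show "v ` ({1/2<..<3/2} \<union> {43/8<..<45/8}) \<subseteq> P"
    proof
      fix z assume "z \<in> v ` ({1/2<..<3/2} \<union> {43/8<..<45/8})"
      then obtain y where y: "y \<in> {1/2<..<3/2} \<union> {43/8<..<45/8}" "z = v y" by blast
      then have y': "0 \<le> y" "y \<le> 8" by auto
      then have "kink y \<in> ball \<i> (1/2)" using kink_near_crossing[OF y'] y by auto
      then show "z \<in> P" unfolding P_def U_def using y' y(2) kinked_v v_circles by simp
    qed
  qed
  have oP: "openin (top_of_set (circles D)) P"
  proof -
    have "P = circles D \<inter> curve (kinked k D) -` U" unfolding P_def by blast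
    then show ?thesis using continuous_openin_preimage_gen[OF kinked_continuous oU] by simp
  qed
  have part: "openin (top_of_set (circles D)) (v ` S)" if S: "S = ({1/2<..<3/2} \<union> {43/8<..<45/8}) - {a..b}" "0 \<le> a" "b \<le> 8" for S a b
  proof -
    have ab: "{a..b} \<subseteq> {0..8}" using S by auto
    have "compact (v ` {a..b})"
      by (rule compact_continuous_image[OF continuous_on_subset[OF v(1) ab]]) simp
    moreover have "v ` S = P - v ` {a..b}"
    proof -
      have "inj_on v {0..8}" by (rule inj_onI) (use v_inj in auto)
      then have "v ` (({1/2<..<3/2} \<union> {43/8<..<45/8}) - {a..b}) = v ` ({1/2<..<3/2} \<union> {43/8<..<45/8}) - v ` {a..b}"
        by (rule inj_on_image_set_diff) (use ab in auto)
      then show ?thesis using S(1) P by simp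
    qed
    moreover have "P - v ` {a..b} = P \<inter> - v ` {a..b}" by blast
    ultimately show ?thesis using oP by (simp add: openin_Int_open compact_imp_closed open_Compl)
  qed
  have "{1/2<..<3/2} = ({1/2<..<3/2} \<union> {43/8<..<45/8}) - {5..(6::real)}" by auto
  note oM = part[OF this]
  have "{43/8<..<45/8} = ({1/2<..<3/2} \<union> {43/8<..<45/8}) - {0..(2::real)}" by auto
  note oN = part[OF this]
  have injk: "inj_on (curve (kinked k D)) (v ` S)" if "S \<subseteq> {0..8}" "1 \<notin> S \<or> 11/2 \<notin> S" for S
  proof (rule inj_onI)
    fix z w assume "z \<in> v ` S" "w \<in> v ` S" and e: "curve (kinked k D) z = curve (kinked k D) w"
    then obtain y y' where y: "y \<in> S" "y' \<in> S" "z = v y" "w = v y'" by blast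
    then have b: "0 \<le> y" "y \<le> 8" "0 \<le> y'" "y' \<le> 8" using that by auto
    then have "kink y = kink y'" using e y kinked_v k_inj kink_in_box by simp
    then have "y = y'" using kink_eq_iff[OF b] that(2) y(1,2) by metis
    then show "z = w" using y by simp
  qed
  have hk: "h (k x) = 2 * (x - \<i>)" if "x \<in> kink_box" for x
    unfolding h_def using the_inv_into_f_f[OF k_inj_on that] by simp
  have lb: "\<i> + u / 2 \<in> ball \<i> (1/2)" if "u \<in> ball 0 1" for u :: complex
    using that by (simp add: dist_norm norm_divide)
  have hom: "homeomorphism U (ball 0 1) h l"
    unfolding homeomorphism_def
  proof (intro conjI ballI)
    have "continuous_on U (the_inv_into kink_box k)"
      using continuous_on_inv_into[OF k_cont compact_kink_box(1) k_inj_on] UB by (rule continuous_on_subset)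
    then show "continuous_on U h" unfolding h_def by (intro continuous_intros)
    show "continuous_on (ball 0 1) l" unfolding l_def
      by (rule continuous_on_compose2[OF k_cont]) (use lb ball_in_box in \<open>auto intro!: continuous_intros\<close>)
    have 1: "h x \<in> ball 0 1 \<and> l (h x) = x" if "x \<in> U" for x
    proof -
      from that obtain w where w: "w \<in> ball \<i> (1/2)" "x = k w" unfolding U_def by blast
      then have h: "h x = 2 * (w - \<i>)" using hk ball_in_box by blast
      have "norm (h x) = 2 * norm (w - \<i>)" unfolding h by (simp only: norm_mult norm_numeral)
      then have "h x \<in> ball 0 1" using w(1) by (simp add: dist_norm norm_minus_commute)
      moreover have "\<i> + h x / 2 = w" unfolding h by (simp add: field_simps)
      ultimately show ?thesis unfolding l_def using w(2) by simp
    qed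
    have 2: "l u \<in> U \<and> h (l u) = u" if "u \<in> ball 0 1" for u
      using lb[OF that] hk[of "\<i> + u / 2"] ball_in_box unfolding l_def U_def by auto
    show "h ` U = ball 0 1" using 1 2 by force
    show "l ` ball 0 1 = U" using 1 2 by force
    show "\<And>x. x \<in> U \<Longrightarrow> l (h x) = x" using 1 by blast
    show "\<And>u. u \<in> ball 0 1 \<Longrightarrow> h (l u) = u" using 2 by blast
  qed
  have img: "h ` curve (kinked k D) ` v ` S = (\<lambda>y. 2 * (kink y - \<i>)) ` S" if "S \<subseteq> {0..8}" for S
    unfolding image_image
    by (rule image_cong[OF refl]) (use that kinked_v hk kink_in_box in \<open>auto simp: subset_iff\<close>)
  have ax: "norm (of_real a :: complex) = \<bar>a\<bar>" "norm (\<i> * of_real a) = \<bar>a\<bar>" for a :: real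
    by (simp_all add: norm_mult)
  show ?thesis unfolding transverse_double_point_def kinked_simps(1)
  proof (intro exI conjI)
    show "v (11/2) \<noteq> v 1" using v_inj[of "11/2" 1] by simp
    show "v (11/2) \<in> v ` {43/8<..<45/8}" "v 1 \<in> v ` {1/2<..<3/2}" by auto
    show "curve (kinked k D) (v (11/2)) = k \<i>" "curve (kinked k D) (v 1) = k \<i>"
      using kinked_v[of 1] kinked_v[of "11/2"] kink_ends by simp_all
    show "k \<i> \<in> U" unfolding U_def by simp
    show "open U" by fact
    show "openin (top_of_set (circles D)) (v ` {43/8<..<45/8})" "openin (top_of_set (circles D)) (v ` {1/2<..<3/2})"
      using oN oM by simp_all
    show "inj_on (curve (kinked k D)) (v ` {43/8<..<45/8})" "inj_on (curve (kinked k D)) (v ` {1/2<..<3/2})"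
      by (rule injk; auto)+
    show "{z \<in> circles D. curve (kinked k D) z \<in> U} = v ` {43/8<..<45/8} \<union> v ` {1/2<..<3/2}"
      using P unfolding P_def image_Un by blast
    show "homeomorphism U (ball 0 1) h l" by fact
    have "(\<lambda>y. 2 * (kink y - \<i>)) ` {43/8<..<45/8} = {u \<in> ball 0 1. Im u = 0}"
    proof
      show "(\<lambda>y. 2 * (kink y - \<i>)) ` {43/8<..<45/8} \<subseteq> {u \<in> ball 0 1. Im u = 0}"
      proof
        fix u assume "u \<in> (\<lambda>y. 2 * (kink y - \<i>)) ` {43/8<..<45/8}"
        then obtain y where y: "43/8 < y" "y < 45/8" "u = 2 * (kink y - \<i>)" by auto
        then have "u = of_real (44 - 8 * y)" by (auto simp: kink_def kink_x_def kink_y_def complex_eq_iff)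
        then show "u \<in> {u \<in> ball 0 1. Im u = 0}" using y(1,2) ax(1)[of "44 - 8 * y"] by (simp add: abs_less_iff)
      qed
      show "{u \<in> ball 0 1. Im u = 0} \<subseteq> (\<lambda>y. 2 * (kink y - \<i>)) ` {43/8<..<45/8}"
      proof
        fix u :: complex assume u: "u \<in> {u \<in> ball 0 1. Im u = 0}"
        then have "\<bar>Re u\<bar> < 1" using abs_Re_le_cmod[of u] by simp
        then show "u \<in> (\<lambda>y. 2 * (kink y - \<i>)) ` {43/8<..<45/8}"
          using u by (intro image_eqI[of _ _ "11/2 - Re u / 8"]) (auto simp: kink_def kink_x_def kink_y_def complex_eq_iff abs_less_iff field_simps)
      qed
    qed
    then show "h ` curve (kinked k D) ` v ` {43/8<..<45/8} = {u \<in> ball 0 1. Im u = 0}"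
      by (subst img) auto
    have "(\<lambda>y. 2 * (kink y - \<i>)) ` {1/2<..<3/2} = {u \<in> ball 0 1. Re u = 0}"
    proof
      show "(\<lambda>y. 2 * (kink y - \<i>)) ` {1/2<..<3/2} \<subseteq> {u \<in> ball 0 1. Re u = 0}"
      proof
        fix u assume "u \<in> (\<lambda>y. 2 * (kink y - \<i>)) ` {1/2<..<3/2}"
        then obtain y where y: "1/2 < y" "y < 3/2" "u = 2 * (kink y - \<i>)" by auto
        then have "u = \<i> * of_real (2 * y - 2)" by (auto simp: kink_def kink_x_def kink_y_def complex_eq_iff)
        then show "u \<in> {u \<in> ball 0 1. Re u = 0}" using y(1,2) ax(2)[of "2 * y - 2"] by (simp add: abs_less_iff)
      qed
      show "{u \<in> ball 0 1. Re u = 0} \<subseteq> (\<lambda>y. 2 * (kink y - \<i>)) ` {1/2<..<3/2}"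
      proof
        fix u :: complex assume u: "u \<in> {u \<in> ball 0 1. Re u = 0}"
        then have "\<bar>Im u\<bar> < 1" using abs_Im_le_cmod[of u] by simp
        then show "u \<in> (\<lambda>y. 2 * (kink y - \<i>)) ` {1/2<..<3/2}"
          using u by (intro image_eqI[of _ _ "1 + Im u / 2"]) (auto simp: kink_def kink_x_def kink_y_def complex_eq_iff abs_less_iff field_simps)
      qed
    qed
    then show "h ` curve (kinked k D) ` v ` {1/2<..<3/2} = {u \<in> ball 0 1. Re u = 0}"
      by (subst img) auto
  qed
qed

lemma kinked_crossings_box: "crossings (kinked k D) \<inter> k ` kink_box = {k \<i>}"
  using kinked_crossings free kink_in_box[of 1] kink_ends(3) by auto

theorem kinked_vld: "virtual_link_diagram (kinked k D)"
proof (rule virtual_link_diagram_agree[OF vld kinked_agree closed_kB(1)])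
  show "continuous_on (circles (kinked k D)) (curve (kinked k D))" using kinked_continuous by simp
  show "finite (crossings (kinked k D) \<inter> k ` kink_box)" unfolding kinked_crossings_box by simp
  show "\<And>x. x \<in> crossings (kinked k D) \<inter> k ` kink_box \<Longrightarrow> transverse_double_point (kinked k D) x"
    unfolding kinked_crossings_box using kinked_transverse by simp
  have "virtuals D \<inter> k ` kink_box = {}" using virtual_link_diagramD(4)[OF vld] free by blast
  then show "crossings (kinked k D) \<inter> k ` kink_box = virtuals (kinked k D) \<inter> k ` kink_box"
    unfolding kinked_crossings_box using kink_in_box[of 1] kink_ends(3) by auto
  fix z assume "z \<in> overs (kinked k D)"
  then have z: "z \<in> circles D" "curve D z \<in> crossings D" using virtual_link_diagramD(5)[OF vld] by auto
  then have "curve D z \<notin> k ` kink_box" using free by blast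
  then show "z \<in> circles (kinked k D) \<and> curve (kinked k D) z \<notin> k ` kink_box"
    using z kinked_mem[OF z(1)] by simp
qed

theorem kinked_VR1: "VR1 (kinked k D) D"
proof -
  let ?B = "k ` kink_box"
  define q where "q i t = v (8 * t)" for i :: nat and t :: real
  have q8: "0 \<le> 8 * t \<and> 8 * t \<le> 8" if "0 \<le> t" "t \<le> 1" for t :: real using that by simp
  have qi: "path_image (q i) = v ` {0..8}" for i
  proof -
    have "(\<lambda>t. 8 * t) ` {0..1} = {0..(8::real)}" by (simp add: image_mult_atLeastAtMost)
    then have "v ` {0..8} = v ` (\<lambda>t. 8 * t) ` {0..1}" by simp
    moreover have "q i ` {0..1} = (\<lambda>t. v (8 * t)) ` {0..1}" by (rule image_cong) (simp_all add: q_def)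
    ultimately show ?thesis unfolding path_image_def image_image by simp
  qed
  have qarc: "arc (q i)" for i
  proof -
    have "continuous_on {0..1} (\<lambda>t. v (8 * t))"
      by (rule continuous_on_compose2[OF v(1)]) (auto intro!: continuous_intros)
    moreover have "inj_on (\<lambda>t. v (8 * t)) {0..1}"
      by (rule inj_onI) (use v_inj q8 in auto)
    moreover have "q i = (\<lambda>t. v (8 * t))" by (rule ext) (simp add: q_def)
    ultimately show ?thesis by (simp add: arc_def path_def)
  qed
  have disk: "?B homeomorphic cball (0::complex) 1"
  proof (rule plane_chart_disk[OF chart box compact_kink_box(1,2)])
    have "Complex 0 1 \<in> interior kink_box" unfolding compact_kink_box(3) axis_inside by simp
    then show "interior kink_box \<noteq> {}" by blast
  qed
  have fr: "k x \<in> frontier ?B" if "x \<in> kink_box" "x \<notin> box (Complex (-3) 0) (Complex 3 8)" for x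
    using plane_chart_frontier[OF chart box compact_kink_box(1)] that compact_kink_box(4) by blast
  have ends: "k (Complex 0 0) \<in> frontier ?B" "k (Complex 0 8) \<in> frontier ?B"
    by (rule fr; simp add: axis_inside axis_in_box)+
  have tD: "tangle D ?B 1 q" unfolding tangle_def
  proof (intro conjI allI impI ballI)
    show "?B homeomorphic cball (0::complex) 1" by fact
    show "crossings D \<inter> frontier ?B = {}" using free closed_kB(1) frontier_subset_closed by blast
    fix i show "arc (q i)" by (rule qarc)
    show "curve D (pathstart (q i)) \<in> frontier ?B" "curve D (pathfinish (q i)) \<in> frontier ?B"
      using ends by (simp_all add: pathstart_def pathfinish_def q_def v(3))
    fix t :: real assume "t \<in> {0<..<1}"
    then show "curve D (q i t) \<in> interior ?B"
      using kB_interior_iff[OF axis_in_box, of "8 * t"] by (simp add: q_def v(3) axis_inside)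
  next
    have "(\<Union>i<1. path_image (q i)) = path_image (q 0)" by auto
    then show "{z \<in> circles D. curve D z \<in> ?B} = (\<Union>i<1. path_image (q i))"
      by (simp only: qi v(2))
  qed (simp add: disjoint_family_on_def)
  have tE: "tangle (kinked k D) ?B 1 q" unfolding tangle_def
  proof (intro conjI allI impI ballI)
    show "?B homeomorphic cball (0::complex) 1" by fact
    have "k \<i> \<in> interior ?B"
      using kB_interior_iff[of \<i>] kink_inside[of 1] kink_ends(3) kink_in_box[of 1] by simp
    then have "k \<i> \<notin> frontier ?B" by (simp add: frontier_def)
    moreover have "frontier ?B \<subseteq> ?B" using closed_kB(1) frontier_subset_closed by blast
    ultimately have "crossings (kinked k D) \<inter> frontier ?B \<subseteq> {k \<i>}" using kinked_crossings_box by blast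
    with \<open>k \<i> \<notin> frontier ?B\<close> show "crossings (kinked k D) \<inter> frontier ?B = {}" by auto
    fix i show "arc (q i)" by (rule qarc)
    show "curve (kinked k D) (pathstart (q i)) \<in> frontier ?B" "curve (kinked k D) (pathfinish (q i)) \<in> frontier ?B"
      using ends by (simp_all add: pathstart_def pathfinish_def q_def kinked_v kink_ends)
    fix t :: real assume "t \<in> {0<..<1}"
    then show "curve (kinked k D) (q i t) \<in> interior ?B"
      using kB_interior_iff[OF kink_in_box, of "8 * t"] by (simp add: q_def kinked_v kink_inside)
  next
    have "{z \<in> circles (kinked k D). curve (kinked k D) z \<in> ?B} = {z \<in> circles D. curve D z \<in> ?B}"
      using kinked_mem by auto
    moreover have "(\<Union>i<1. path_image (q i)) = path_image (q 0)" by auto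
    ultimately show "{z \<in> circles (kinked k D). curve (kinked k D) z \<in> ?B} = (\<Union>i<1. path_image (q i))"
      by (simp only: qi v(2))
  qed (simp add: disjoint_family_on_def)
  have "replacement_rel_ends (kinked k D) D ?B 1 q q"
    unfolding replacement_rel_ends_def replacement_def
    using tD tE agree_outside_sym[OF kinked_agree]
    by (simp add: pathstart_def pathfinish_def q_def kinked_v v(3) kink_ends)
  then show ?thesis unfolding VR1_def using kinked_crossings_box free by (intro exI conjI) auto
qed

end

section \<open>Standard positions for H-moves\<close>

abbreviation rect :: "real \<Rightarrow> real \<Rightarrow> real \<Rightarrow> real \<Rightarrow> complex set" where
  "rect l r b t \<equiv> cbox (Complex l b) (Complex r t)"

abbreviation open_rect :: "real \<Rightarrow> real \<Rightarrow> real \<Rightarrow> real \<Rightarrow> complex set" where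
  "open_rect l r b t \<equiv> box (Complex l b) (Complex r t)"

text \<open>
  The picture of a diagram seen in the coordinates of a chart.
\<close>

definition drawing :: "diagram \<Rightarrow> (complex \<Rightarrow> complex) \<Rightarrow> complex set" where
  "drawing D k = k -` (curve D ` circles D)"

lemma drawing_image: "curve D ` circles D \<inter> k ` C = k ` (C \<inter> drawing D k)"
proof
  show "curve D ` circles D \<inter> k ` C \<subseteq> k ` (C \<inter> drawing D k)"
  proof
    fix x assume x: "x \<in> curve D ` circles D \<inter> k ` C"
    then obtain w where w: "w \<in> C" "x = k w" by blast
    then have "w \<in> drawing D k" using x by (simp add: drawing_def)
    then show "x \<in> k ` (C \<inter> drawing D k)" using w by simp
  qed
qed (auto simp: drawing_def)

lemma drawing_compose: "drawing D (k \<circ> A) = A -` drawing D k"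
  by (simp add: drawing_def vimage_comp)

text \<open>
  Disjoint arcs that fill the part of \<open>S\<close> in a rectangle and have their ends on its lower edge; the ends
  are at the points with index \<open>j\<close> and abscissa \<open>x j\<close>, and \<open>p\<close> tells which indices are joined.
\<close>

definition cups :: "complex set \<Rightarrow> real \<Rightarrow> real \<Rightarrow> real \<Rightarrow> real \<Rightarrow> nat \<Rightarrow> (nat \<Rightarrow> real) \<Rightarrow> (nat \<Rightarrow> nat \<times> nat) \<Rightarrow>
    (nat \<Rightarrow> real \<Rightarrow> complex) \<Rightarrow> bool" where
  "cups S l r s t m x p g \<longleftrightarrow>
     (\<forall>i<m. arc (g i) \<and> pathstart (g i) = Complex (x (fst (p i))) s \<and>
        pathfinish (g i) = Complex (x (snd (p i))) s \<and>
        (\<forall>u. 0 < u \<longrightarrow> u < 1 \<longrightarrow> g i u \<in> open_rect l r s t)) \<and>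
     (\<forall>i<m. \<forall>j<m. i \<noteq> j \<longrightarrow> path_image (g i) \<inter> path_image (g j) = {}) \<and>
     rect l r s t \<inter> S = (\<Union>i<m. path_image (g i))"

lemma cupsD:
  assumes "cups S l r s t m x p g"
  shows "i < m \<Longrightarrow> arc (g i)" "i < m \<Longrightarrow> pathstart (g i) = Complex (x (fst (p i))) s"
    "i < m \<Longrightarrow> pathfinish (g i) = Complex (x (snd (p i))) s"
    "i < m \<Longrightarrow> 0 < u \<Longrightarrow> u < 1 \<Longrightarrow> g i u \<in> open_rect l r s t"
    "i < m \<Longrightarrow> j < m \<Longrightarrow> i \<noteq> j \<Longrightarrow> path_image (g i) \<inter> path_image (g j) = {}"
    "rect l r s t \<inter> S = (\<Union>i<m. path_image (g i))"
  using assms unfolding cups_def by simp_all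

text \<open>
  Below height \<open>s\<close> the diagram consists of \<open>2m\<close> legs, which are graphs over the vertical axis; above, the
  upper ends of the legs are joined in pairs.  The legs are kept in the picture since the kink that
  raises \<open>m\<close> is put on one of them.
\<close>

definition plat :: "diagram \<Rightarrow> (complex \<Rightarrow> complex) \<Rightarrow> real \<Rightarrow> real \<Rightarrow> real \<Rightarrow> real \<Rightarrow> real \<Rightarrow> nat \<Rightarrow>
    (nat \<Rightarrow> real \<Rightarrow> real) \<Rightarrow> (nat \<Rightarrow> nat \<times> nat) \<Rightarrow> bool" where
  "plat D k l r e s t m X p \<longleftrightarrow>
     crossings D \<inter> k ` rect l r e t = {} \<and>
     rect l r e s \<inter> drawing D k = (\<Union>j<2*m. (\<lambda>y. Complex (X j y) y) ` {e..s}) \<and>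
     (\<exists>g. cups (drawing D k) l r s t m (\<lambda>j. X j s) p g)"

definition legs :: "real \<Rightarrow> real \<Rightarrow> real \<Rightarrow> real \<Rightarrow> nat \<Rightarrow> (nat \<Rightarrow> real \<Rightarrow> real) \<Rightarrow> bool" where
  "legs l r e s m X \<longleftrightarrow>
     (\<forall>j<2*m. continuous_on {e..s} (X j) \<and> (\<forall>y\<in>{e..s}. l < X j y \<and> X j y < r)) \<and>
     (\<forall>i j. i < j \<longrightarrow> j < 2*m \<longrightarrow> (\<forall>y\<in>{e..s}. X i y < X j y))"

definition pairs_before :: "nat \<Rightarrow> nat \<times> nat" where
  "pairs_before i = (2 * i, 2 * i + 1)"

definition pairs_after :: "nat \<Rightarrow> nat \<Rightarrow> nat \<times> nat" where
  "pairs_after m i = (2 * i + 1, (2 * i + 2) mod (2 * m))"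

text \<open>
  An \<open>H(m)\<close>-move in a rectangle, together with a collar below it in which both diagrams are the same
  legs.  The leg with index \<open>1\<close> is required to be vertical with some room on both sides: it is the one that
  gets a kink.
\<close>

definition H_config :: "nat \<Rightarrow> diagram \<Rightarrow> diagram \<Rightarrow> complex set \<Rightarrow> (complex \<Rightarrow> complex) \<Rightarrow>
   real \<Rightarrow> real \<Rightarrow> real \<Rightarrow> real \<Rightarrow> real \<Rightarrow> (nat \<Rightarrow> real \<Rightarrow> real) \<Rightarrow> real \<Rightarrow> real \<Rightarrow> bool" where
  "H_config m D D' Q k l r e s t X x a \<longleftrightarrow>
     virtual_link_diagram D \<and> virtual_link_diagram D' \<and> ncomp D' = ncomp D \<and>
     plane_chart Q k \<and> rect l r e t \<subseteq> Q \<and> e < s \<and> s < t \<and> 0 < a \<and> l < x - a \<and> x + a < r \<and>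
     legs l r e s m X \<and>
     (\<forall>y\<in>{e..s}. X 1 y = x) \<and> (\<forall>j<2*m. j \<noteq> 1 \<longrightarrow> (\<forall>y\<in>{e..s}. a < \<bar>X j y - x\<bar>)) \<and>
     plat D k l r e s t m X pairs_before \<and> plat D' k l r e s t m X (pairs_after m) \<and>
     agree_outside (k ` rect l r s t) D D'"

text \<open>
  All ends lie on the lower edge of the rectangle, which is the first quarter of the boundary loop
  \<open>rectpath\<close>, traversed on the parameters \<open>[0, 1/2]\<close>; so they are in cyclic order if their abscissas
  increase.
\<close>

lemma H_config_H_move:
  assumes "H_config m D D' Q k l r e s t X x a" "2 \<le> m"
  shows "H_move m D D'"
proof -
  from assms have D: "virtual_link_diagram D" "virtual_link_diagram D'" "ncomp D' = ncomp D"
    and k: "plane_chart Q k" and Q: "rect l r e t \<subseteq> Q" and est: "e < s" "s < t"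
    and L: "legs l r e s m X"
    and P: "plat D k l r e s t m X pairs_before" "plat D' k l r e s t m X (pairs_after m)"
    and ag: "agree_outside (k ` rect l r s t) D D'"
    by (simp_all add: H_config_def)
  have Xs: "l < X j s" "X j s < r" if "j < 2 * m" for j
    using L that est unfolding legs_def by auto
  have lr: "l < r" using Xs[of 0] assms(2) by simp
  let ?C = "rect l r s t"
  have Csub: "?C \<subseteq> rect l r e t" using est by (auto simp: in_cbox_complex_iff)
  then have C: "?C \<subseteq> Q" using Q by blast
  have Cint: "interior ?C \<noteq> {}"
  proof -
    have "Complex ((l + r) / 2) ((s + t) / 2) \<in> open_rect l r s t"
      using est lr by (simp add: in_box_complex_iff)
    then show ?thesis unfolding interior_cbox by blast
  qed
  have fr: "Complex (X j s) s \<in> frontier ?C" if "j < 2 * m" for j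
    using Xs[OF that] est by (simp add: frontier_cbox in_box_complex_iff in_cbox_complex_iff)
  have tangle: "\<exists>q. tangle E (k ` ?C) m q \<and> (\<forall>i<m. curve E (pathstart (q i)) = k (Complex (X (fst (p i)) s) s) \<and>
       curve E (pathfinish (q i)) = k (Complex (X (snd (p i)) s) s)) \<and> crossings E \<inter> k ` ?C = {}"
    if E: "virtual_link_diagram E" and P: "plat E k l r e s t m X p"
      and p: "\<And>i. i < m \<Longrightarrow> fst (p i) < 2 * m \<and> snd (p i) < 2 * m" for E p
  proof -
    from P obtain g where free: "crossings E \<inter> k ` rect l r e t = {}"
      and cups: "cups (drawing E k) l r s t m (\<lambda>j. X j s) p g"
      unfolding plat_def by blast
    note g = cupsD[OF cups]
    have free': "crossings E \<inter> k ` ?C = {}" using free image_mono[OF Csub, of k] by blast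
    have im: "curve E ` circles E \<inter> k ` ?C = (\<Union>i<m. k ` path_image (g i))"
      unfolding drawing_image g(6) by blast
    obtain q where q: "tangle E (k ` ?C) m q" "\<And>i u. i < m \<Longrightarrow> 0 \<le> u \<Longrightarrow> u \<le> 1 \<Longrightarrow> curve E (q i u) = k (g i u)"
    proof (rule tangle_of_arcs[OF virtual_link_diagramD(1)[OF E] k C _ _ Cint free' g(1) _ _ _ g(5) im])
      show "pathstart (g i) \<in> frontier ?C" "pathfinish (g i) \<in> frontier ?C" if "i < m" for i
        using fr g(2,3) p that by simp_all
    qed (use g(4) in \<open>auto simp: interior_cbox\<close>)
    have "curve E (pathstart (q i)) = k (Complex (X (fst (p i)) s) s)"
      "curve E (pathfinish (q i)) = k (Complex (X (snd (p i)) s) s)" if "i < m" for i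
      using q(2)[OF that, of 0] q(2)[OF that, of 1] g(2,3)[OF that] by (simp_all add: pathstart_def pathfinish_def)
    then show ?thesis using q(1) free' by blast
  qed
  have "\<And>i. i < m \<Longrightarrow> fst (pairs_before i) < 2 * m \<and> snd (pairs_before i) < 2 * m" by (simp add: pairs_before_def)
  from tangle[OF D(1) P(1) this] obtain q where q: "tangle D (k ` ?C) m q" "crossings D \<inter> k ` ?C = {}"
    "\<And>i. i < m \<Longrightarrow> curve D (pathstart (q i)) = k (Complex (X (2 * i) s) s)"
    "\<And>i. i < m \<Longrightarrow> curve D (pathfinish (q i)) = k (Complex (X (2 * i + 1) s) s)"
    by (auto simp: pairs_before_def)
  have "\<And>i. i < m \<Longrightarrow> fst (pairs_after m i) < 2 * m \<and> snd (pairs_after m i) < 2 * m" by (simp add: pairs_after_def)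
  from tangle[OF D(2) P(2) this] obtain q' where q': "tangle D' (k ` ?C) m q'" "crossings D' \<inter> k ` ?C = {}"
    "\<And>i. i < m \<Longrightarrow> curve D' (pathstart (q' i)) = k (Complex (X (2 * i + 1) s) s)"
    "\<And>i. i < m \<Longrightarrow> curve D' (pathfinish (q' i)) = k (Complex (X ((2 * i + 2) mod (2 * m)) s) s)"
    by (auto simp: pairs_after_def)
  define c where "c = k \<circ> rectpath (Complex l s) (Complex r t)"
  define th where "th j = (X j s - l) / (2 * (r - l))" for j
  have th: "0 < th j" "th j < 1/2" if "j < 2 * m" for j
    using Xs[OF that] lr by (simp_all add: th_def field_simps)
  have cth: "c (th j) = k (Complex (X j s) s)" if "j < 2 * m" for j
  proof -
    have "2 * th j = (X j s - l) / (r - l)" using lr by (simp add: th_def field_simps)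
    then have "linepath (Complex l s) (Complex r s) (2 * th j) = Complex (X j s) s"
      using lr by (simp add: linepath_def complex_eq_iff field_simps)
    then show ?thesis using th[OF that] by (simp add: c_def rectpath_def Let_def joinpaths_def)
  qed
  have simple: "simple_path (rectpath (Complex l s) (Complex r t))"
    by (rule simple_path_rectpath) (use lr est in auto)
  have pim: "path_image (rectpath (Complex l s) (Complex r t)) = frontier ?C"
    using path_image_rectpath_cbox_minus_box[of "Complex l s" "Complex r t"] lr est by (simp add: frontier_cbox)
  have pC: "frontier ?C \<subseteq> Q" using C frontier_subset_closed[of ?C] by auto
  have "simple_path c" unfolding c_def
    by (rule simple_path_continuous_image[OF simple])
       (use k pC pim in \<open>auto simp: plane_chart_def intro: continuous_on_subset inj_on_subset\<close>)
  moreover have "pathfinish c = pathstart c" by (simp add: c_def pathstart_compose pathfinish_compose)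
  moreover have "path_image c = frontier (k ` ?C)"
    unfolding c_def path_image_compose pim using plane_chart_frontier[OF k C] by simp
  moreover have "strict_mono_on {..<2 * m} th"
    unfolding strict_mono_on_def th_def using L est lr by (auto simp: legs_def divide_strict_right_mono)
  moreover have "th ` {..<2 * m} \<subseteq> {0..<1}" using th by force
  moreover have "replacement D D' (k ` ?C) m q q'" unfolding replacement_def using q q' ag by blast
  ultimately show ?thesis unfolding H_move_def using D q q' assms(2)
    by (intro conjI exI[of _ "k ` ?C"] exI[of _ q] exI[of _ q'] exI[of _ c] exI[of _ th]) (simp_all add: cth)
qed

lemma affine_bij:
  fixes x e \<alpha> \<beta> :: real
  assumes "\<alpha> > 0" "\<beta> > 0" and A: "\<And>z. A z = Complex (x + \<alpha> * Re z) (e + \<beta> * Im z)"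
  shows "bij A" "A ` rect l r b t = rect (x + \<alpha> * l) (x + \<alpha> * r) (e + \<beta> * b) (e + \<beta> * t)"
    "A z \<in> open_rect (x + \<alpha> * l) (x + \<alpha> * r) (e + \<beta> * b) (e + \<beta> * t) \<longleftrightarrow> z \<in> open_rect l r b t"
    "continuous_on UNIV A"
proof -
  define A' where "A' z = Complex ((Re z - x) / \<alpha>) ((Im z - e) / \<beta>)" for z
  have 1: "A (A' z) = z" "A' (A z) = z" for z
    using assms(1,2) by (simp_all add: A A'_def complex_eq_iff)
  show "bij A" by (rule bij_betw_byWitness[of _ A']) (use 1 in auto)
  have *: "A z \<in> rect (x + \<alpha> * l) (x + \<alpha> * r) (e + \<beta> * b) (e + \<beta> * t) \<longleftrightarrow> z \<in> rect l r b t" for z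
    using assms(1,2) by (simp add: A in_cbox_complex_iff)
  show "A ` rect l r b t = rect (x + \<alpha> * l) (x + \<alpha> * r) (e + \<beta> * b) (e + \<beta> * t)"
    using * 1(1) by (metis (no_types, lifting) image_eqI image_subsetI subsetI subset_antisym)
  show "A z \<in> open_rect (x + \<alpha> * l) (x + \<alpha> * r) (e + \<beta> * b) (e + \<beta> * t) \<longleftrightarrow> z \<in> open_rect l r b t"
    using assms(1,2) by (simp add: A in_box_complex_iff)
  have "A = (\<lambda>z. Complex (x + \<alpha> * Re z) (e + \<beta> * Im z))" by (rule ext) (rule A)
  then show "continuous_on UNIV A" by (simp add: continuous_intros)
qed

lemma plane_chart_compose:
  assumes "plane_chart Q k" "bij A" "continuous_on UNIV A"
  shows "plane_chart (A -` Q) (k \<circ> A)"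
  unfolding plane_chart_def
proof (intro conjI)
  show "open (A -` Q)" using assms(1,3) open_vimage unfolding plane_chart_def by blast
  show "continuous_on (A -` Q) (k \<circ> A)"
    by (rule continuous_on_compose) (use assms in \<open>auto simp: plane_chart_def intro: continuous_on_subset\<close>)
  show "inj_on (k \<circ> A) (A -` Q)"
    by (rule comp_inj_on) (use assms in \<open>auto simp: plane_chart_def bij_def intro: inj_on_subset\<close>)
qed

lemma plat_affine:
  fixes x f \<alpha> \<beta> :: real
  assumes pos: "\<alpha> > 0" "\<beta> > 0" and A: "\<And>z. A z = Complex (x + \<alpha> * Re z) (f + \<beta> * Im z)"
    and X: "\<And>j y. X' j (f + \<beta> * y) = x + \<alpha> * X j y"
    and P: "plat D k (x + \<alpha> * l) (x + \<alpha> * r) (f + \<beta> * e) (f + \<beta> * s) (f + \<beta> * t) m X' p"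
  shows "plat D (k \<circ> A) l r e s t m X p"
proof -
  note b = affine_bij[OF pos A]
  have inj: "inj A" using b(1) by (rule bij_is_inj)
  have tr: "A ` (S \<inter> drawing D (k \<circ> A)) = A ` S \<inter> drawing D k" for S
    unfolding drawing_compose by auto
  have aff: "{f + \<beta> * e..f + \<beta> * s} = (\<lambda>y. f + \<beta> * y) ` {e..s}"
  proof -
    have "(\<lambda>y. f + \<beta> * y) ` {e..s} = (+) f ` (*) \<beta> ` {e..s}" by (simp add: image_image)
    also have "\<dots> = {f + \<beta> * e..f + \<beta> * s} \<or> \<not> e \<le> s"
      using pos(2) by (simp add: image_mult_atLeastAtMost_if)
    finally show ?thesis using pos(2) by (cases "e \<le> s") auto
  qed
  from P obtain g where free: "crossings D \<inter> k ` rect (x + \<alpha> * l) (x + \<alpha> * r) (f + \<beta> * e) (f + \<beta> * t) = {}"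
    and slab: "rect (x + \<alpha> * l) (x + \<alpha> * r) (f + \<beta> * e) (f + \<beta> * s) \<inter> drawing D k =
       (\<Union>j<2*m. (\<lambda>y. Complex (X' j y) y) ` {f + \<beta> * e..f + \<beta> * s})"
    and cups: "cups (drawing D k) (x + \<alpha> * l) (x + \<alpha> * r) (f + \<beta> * s) (f + \<beta> * t) m (\<lambda>j. X' j (f + \<beta> * s)) p g"
    unfolding plat_def by blast
  note g = cupsD[OF cups]
  define B where "B z = Complex ((Re z - x) / \<alpha>) ((Im z - f) / \<beta>)" for z
  have AB: "A (B z) = z" and BA: "B (A z) = z" for z
    using pos by (simp_all add: A B_def complex_eq_iff)
  have Bc: "continuous_on S B" for S
  proof -
    have "B = (\<lambda>z. Complex ((Re z - x) / \<alpha>) ((Im z - f) / \<beta>))" by (rule ext) (simp add: B_def)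
    then show ?thesis using pos by (simp add: continuous_intros)
  qed
  have Bi: "inj_on B S" for S by (rule inj_on_inverseI[of _ A]) (rule AB)
  have AX: "A (Complex (X j y) y) = Complex (X' j (f + \<beta> * y)) (f + \<beta> * y)" for j y
    by (simp add: A X)
  have cancel: "S = T" if "A ` S = A ` T" for S T using that inj by (simp add: inj_image_eq_iff)
  show ?thesis unfolding plat_def cups_def
  proof (intro conjI exI[of _ "\<lambda>i. B \<circ> g i"] allI impI)
    show "crossings D \<inter> (k \<circ> A) ` rect l r e t = {}" using free unfolding image_comp[symmetric] b(2) .
    show "rect l r e s \<inter> drawing D (k \<circ> A) = (\<Union>j<2 * m. (\<lambda>y. Complex (X j y) y) ` {e..s})"
      by (rule cancel) (simp add: tr b(2) slab aff image_UN image_image AX)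
    show "rect l r s t \<inter> drawing D (k \<circ> A) = (\<Union>i<m. path_image (B \<circ> g i))"
      by (rule cancel) (simp add: tr b(2) g(6) image_UN path_image_compose image_image AB)
    fix i assume i: "i < m"
    show "arc (B \<circ> g i)" using g(1)[OF i] path_continuous_image[OF _ Bc] Bi unfolding arc_def
      by (auto intro!: comp_inj_on)
    show "pathstart (B \<circ> g i) = Complex (X (fst (p i)) s) s"
      unfolding pathstart_compose g(2)[OF i] AX[symmetric] by (rule BA)
    show "pathfinish (B \<circ> g i) = Complex (X (snd (p i)) s) s"
      unfolding pathfinish_compose g(3)[OF i] AX[symmetric] by (rule BA)
    show "(B \<circ> g i) u \<in> open_rect l r s t" if "0 < u" "u < 1" for u
      using g(4)[OF i that] b(3)[where z="B (g i u)" and l=l and r=r and b=s and t=t] AB by simp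
    show "path_image (B \<circ> g i) \<inter> path_image (B \<circ> g j) = {}" if "j < m" "i \<noteq> j" for j
      using g(5)[OF i that] inj_on_image_Int[OF Bi, of "path_image (g i)" UNIV "path_image (g j)"]
      by (simp add: path_image_compose)
  qed
qed

text \<open>
  An affine change of coordinates brings the collar to height \<open>[0, 8]\<close> and the vertical leg to the axis, with
  room for the box of the standard kink.
\<close>

lemma H_config_normalise:
  assumes H: "H_config m D D' Q k l r e s t X x a"
  obtains Q' k' l' r' t' X' where "H_config m D D' Q' k' l' r' 0 8 t' X' 0 3"
proof -
  define \<alpha> where "\<alpha> = a / 3"
  define \<beta> where "\<beta> = (s - e) / 8"
  define A where "A z = Complex (x + \<alpha> * Re z) (e + \<beta> * Im z)" for z
  define X' where "X' j y = (X j (e + \<beta> * y) - x) / \<alpha>" for j y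
  define l' r' t' where "l' = (l - x) / \<alpha>" and "r' = (r - x) / \<alpha>" and "t' = (t - e) / \<beta>"
  from H have est: "e < s" "s < t" "0 < a" "l < x - a" "x + a < r" "rect l r e t \<subseteq> Q" "plane_chart Q k"
    and L: "legs l r e s m X" and X1: "\<And>y. y \<in> {e..s} \<Longrightarrow> X 1 y = x"
    and Xa: "\<And>j y. j < 2 * m \<Longrightarrow> j \<noteq> 1 \<Longrightarrow> y \<in> {e..s} \<Longrightarrow> a < \<bar>X j y - x\<bar>"
    by (auto simp: H_config_def)
  have pos: "\<alpha> > 0" "\<beta> > 0" using est by (simp_all add: \<alpha>_def \<beta>_def)
  have eqs: "x + \<alpha> * l' = l" "x + \<alpha> * r' = r" "e + \<beta> * 0 = e" "e + \<beta> * 8 = s" "e + \<beta> * t' = t"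
    using pos by (simp_all add: l'_def r'_def t'_def) (simp add: \<beta>_def field_simps)
  have XX: "X j (e + \<beta> * y) = x + \<alpha> * X' j y" for j y using pos by (simp add: X'_def)
  note b = affine_bij[OF pos A_def]
  have y: "e + \<beta> * y \<in> {e..s}" if "y \<in> {0..8}" for y
  proof -
    have "\<beta> * y \<le> \<beta> * 8" "0 \<le> \<beta> * y" using that pos by simp_all
    then show ?thesis using eqs(4) by auto
  qed
  have "H_config m D D' (A -` Q) (k \<circ> A) l' r' 0 8 t' X' 0 3"
    unfolding H_config_def
  proof (intro conjI)
    show "virtual_link_diagram D" "virtual_link_diagram D'" "ncomp D' = ncomp D"
      using H by (simp_all add: H_config_def)
    show "plane_chart (A -` Q) (k \<circ> A)" by (rule plane_chart_compose[OF est(7) b(1,4)])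
    show "rect l' r' 0 t' \<subseteq> A -` Q"
      using b(2)[where l=l' and r=r' and b=0 and t=t'] est(6) unfolding eqs by blast
    show "(8::real) < t'" using est pos eqs by (metis add_le_cancel_left linorder_not_le mult_le_cancel_left_pos)
    show "l' < 0 - 3" "0 + 3 < r'" using est by (simp_all add: l'_def r'_def \<alpha>_def field_simps)
    show "legs l' r' 0 8 m X'" unfolding legs_def
    proof (intro conjI allI impI ballI)
      fix j assume j: "j < 2 * m"
      have "continuous_on {e..s} (X j)" using L j by (simp add: legs_def)
      then have "continuous_on {0..8} (\<lambda>y. X j (e + \<beta> * y))"
        by (rule continuous_on_compose2) (use y in \<open>auto intro!: continuous_intros\<close>)
      moreover have "X' j = (\<lambda>y. (X j (e + \<beta> * y) - x) / \<alpha>)" by (rule ext) (simp add: X'_def)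
      ultimately show "continuous_on {0..8} (X' j)" using pos by (simp add: continuous_intros)
      fix u :: real assume "u \<in> {0..8}"
      then have "l < X j (e + \<beta> * u)" "X j (e + \<beta> * u) < r" using L j y by (simp_all add: legs_def)
      then show "l' < X' j u" "X' j u < r'"
        using pos by (simp_all add: X'_def l'_def r'_def divide_strict_right_mono)
    next
      fix i j and u :: real assume "i < j" "j < 2 * m" "u \<in> {0..8}"
      then have "X i (e + \<beta> * u) < X j (e + \<beta> * u)" using L y by (simp add: legs_def)
      then show "X' i u < X' j u" using pos by (simp add: X'_def divide_strict_right_mono)
    qed
    show "\<forall>y\<in>{0..8}. X' 1 y = 0" using X1 y by (simp add: X'_def)
    show "\<forall>j<2 * m. j \<noteq> 1 \<longrightarrow> (\<forall>y\<in>{0..8}. 3 < \<bar>X' j y - 0\<bar>)"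
    proof (intro allI impI ballI)
      fix j and u :: real assume "j < 2 * m" "j \<noteq> 1" "u \<in> {0..8}"
      then have "a < \<bar>X j (e + \<beta> * u) - x\<bar>" using Xa y by blast
      then show "3 < \<bar>X' j u - 0\<bar>" using pos est by (simp add: X'_def \<alpha>_def abs_divide field_simps)
    qed
    have P: "plat D k l r e s t m X pairs_before" "plat D' k l r e s t m X (pairs_after m)"
      and ag: "agree_outside (k ` rect l r s t) D D'" using H by (simp_all add: H_config_def)
    show "plat D (k \<circ> A) l' r' 0 8 t' m X' pairs_before" "plat D' (k \<circ> A) l' r' 0 8 t' m X' (pairs_after m)"
      using plat_affine[OF pos A_def, where X'=X and X=X' and D=D and k=k and l=l' and r=r' and e=0 and s=8 and t=t'] plat_affine[OF pos A_def, where X'=X and X=X' and D=D' and k=k and l=l' and r=r' and e=0 and s=8 and t=t'] P XX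
      unfolding eqs by blast+
    show "agree_outside ((k \<circ> A) ` rect l' r' 8 t') D D'"
      using ag b(2)[where l=l' and r=r' and b=8 and t=t'] unfolding image_comp[symmetric] eqs by simp
  qed simp_all
  then show thesis by (rule that)
qed

section \<open>A kink turns two ends of an H-move into four\<close>

definition mirror :: "real \<Rightarrow> complex \<Rightarrow> complex" where
  "mirror \<sigma> z = Complex (\<sigma> * Re z) (Im z)"

lemma mirror_simps:
  assumes "\<sigma> = 1 \<or> \<sigma> = -1"
  shows "mirror \<sigma> (mirror \<sigma> z) = z" "bij (mirror \<sigma>)" "continuous_on S (mirror \<sigma>)"
    "mirror \<sigma> ` kink_box = kink_box" "mirror \<sigma> \<i> = \<i>"
proof -
  show 1: "mirror \<sigma> (mirror \<sigma> z) = z" for z using assms by (auto simp: mirror_def complex_eq_iff)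
  show "bij (mirror \<sigma>)" by (rule bij_betw_byWitness[of _ "mirror \<sigma>"]) (auto simp: 1)
  have "mirror \<sigma> = (\<lambda>z. Complex (\<sigma> * Re z) (Im z))" by (rule ext) (simp add: mirror_def)
  then show "continuous_on S (mirror \<sigma>)" by (simp add: continuous_intros)
  have "mirror \<sigma> z \<in> kink_box \<longleftrightarrow> z \<in> kink_box" for z
    using assms by (auto simp: mirror_def kink_box_def in_cbox_complex_iff)
  then show "mirror \<sigma> ` kink_box = kink_box" using 1 by (metis image_eqI image_subsetI subsetI subset_antisym)
  show "mirror \<sigma> \<i> = \<i>" by (simp add: mirror_def complex_eq_iff)
qed

text \<open>
  The three pieces lie below, above and below the level \<open>s\<close> again, so they meet only at their ends.
\<close>

lemma arc_extend:
  assumes "arc a" "arc b" "arc g" and st: "pathstart g = pathfinish a" "pathfinish g = pathfinish b"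
    and a: "\<And>u. 0 \<le> u \<Longrightarrow> u < 1 \<Longrightarrow> Im (a u) < s" and b: "\<And>u. 0 \<le> u \<Longrightarrow> u < 1 \<Longrightarrow> Im (b u) < s"
    and g: "\<And>u. 0 \<le> u \<Longrightarrow> u \<le> 1 \<Longrightarrow> s \<le> Im (g u)"
    and ab: "path_image a \<inter> path_image b = {}"
  shows "arc (a +++ g +++ reversepath b)"
    "path_image (a +++ g +++ reversepath b) = path_image a \<union> path_image g \<union> path_image b"
proof -
  have ga: "path_image a \<inter> path_image g \<subseteq> {pathfinish a}"
  proof
    fix x assume "x \<in> path_image a \<inter> path_image g"
    then obtain u w where u: "0 \<le> u" "u \<le> 1" "x = a u" "0 \<le> w" "w \<le> 1" "x = g w" by (auto simp: path_image_def)
    then have "\<not> u < 1" using a[of u] g[of w] by force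
    then have "u = 1" using u by simp
    then show "x \<in> {pathfinish a}" using u by (simp add: pathfinish_def)
  qed
  have gb: "path_image g \<inter> path_image b \<subseteq> {pathfinish g}"
  proof
    fix x assume "x \<in> path_image g \<inter> path_image b"
    then obtain u w where u: "0 \<le> u" "u \<le> 1" "x = b u" "0 \<le> w" "w \<le> 1" "x = g w" by (auto simp: path_image_def)
    then have "\<not> u < 1" using b[of u] g[of w] by force
    then have "u = 1" using u by simp
    then show "x \<in> {pathfinish g}" using u st by (simp add: pathfinish_def)
  qed
  have 1: "arc (g +++ reversepath b)"
    by (rule arc_join) (use assms gb in \<open>auto simp: arc_reversepath\<close>)
  have pi: "path_image (g +++ reversepath b) = path_image g \<union> path_image b"
    using st by (subst path_image_join) auto
  show "arc (a +++ g +++ reversepath b)"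
    by (rule arc_join) (use assms 1 ga ab st in \<open>auto simp: pi\<close>)
  show "path_image (a +++ g +++ reversepath b) = path_image a \<union> path_image g \<union> path_image b"
    using st by (subst path_image_join) (auto simp: pi)
qed

definition pairing :: "nat \<Rightarrow> (nat \<Rightarrow> nat \<times> nat) \<Rightarrow> bool" where
  "pairing m p \<longleftrightarrow> (\<forall>i<m. fst (p i) < 2 * m \<and> snd (p i) < 2 * m \<and> fst (p i) \<noteq> snd (p i)) \<and>
     (\<forall>i<m. \<forall>j<m. i \<noteq> j \<longrightarrow> {fst (p i), snd (p i)} \<inter> {fst (p j), snd (p j)} = {}) \<and>
     (\<forall>j<2 * m. \<exists>i<m. j = fst (p i) \<or> j = snd (p i))"

lemma kink_slab:
  assumes "0 \<le> u" "u \<le> 8" "2 \<le> kink_y u" "kink_y u \<le> 5/2"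
  shows "kink_x u \<in> {-2, 0, 2}"
  using assms unfolding kink_x_def kink_y_def by (auto split: if_splits)

lemma kink_slab_ex:
  assumes "2 \<le> y" "y \<le> 5/2" "x \<in> {-2, 0, 2}"
  shows "\<exists>u. 0 \<le> u \<and> u \<le> 8 \<and> kink_x u = x \<and> kink_y u = y"
proof -
  consider "x = 0" | "x = 2" | "x = -2" using assms by auto
  then show ?thesis
  proof cases
    case 1 then show ?thesis using assms by (intro exI[of _ y]) (simp add: kink_x_def kink_y_def)
  next
    case 2 then show ?thesis using assms by (intro exI[of _ "(11 - y) / 2"]) (auto simp: kink_x_def kink_y_def field_simps)
  next
    case 3 then show ?thesis using assms by (intro exI[of _ "(11 + y) / 2"]) (auto simp: kink_x_def kink_y_def field_simps)
  qed
qed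

lemma kink_high:
  assumes "0 \<le> u" "u \<le> 8"
  shows "5/2 \<le> kink_y u \<longleftrightarrow> (5/2 \<le> u \<and> u \<le> 17/4) \<or> 27/4 \<le> u"
  using assms unfolding kink_y_def by auto

lemma kink_high_strict:
  assumes "(5/2 < u \<and> u < 17/4) \<or> 27/4 < u"
  shows "5/2 < kink_y u"
  using assms unfolding kink_y_def by auto

lemma kink_bounds: "\<bar>kink_x u\<bar> \<le> 2" "0 \<le> u \<Longrightarrow> 0 \<le> kink_y u" "u \<le> 8 \<Longrightarrow> kink_y u \<le> 8" "u < 8 \<Longrightarrow> kink_y u < 8"
  if "u \<le> 8"
  using that by (auto simp: kink_x_def kink_y_def)

text \<open>
  One of the two diagrams of an \<open>H(m)\<close>-move in normalised position, with a kink on its vertical leg.  The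
  sign \<open>\<sigma>\<close> selects the standard kink or its mirror image.
\<close>

locale kinkable =
  fixes D :: diagram and Q k l r t m X p and \<sigma> :: real
  assumes vld0: "virtual_link_diagram D"
    and chart0: "plane_chart Q k" and sub0: "rect l r 0 t \<subseteq> Q" and t8: "8 < t" and l3: "l < -3" and r3: "3 < r"
    and legs0: "legs l r 0 8 m X"
    and X1: "\<And>y. 0 \<le> y \<Longrightarrow> y \<le> 8 \<Longrightarrow> X 1 y = 0"
    and Xa: "\<And>j y. j < 2 * m \<Longrightarrow> j \<noteq> 1 \<Longrightarrow> 0 \<le> y \<Longrightarrow> y \<le> 8 \<Longrightarrow> 3 < \<bar>X j y\<bar>"
    and plat0: "plat D k l r 0 8 t m X p" and pairing0: "pairing m p"
    and sgn: "\<sigma> = 1 \<or> \<sigma> = -1" and m2: "2 \<le> m"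
begin

abbreviation "km \<equiv> k \<circ> mirror \<sigma>"

abbreviation "E \<equiv> kinked km D"

lemma kmB: "km ` kink_box = k ` kink_box"
  by (simp only: image_comp[symmetric] mirror_simps(4)[OF sgn])

lemma kbsub: "kink_box \<subseteq> rect l r 0 t" "kink_box \<subseteq> rect l r 0 8" "kink_box \<subseteq> Q"
proof -
  show 1: "kink_box \<subseteq> rect l r 0 t" "kink_box \<subseteq> rect l r 0 8"
    using t8 l3 r3 by (auto simp: kink_box_def in_cbox_complex_iff)
  show "kink_box \<subseteq> Q" using 1 sub0 by blast
qed

lemma kb_iff: "Complex x y \<in> kink_box \<longleftrightarrow> \<bar>x\<bar> \<le> 3 \<and> 0 \<le> y \<and> y \<le> 8"
  by (auto simp: kink_box_def in_cbox_complex_iff)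

lemma k_eq: "w \<in> Q \<Longrightarrow> w' \<in> Q \<Longrightarrow> k w = k w' \<longleftrightarrow> w = w'"
  by (rule plane_chart_inj[OF chart0])

lemma slab0: "rect l r 0 8 \<inter> drawing D k = (\<Union>j<2*m. (\<lambda>y. Complex (X j y) y) ` {0..8})"
  and free0: "crossings D \<inter> k ` rect l r 0 t = {}"
  using plat0 by (auto simp: plat_def)

lemma slabE:
  assumes "Complex x y \<in> drawing D k" "l \<le> x" "x \<le> r" "0 \<le> y" "y \<le> 8"
  obtains j where "j < 2 * m" "x = X j y"
proof -
  have "Complex x y \<in> rect l r 0 8 \<inter> drawing D k" using assms by (simp add: in_cbox_complex_iff)
  then show thesis unfolding slab0 using that by auto
qed

lemma leg_in: "j < 2 * m \<Longrightarrow> 0 \<le> y \<Longrightarrow> y \<le> 8 \<Longrightarrow> Complex (X j y) y \<in> drawing D k"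
proof -
  assume j: "j < 2 * m" "0 \<le> y" "y \<le> 8"
  then have "Complex (X j y) y \<in> (\<Union>j<2*m. (\<lambda>y. Complex (X j y) y) ` {0..8})"
    by (intro UN_I[of j] image_eqI[of _ _ y]) auto
  then show ?thesis unfolding slab0[symmetric] by blast
qed

lemma axis: "kink_box \<inter> drawing D k = (\<lambda>y. Complex 0 y) ` {0..8}"
proof
  show "kink_box \<inter> drawing D k \<subseteq> (\<lambda>y. Complex 0 y) ` {0..8}"
  proof
    fix w assume w: "w \<in> kink_box \<inter> drawing D k"
    obtain x y where xy: "w = Complex x y" by (cases w)
    then have b: "\<bar>x\<bar> \<le> 3" "0 \<le> y" "y \<le> 8" using w kb_iff by auto
    have "Complex x y \<in> drawing D k" using w xy by simp
    moreover have "l \<le> x" "x \<le> r" using b l3 r3 by (simp_all add: abs_le_iff)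
    ultimately obtain j where j: "j < 2 * m" "x = X j y" using slabE b by metis
    then have "j = 1" using Xa[of j y] b by force
    then show "w \<in> (\<lambda>y. Complex 0 y) ` {0..8}" using X1[of y] j b xy by auto
  qed
  show "(\<lambda>y. Complex 0 y) ` {0..8} \<subseteq> kink_box \<inter> drawing D k"
    using leg_in[of 1] X1 m2 kb_iff by auto
qed

sublocale flat_strand D "mirror \<sigma> -` Q" km
proof
  show "virtual_link_diagram D" by (rule vld0)
  show "plane_chart (mirror \<sigma> -` Q) km"
    by (rule plane_chart_compose[OF chart0 mirror_simps(2,3)[OF sgn]])
  show "kink_box \<subseteq> mirror \<sigma> -` Q" using mirror_simps(4)[OF sgn] kbsub(3) by blast
  show "crossings D \<inter> km ` kink_box = {}" unfolding kmB using free0 kbsub(1) by blast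
  have "curve D ` circles D \<inter> km ` kink_box = (\<lambda>y. k (Complex 0 y)) ` {0..8}"
    unfolding kmB drawing_image axis by (simp add: image_image)
  also have "\<dots> = (\<lambda>y. km (Complex 0 y)) ` {0..8}" by (simp add: mirror_def)
  finally show "curve D ` circles D \<inter> km ` kink_box = (\<lambda>y. km (Complex 0 y)) ` {0..8}" .
qed

lemma mk_kb: "0 \<le> u \<Longrightarrow> u \<le> 8 \<Longrightarrow> mirror \<sigma> (kink u) \<in> kink_box"
  using kink_in_box mirror_simps(4)[OF sgn] by blast

lemma drawing_E:
  assumes w: "w \<in> Q"
  shows "w \<in> drawing E k \<longleftrightarrow> (w \<in> drawing D k \<and> w \<notin> kink_box) \<or> (\<exists>u. 0 \<le> u \<and> u \<le> 8 \<and> w = mirror \<sigma> (kink u))"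
proof
  assume "w \<in> drawing E k"
  then have "k w \<in> curve E ` circles D" by (simp add: drawing_def)
  then obtain z where z: "z \<in> circles D" "k w = curve E z" by blast
  from z(1) show "(w \<in> drawing D k \<and> w \<notin> kink_box) \<or> (\<exists>u. 0 \<le> u \<and> u \<le> 8 \<and> w = mirror \<sigma> (kink u))"
  proof (cases rule: v_cases)
    case (strand u)
    then have "k w = k (mirror \<sigma> (kink u))" using z by simp
    then have "w = mirror \<sigma> (kink u)" using k_eq[OF w] mk_kb[of u] strand kbsub(3) by blast
    then show ?thesis using strand by blast
  next
    case outside
    then have "k w = curve D z" "k w \<notin> k ` kink_box" using z(2) kmB by simp_all
    moreover have "w \<notin> kink_box" using calculation(2) by blast
    moreover have "w \<in> drawing D k" unfolding drawing_def using calculation(1) z(1) by (metis image_eqI vimageI)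
    ultimately show ?thesis by blast
  qed
next
  assume "(w \<in> drawing D k \<and> w \<notin> kink_box) \<or> (\<exists>u. 0 \<le> u \<and> u \<le> 8 \<and> w = mirror \<sigma> (kink u))"
  then show "w \<in> drawing E k"
  proof
    assume a: "w \<in> drawing D k \<and> w \<notin> kink_box"
    then obtain z where z: "z \<in> circles D" "curve D z = k w" unfolding drawing_def by (auto simp: image_iff)
    have "k w \<notin> k ` kink_box" using plane_chart_mem[OF chart0 kbsub(3) w] a by simp
    then have "curve E z = k w" using kinked_outside[of z] z kmB by simp
    then show ?thesis unfolding drawing_def using z(1) kinked_simps(1) by (metis image_eqI vimageI)
  next
    assume "\<exists>u. 0 \<le> u \<and> u \<le> 8 \<and> w = mirror \<sigma> (kink u)"
    then obtain u where u: "0 \<le> u" "u \<le> 8" "w = mirror \<sigma> (kink u)" by blast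
    then have "curve E (v u) = k w" using kinked_v by simp
    then show ?thesis unfolding drawing_def using v_circles[OF u(1,2)] kinked_simps(1) by (metis image_eqI vimageI)
  qed
qed

text \<open>
  The collar of the kinked diagram is at height \<open>[2, 5/2]\<close>.  There the old vertical leg is replaced by the three
  vertical pieces of the kink, whichever way it is curled.
\<close>

definition Xn :: "nat \<Rightarrow> real \<Rightarrow> real" where
  "Xn j = (if j = 0 then X 0 else if j = 1 then (\<lambda>_. -2) else if j = 2 then (\<lambda>_. 0)
     else if j = 3 then (\<lambda>_. 2) else X (j - 2))"

text \<open>
  The new position of the leg that leads to the old end \<open>j\<close>.  The old vertical leg is reached from the left end
  of the bridge if \<open>\<sigma> = 1\<close> and from its right end if \<open>\<sigma> = -1\<close>; the two remaining new ends are joined by the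
  top of the kink.
\<close>

definition shift :: "nat \<Rightarrow> nat" where
  "shift j = (if j = 0 then 0 else if j = 1 then (if \<sigma> = 1 then 1 else 3) else j + 2)"

lemma X0: "0 \<le> y \<Longrightarrow> y \<le> 8 \<Longrightarrow> X 0 y < -3"
proof -
  assume y: "0 \<le> y" "y \<le> 8"
  have "X 0 y < X 1 y" using legs0 m2 y unfolding legs_def by auto
  then show ?thesis using Xa[of 0 y] X1[of y] y m2 by auto
qed

lemma X2: "2 \<le> j \<Longrightarrow> j < 2 * m \<Longrightarrow> 0 \<le> y \<Longrightarrow> y \<le> 8 \<Longrightarrow> 3 < X j y"
proof -
  assume j: "2 \<le> j" "j < 2 * m" "0 \<le> y" "y \<le> 8"
  have "X 1 y < X j y" using legs0 j unfolding legs_def by auto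
  then show ?thesis using Xa[of j y] X1[of y] j by auto
qed

lemma legs_Xn: "legs l r 2 (5/2) (Suc m) Xn"
proof -
  have b: "l < X j y" "X j y < r" if "j < 2 * m" "0 \<le> y" "y \<le> 8" for j y
    using legs0 that unfolding legs_def by auto
  have c: "continuous_on {2..5/2} (X j)" if "j < 2 * m" for j
    using legs0 that unfolding legs_def by (auto intro: continuous_on_subset)
  have o: "X i y < X j y" if "i < j" "j < 2 * m" "0 \<le> y" "y \<le> 8" for i j y
    using legs0 that unfolding legs_def by auto
  show ?thesis unfolding legs_def
  proof (intro conjI allI impI ballI)
    fix j assume j: "j < 2 * Suc m"
    then have j': "j = 0 \<or> j = 1 \<or> j = 2 \<or> j = 3 \<or> (4 \<le> j \<and> j - 2 < 2 * m)" by auto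
    then show "continuous_on {2..5/2} (Xn j)" using c m2 by (auto simp: Xn_def)
    fix y :: real assume "y \<in> {2..5/2}"
    then have "0 \<le> y" "y \<le> 8" by auto
    then show "l < Xn j y" "Xn j y < r" using j' b[of _ y] l3 r3 m2 by (auto simp: Xn_def)
  next
    fix i j and y :: real assume ij: "i < j" "j < 2 * Suc m" and "y \<in> {2..5/2}"
    then have y: "0 \<le> y" "y \<le> 8" by auto
    have x2: "3 < X (j - 2) y" if "4 \<le> j" using X2[of "j - 2" y] that ij y by simp
    have x0: "X 0 y < - 3" by (rule X0[OF y])
    show "Xn i y < Xn j y"
    proof (cases "4 \<le> i")
      case True
      then show ?thesis using o[of "i - 2" "j - 2" y] ij y by (simp add: Xn_def)
    next
      case False
      then have "i = 0 \<or> i = 1 \<or> i = 2 \<or> i = 3" by linarith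
      moreover have "j = 1 \<or> j = 2 \<or> j = 3 \<or> 4 \<le> j" using ij by linarith
      ultimately show ?thesis using x2 x0 ij by (elim disjE) (simp_all add: Xn_def)
    qed
  qed
qed

lemma kink_coords: "mirror \<sigma> (kink u) = Complex (\<sigma> * kink_x u) (kink_y u)"
  by (simp add: mirror_def kink_def)

lemma slab_E: "rect l r 2 (5/2) \<inter> drawing E k = (\<Union>j<2 * Suc m. (\<lambda>y. Complex (Xn j y) y) ` {2..5/2})"
proof
  have Rsub: "rect l r 2 (5/2) \<subseteq> Q"
    using sub0 t8 by (auto simp: in_cbox_complex_iff subset_iff)
  show "rect l r 2 (5/2) \<inter> drawing E k \<subseteq> (\<Union>j<2 * Suc m. (\<lambda>y. Complex (Xn j y) y) ` {2..5/2})"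
  proof
    fix w assume w: "w \<in> rect l r 2 (5/2) \<inter> drawing E k"
    obtain x y where xy: "w = Complex x y" by (cases w)
    then have b: "l \<le> x" "x \<le> r" "2 \<le> y" "y \<le> 5/2" using w by (auto simp: in_cbox_complex_iff)
    have "\<exists>j<2 * Suc m. x = Xn j y"
    proof -
      have "w \<in> Q" using w Rsub by blast
      from drawing_E[OF this] w consider "w \<in> drawing D k" "w \<notin> kink_box"
        | u where "0 \<le> u" "u \<le> 8" "w = mirror \<sigma> (kink u)" by blast
      then show ?thesis
      proof cases
        case 1
        then obtain j where j: "j < 2 * m" "x = X j y" using slabE[of x y] b xy by auto
        have "j \<noteq> 1" using 1(2) X1[of y] j b unfolding xy kb_iff by auto
        then show ?thesis using j
          by (intro exI[of _ "if j = 0 then 0 else j + 2"]) (auto simp: Xn_def)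
      next
        case 2
        then have "x = \<sigma> * kink_x u" "y = kink_y u" using xy kink_coords by auto
        then have "x \<in> {-2, 0, 2}" using kink_slab[of u] 2 b sgn by auto
        then consider "x = -2" | "x = 0" | "x = 2" by auto
        then show ?thesis
        proof cases
          case 1 then show ?thesis using m2 by (intro exI[of _ 1]) (simp add: Xn_def)
        next
          case 2 then show ?thesis using m2 by (intro exI[of _ 2]) (simp add: Xn_def)
        next
          case 3 then show ?thesis using m2 by (intro exI[of _ 3]) (simp add: Xn_def)
        qed
      qed
    qed
    then obtain j where "j < 2 * Suc m" "x = Xn j y" by blast
    then show "w \<in> (\<Union>j<2 * Suc m. (\<lambda>y. Complex (Xn j y) y) ` {2..5/2})" using xy b
      by (intro UN_I[of j] image_eqI[of _ _ y]) auto
  qed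
  show "(\<Union>j<2 * Suc m. (\<lambda>y. Complex (Xn j y) y) ` {2..5/2}) \<subseteq> rect l r 2 (5/2) \<inter> drawing E k"
  proof
    fix w assume "w \<in> (\<Union>j<2 * Suc m. (\<lambda>y. Complex (Xn j y) y) ` {2..5/2})"
    then obtain j y where j: "j < 2 * Suc m" "w = Complex (Xn j y) y" and y: "2 \<le> y" "y \<le> 5/2" by auto
    have "l < Xn j y" "Xn j y < r" using legs_Xn j(1) y unfolding legs_def by auto
    then have wR: "w \<in> rect l r 2 (5/2)" using j y by (simp add: in_cbox_complex_iff)
    have y8: "0 \<le> y" "y \<le> 8" using y by auto
    have "(w \<in> drawing D k \<and> w \<notin> kink_box) \<or> (\<exists>u. 0 \<le> u \<and> u \<le> 8 \<and> w = mirror \<sigma> (kink u))"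
    proof (cases "j = 0 \<or> 4 \<le> j")
      case True
      then obtain i where i: "i < 2 * m" "i \<noteq> 1" "Xn j = X i"
      proof
        assume "j = 0" then show thesis using that[of 0] m2 by (simp add: Xn_def)
      next
        assume "4 \<le> j" then show thesis using that[of "j - 2"] j by (simp add: Xn_def)
      qed
      then show ?thesis using leg_in[of i y] Xa[of i y] y8 unfolding j(2) i(3) kb_iff by auto
    next
      case False
      then have "j = 1 \<or> j = 2 \<or> j = 3" by linarith
      then have "\<sigma> * Xn j y \<in> {-2, 0, 2}" using sgn by (auto simp: Xn_def)
      then obtain u where u: "0 \<le> u" "u \<le> 8" "kink_x u = \<sigma> * Xn j y" "kink_y u = y"
        using kink_slab_ex[OF y] by blast
      have "\<sigma> * (\<sigma> * Xn j y) = Xn j y" using sgn by auto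
      then show ?thesis using u j(2) kink_coords[of u] by auto
    qed
    then show "w \<in> rect l r 2 (5/2) \<inter> drawing E k" using wR drawing_E Rsub by blast
  qed
qed

end

context kinkable
begin

text \<open>
  The arc from the new collar up to the old end \<open>j\<close>.
\<close>

definition rise :: "nat \<Rightarrow> real \<Rightarrow> complex" where
  "rise j = (if j = 1 then (\<lambda>u. mirror \<sigma> (kink (27/4 + 5/4 * u)))
     else (\<lambda>u. Complex (X j (5/2 + 11/2 * u)) (5/2 + 11/2 * u)))"

text \<open>
  The top of the kink; together with the old cups it makes \<open>m + 1\<close> cups.
\<close>

definition newcup :: "real \<Rightarrow> complex" where
  "newcup u = mirror \<sigma> (kink (5/2 + 7/4 * u))"

lemma m_inj: "mirror \<sigma> x = mirror \<sigma> y \<longleftrightarrow> x = y"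
  using mirror_simps(2)[OF sgn] by (simp add: bij_def inj_eq)

lemma arc_mirror_kink:
  assumes "0 \<le> b" "0 < c" "b + c \<le> 8" "\<not> (b \<le> 1 \<and> 11/2 \<le> b + c)"
  shows "arc (\<lambda>u. mirror \<sigma> (kink (b + c * u)))"
proof -
  have "continuous_on {0..1} (\<lambda>u. mirror \<sigma> (kink (b + c * u)))"
    by (rule continuous_on_compose2[OF mirror_simps(3)[OF sgn, of UNIV]])
       (auto intro!: continuous_on_compose2[OF continuous_kink[of UNIV]] continuous_intros)
  moreover have "inj_on (\<lambda>u. mirror \<sigma> (kink (b + c * u))) {0..1}"
  proof (rule inj_onI)
    fix u w :: real assume u: "u \<in> {0..1}" "w \<in> {0..1}" and eq: "mirror \<sigma> (kink (b + c * u)) = mirror \<sigma> (kink (b + c * w))"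
    have r: "b \<le> b + c * x \<and> b + c * x \<le> b + c" if "x \<in> {0..1}" for x
      using that assms(2) by (simp add: mult_left_le)
    have 1: "0 \<le> b + c * u" "b + c * u \<le> 8" "0 \<le> b + c * w" "b + c * w \<le> 8"
      using r[OF u(1)] r[OF u(2)] assms by linarith+
    have "b + c * u = b + c * w"
      using kink_eq_iff[OF 1] eq m_inj r[OF u(1)] r[OF u(2)] assms(4) by auto
    then show "u = w" using assms(2) by simp
  qed
  ultimately show ?thesis unfolding arc_def path_def by blast
qed

lemma arc_newcup: "arc newcup"
proof -
  have "newcup = (\<lambda>u. mirror \<sigma> (kink (5/2 + 7/4 * u)))" by (rule ext) (simp add: newcup_def)
  then show ?thesis using arc_mirror_kink[of "5/2" "7/4"] by simp
qed

lemma arc_rise: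
  assumes j: "j < 2 * m" shows "arc (rise j)"
proof (cases "j = 1")
  case True
  then show ?thesis using arc_mirror_kink[of "27/4" "5/4"] by (simp add: rise_def)
next
  case False
  have "continuous_on {0..8} (X j)" using legs0 j by (simp add: legs_def)
  then have "continuous_on {0..1} (\<lambda>u. X j (5/2 + 11/2 * u))"
    by (rule continuous_on_compose2) (auto intro!: continuous_intros)
  then have "continuous_on {0..1} (\<lambda>u. Complex (X j (5/2 + 11/2 * u)) (5/2 + 11/2 * u))"
    by (intro continuous_intros)
  then show ?thesis using False unfolding arc_def path_def rise_def by (auto simp: inj_on_def)
qed

lemma rise_ends:
  assumes j: "j < 2 * m"
  shows "pathstart (rise j) = Complex (Xn (shift j) (5/2)) (5/2)" "pathfinish (rise j) = Complex (X j 8) 8"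
proof -
  show "pathstart (rise j) = Complex (Xn (shift j) (5/2)) (5/2)"
    using sgn by (auto simp: rise_def pathstart_def Xn_def shift_def kink_coords kink_x_def kink_y_def)
  show "pathfinish (rise j) = Complex (X j 8) 8"
    using X1[of 8] by (auto simp: rise_def pathfinish_def kink_ends mirror_def)
qed

lemma newcup_ends: "pathstart newcup = Complex 0 (5/2)" "pathfinish newcup = Complex (2 * \<sigma>) (5/2)"
  by (auto simp: newcup_def pathstart_def pathfinish_def kink_coords kink_x_def kink_y_def)

lemma rise_bounds:
  assumes j: "j < 2 * m" and u: "0 \<le> u" "u \<le> 1"
  shows "l < Re (rise j u)" "Re (rise j u) < r" "u < 1 \<Longrightarrow> Im (rise j u) < 8" "Im (rise j u) \<le> 8"
    "0 < u \<Longrightarrow> 5/2 < Im (rise j u)" "5/2 \<le> Im (rise j u)" "j \<noteq> 1 \<Longrightarrow> 3 < \<bar>Re (rise j u)\<bar>" "j = 1 \<Longrightarrow> \<bar>Re (rise j u)\<bar> \<le> 2"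
proof -
  have 1: "0 \<le> 5/2 + 11/2 * u" "5/2 + 11/2 * u \<le> 8" using u by auto
  have X: "l < X j (5/2 + 11/2 * u)" "X j (5/2 + 11/2 * u) < r" using legs0 j 1 by (auto simp: legs_def)
  have k: "\<bar>\<sigma> * kink_x (27/4 + 5/4 * u)\<bar> \<le> 2"
    using kink_bounds(1)[of "27/4 + 5/4 * u"] sgn u by (auto simp: abs_mult)
  then have k': "- 2 \<le> \<sigma> * kink_x (27/4 + 5/4 * u)" "\<sigma> * kink_x (27/4 + 5/4 * u) \<le> 2" by linarith+
  show "l < Re (rise j u)" "Re (rise j u) < r"
    using X k' l3 r3 by (auto simp: rise_def kink_coords)
  show "u < 1 \<Longrightarrow> Im (rise j u) < 8" "Im (rise j u) \<le> 8"
    using kink_bounds(3,4)[of "27/4 + 5/4 * u"] u by (auto simp: rise_def kink_coords)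
  show "0 < u \<Longrightarrow> 5/2 < Im (rise j u)"
    using kink_high_strict[of "27/4 + 5/4 * u"] u by (auto simp: rise_def kink_coords)
  show "5/2 \<le> Im (rise j u)"
    using kink_high[of "27/4 + 5/4 * u"] u by (auto simp: rise_def kink_coords)
  show "j \<noteq> 1 \<Longrightarrow> 3 < \<bar>Re (rise j u)\<bar>" using Xa[OF j] 1 by (simp add: rise_def)
  show "j = 1 \<Longrightarrow> \<bar>Re (rise j u)\<bar> \<le> 2" using k by (simp add: rise_def kink_coords)
qed

lemma newcup_bounds:
  assumes u: "0 \<le> u" "u \<le> 1"
  shows "\<bar>Re (newcup u)\<bar> \<le> 2" "Im (newcup u) \<le> 8" "5/2 \<le> Im (newcup u)" "0 < u \<Longrightarrow> u < 1 \<Longrightarrow> 5/2 < Im (newcup u)"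
proof -
  have 1: "5/2 + 7/4 * u \<le> 8" "0 \<le> 5/2 + 7/4 * u" using u by simp_all
  show "\<bar>Re (newcup u)\<bar> \<le> 2"
    using kink_bounds(1)[OF 1(1)] sgn by (auto simp: newcup_def kink_coords abs_mult)
  show "Im (newcup u) \<le> 8" using kink_bounds(3)[OF 1(1) 1(1)] by (simp add: newcup_def kink_coords)
  show "5/2 \<le> Im (newcup u)" using kink_high[OF 1(2) 1(1)] u by (simp add: newcup_def kink_coords)
  show "0 < u \<Longrightarrow> u < 1 \<Longrightarrow> 5/2 < Im (newcup u)"
    using kink_high_strict[of "5/2 + 7/4 * u"] u by (simp add: newcup_def kink_coords)
qed

lemma rise_disjoint:
  assumes "i < 2 * m" "j < 2 * m" "i \<noteq> j" shows "path_image (rise i) \<inter> path_image (rise j) = {}"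
proof (rule ccontr)
  assume "path_image (rise i) \<inter> path_image (rise j) \<noteq> {}"
  then obtain u w where u: "0 \<le> u" "u \<le> 1" "0 \<le> w" "w \<le> 1" "rise i u = rise j w" by (auto simp: path_image_def)
  show False
  proof (cases "i = 1 \<or> j = 1")
    case True
    then show False using rise_bounds(7,8)[OF assms(1) u(1,2)] rise_bounds(7,8)[OF assms(2) u(3,4)] u(5) assms(3) by auto
  next
    case False
    then have "u = w \<and> X i (5/2 + 11/2 * u) = X j (5/2 + 11/2 * w)"
      using u(5) by (auto simp: rise_def)
    then have "X i (5/2 + 11/2 * u) = X j (5/2 + 11/2 * u)" "5/2 + 11/2 * u \<in> {0..8}" using u by auto
    then show False using legs0 assms unfolding legs_def by (metis less_irrefl linorder_neqE_nat)
  qed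
qed

lemma rise_newcup_disjoint:
  assumes "j < 2 * m" shows "path_image (rise j) \<inter> path_image newcup = {}"
proof (rule ccontr)
  assume "path_image (rise j) \<inter> path_image newcup \<noteq> {}"
  then obtain u w where u: "0 \<le> u" "u \<le> 1" "0 \<le> w" "w \<le> 1" "rise j u = newcup w" by (auto simp: path_image_def)
  show False
  proof (cases "j = 1")
    case True
    then have "kink (27/4 + 5/4 * u) = kink (5/2 + 7/4 * w)"
      using u(5) m_inj by (simp add: rise_def newcup_def)
    then show False using kink_eq_iff[of "27/4 + 5/4 * u" "5/2 + 7/4 * w"] u by auto
  next
    case False
    then show False using rise_bounds(7)[OF assms u(1,2)] newcup_bounds(1)[OF u(3,4)] u(5) by simp
  qed
qed

lemma Rsub: "rect l r (5/2) t \<subseteq> Q" "rect l r 8 t \<subseteq> Q" "rect l r 2 t \<subseteq> Q"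
  using sub0 t8 by (auto simp: in_cbox_complex_iff subset_iff)

lemma upper_E:
  assumes "cups (drawing D k) l r 8 t m (\<lambda>j. X j 8) p g"
  shows "rect l r (5/2) t \<inter> drawing E k = path_image newcup \<union> (\<Union>j<2*m. path_image (rise j)) \<union> (\<Union>i<m. path_image (g i))"
proof
  note g = cupsD[OF assms]
  show "rect l r (5/2) t \<inter> drawing E k \<subseteq> path_image newcup \<union> (\<Union>j<2*m. path_image (rise j)) \<union> (\<Union>i<m. path_image (g i))"
  proof
    fix w assume w: "w \<in> rect l r (5/2) t \<inter> drawing E k"
    obtain x y where xy: "w = Complex x y" by (cases w)
    then have b: "l \<le> x" "x \<le> r" "5/2 \<le> y" "y \<le> t" using w by (auto simp: in_cbox_complex_iff)
    have "w \<in> Q" using w Rsub by blast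
    from drawing_E[OF this] w consider "w \<in> drawing D k" "w \<notin> kink_box"
      | u where "0 \<le> u" "u \<le> 8" "w = mirror \<sigma> (kink u)" by blast
    then show "w \<in> path_image newcup \<union> (\<Union>j<2*m. path_image (rise j)) \<union> (\<Union>i<m. path_image (g i))"
    proof cases
      case 1
      show ?thesis
      proof (cases "y \<le> 8")
        case True
        then obtain j where j: "j < 2 * m" "x = X j y" using slabE[of x y] 1(1) b xy by auto
        have "j \<noteq> 1" using 1(2) X1[of y] j b True unfolding xy kb_iff by auto
        moreover have "5/2 + 11/2 * ((y - 5/2) / (11/2)) = y" by (simp add: field_simps)
        ultimately have "w = rise j ((y - 5/2) / (11/2))" using j xy unfolding rise_def by simp
        moreover have "(y - 5/2) / (11/2) \<in> {0..1}" using b True by simp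
        ultimately have "w \<in> path_image (rise j)" unfolding path_image_def by blast
        then show ?thesis using j(1) by blast
      next
        case False
        then have "w \<in> rect l r 8 t \<inter> drawing D k" using 1 b xy by (simp add: in_cbox_complex_iff)
        then show ?thesis using g(6) by blast
      qed
    next
      case 2
      then have "5/2 \<le> kink_y u" using b xy kink_coords by auto
      then have "(5/2 \<le> u \<and> u \<le> 17/4) \<or> 27/4 \<le> u" using kink_high 2 by blast
      then show ?thesis
      proof
        assume u: "5/2 \<le> u \<and> u \<le> 17/4"
        have "5/2 + 7/4 * ((u - 5/2) / (7/4)) = u" by (simp add: field_simps)
        then have "w = newcup ((u - 5/2) / (7/4))" using 2 unfolding newcup_def by simp
        moreover have "(u - 5/2) / (7/4) \<in> {0..1}" using u by simp
        ultimately show ?thesis unfolding path_image_def by blast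
      next
        assume u: "27/4 \<le> u"
        have "27/4 + 5/4 * ((u - 27/4) / (5/4)) = u" by (simp add: field_simps)
        then have "w = rise 1 ((u - 27/4) / (5/4))" using 2 unfolding rise_def by simp
        moreover have "(u - 27/4) / (5/4) \<in> {0..1}" using u 2 by simp
        ultimately have "w \<in> path_image (rise 1)" unfolding path_image_def by blast
        then show ?thesis using m2 by auto
      qed
    qed
  qed
  show "path_image newcup \<union> (\<Union>j<2*m. path_image (rise j)) \<union> (\<Union>i<m. path_image (g i)) \<subseteq> rect l r (5/2) t \<inter> drawing E k"
  proof (intro Un_least UN_least)
    show "path_image newcup \<subseteq> rect l r (5/2) t \<inter> drawing E k"
    proof
      fix w assume "w \<in> path_image newcup"
      then obtain u where u: "0 \<le> u" "u \<le> 1" "w = newcup u" by (auto simp: path_image_def)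
      have R: "w \<in> rect l r (5/2) t"
        using newcup_bounds[OF u(1,2)] u(3) l3 r3 t8 by (auto simp: in_cbox_complex_iff abs_le_iff)
      moreover have "w = mirror \<sigma> (kink (5/2 + 7/4 * u))" "0 \<le> 5/2 + 7/4 * u" "5/2 + 7/4 * u \<le> 8"
        using u by (simp_all add: newcup_def)
      ultimately show "w \<in> rect l r (5/2) t \<inter> drawing E k" using drawing_E Rsub by blast
    qed
    fix j assume "j \<in> {..<2*m}"
    then have j: "j < 2 * m" by simp
    show "path_image (rise j) \<subseteq> rect l r (5/2) t \<inter> drawing E k"
    proof
      fix w assume "w \<in> path_image (rise j)"
      then obtain u where u: "0 \<le> u" "u \<le> 1" "w = rise j u" by (auto simp: path_image_def)
      have R: "w \<in> rect l r (5/2) t"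
        using rise_bounds(1,2,4,6)[OF j u(1,2)] u(3) t8 by (simp add: in_cbox_complex_iff)
      have "(w \<in> drawing D k \<and> w \<notin> kink_box) \<or> (\<exists>u. 0 \<le> u \<and> u \<le> 8 \<and> w = mirror \<sigma> (kink u))"
      proof (cases "j = 1")
        case True
        then have "w = mirror \<sigma> (kink (27/4 + 5/4 * u))" "0 \<le> 27/4 + 5/4 * u" "27/4 + 5/4 * u \<le> 8"
          using u by (simp_all add: rise_def)
        then show ?thesis by blast
      next
        case False
        then have "w = Complex (X j (5/2 + 11/2 * u)) (5/2 + 11/2 * u)" using u by (simp add: rise_def)
        moreover have "0 \<le> 5/2 + 11/2 * u" "5/2 + 11/2 * u \<le> 8" using u by simp_all
        ultimately show ?thesis using leg_in[OF j] Xa[OF j False] kb_iff by force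
      qed
      then show "w \<in> rect l r (5/2) t \<inter> drawing E k" using R drawing_E Rsub by blast
    qed
  next
    fix i assume "i \<in> {..<m}"
    then have i: "i < m" by simp
    show "path_image (g i) \<subseteq> rect l r (5/2) t \<inter> drawing E k"
    proof
      fix w assume "w \<in> path_image (g i)"
      then have w: "w \<in> rect l r 8 t" "w \<in> drawing D k" using g(6) i by blast+
      obtain x y where xy: "w = Complex x y" by (cases w)
      then have b: "l \<le> x" "x \<le> r" "8 \<le> y" "y \<le> t" using w by (auto simp: in_cbox_complex_iff)
      have R: "w \<in> rect l r (5/2) t" using b xy by (simp add: in_cbox_complex_iff)
      have "w = mirror \<sigma> (kink 8)" if kb: "w \<in> kink_box"
      proof -
        have y: "y = 8" "\<bar>x\<bar> \<le> 3" using kb b unfolding xy kb_iff by auto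
        then obtain j where j: "j < 2 * m" "x = X j 8" using slabE[of x 8] w(2) b xy by auto
        then have "j = 1" using Xa[of j 8] y by force
        then show ?thesis using X1[of 8] j y xy by (simp add: kink_ends mirror_def)
      qed
      then have "(w \<in> drawing D k \<and> w \<notin> kink_box) \<or> (\<exists>u. 0 \<le> u \<and> u \<le> 8 \<and> w = mirror \<sigma> (kink u))"
        using w(2) by force
      then show "w \<in> rect l r (5/2) t \<inter> drawing E k" using R drawing_E Rsub by blast
    qed
  qed
qed

definition new_pairs :: "nat \<Rightarrow> nat \<Rightarrow> nat \<times> nat" where
  "new_pairs c i = (if i = c then (if \<sigma> = 1 then (2, 3) else (1, 2))
     else map_prod shift shift (p (if i < c then i else i - 1)))"

text \<open>
  The additional cup may be given any index \<open>c\<close>; the pairings before and after the move need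
  different values.
\<close>

theorem kinked_plat:
  assumes c: "c \<le> m"
  shows "plat E k l r 2 (5/2) t (Suc m) Xn (new_pairs c)"
proof -
  from plat0 obtain g where cups: "cups (drawing D k) l r 8 t m (\<lambda>j. X j 8) p g" by (auto simp: plat_def)
  note g = cupsD[OF cups]
  have p: "fst (p i) < 2 * m" "snd (p i) < 2 * m" "fst (p i) \<noteq> snd (p i)" if "i < m" for i
    using pairing0 that by (auto simp: pairing_def)
  have pd: "{fst (p i), snd (p i)} \<inter> {fst (p j), snd (p j)} = {}" if "i < m" "j < m" "i \<noteq> j" for i j
    using pairing0 that by (simp add: pairing_def)
  have pc: "\<exists>i<m. j = fst (p i) \<or> j = snd (p i)" if "j < 2 * m" for j
    using pairing0 that by (simp add: pairing_def)
  define h where "h i = rise (fst (p i)) +++ g i +++ reversepath (rise (snd (p i)))" for i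
  have gIm: "8 \<le> Im (g i u)" if "i < m" "0 \<le> u" "u \<le> 1" for i u
  proof -
    have "g i u \<in> path_image (g i)" using that by (simp add: path_image_def)
    then have "g i u \<in> rect l r 8 t" using g(6) that(1) by blast
    then show ?thesis by (simp add: in_cbox_complex_iff)
  qed
  have harc: "arc (h i)" and him: "path_image (h i) = path_image (rise (fst (p i))) \<union> path_image (g i) \<union> path_image (rise (snd (p i)))"
    if i: "i < m" for i
  proof -
    note a = arc_extend[of "rise (fst (p i))" "rise (snd (p i))" "g i" 8, OF arc_rise[OF p(1)[OF i]] arc_rise[OF p(2)[OF i]] g(1)[OF i]]
    have 1: "pathstart (g i) = pathfinish (rise (fst (p i)))" "pathfinish (g i) = pathfinish (rise (snd (p i)))"
      using g(2,3)[OF i] rise_ends(2) p[OF i] by simp_all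
    show "arc (h i)" unfolding h_def
      by (rule a(1)[OF 1]) (use rise_bounds(3) p[OF i] gIm[OF i] rise_disjoint in auto)
    show "path_image (h i) = path_image (rise (fst (p i))) \<union> path_image (g i) \<union> path_image (rise (snd (p i)))"
      unfolding h_def
      by (rule a(2)[OF 1]) (use rise_bounds(3) p[OF i] gIm[OF i] rise_disjoint in auto)
  qed
  have hs: "pathstart (h i) = pathstart (rise (fst (p i)))" "pathfinish (h i) = pathstart (rise (snd (p i)))" for i
    by (simp_all add: h_def)
  have gr: "path_image (g i) \<inter> path_image (rise j) \<subseteq> {Complex (X j 8) 8}" if i: "i < m" and j: "j < 2 * m" for i j
  proof
    fix w assume "w \<in> path_image (g i) \<inter> path_image (rise j)"
    then obtain u x where u: "0 \<le> u" "u \<le> 1" "w = rise j u" "0 \<le> x" "x \<le> 1" "w = g i x" by (auto simp: path_image_def)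
    then have "8 \<le> Im (rise j u)" using gIm[OF i u(4,5)] by simp
    then have "\<not> u < 1" using rise_bounds(3)[OF j u(1,2)] by (meson linorder_not_less)
    with u(2) have "u = 1" by linarith
    then show "w \<in> {Complex (X j 8) 8}" using u rise_ends(2)[OF j] by (simp add: pathfinish_def)
  qed
  have g8: "Complex (X j 8) 8 \<notin> path_image (g i)" if i: "i < m" and j: "j < 2 * m" "j \<noteq> fst (p i)" "j \<noteq> snd (p i)" for i j
  proof
    assume "Complex (X j 8) 8 \<in> path_image (g i)"
    then obtain u where u: "0 \<le> u" "u \<le> 1" "Complex (X j 8) 8 = g i u" by (auto simp: path_image_def)
    have "Complex (X j 8) 8 \<notin> open_rect l r 8 t" by (simp add: in_box_complex_iff)
    then have "\<not> (0 < u \<and> u < 1)" using g(4)[OF i, of u] u(3) by metis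
    then have "u = 0 \<or> u = 1" using u by auto
    then have "X j 8 = X (fst (p i)) 8 \<or> X j 8 = X (snd (p i)) 8"
      using u(3) g(2,3)[OF i] by (auto simp: pathstart_def pathfinish_def)
    moreover have "X j 8 \<noteq> X j' 8" if "j' < 2 * m" "j \<noteq> j'" for j'
      using legs0 j(1) that unfolding legs_def by (metis atLeastAtMost_iff less_irrefl linorder_neqE_nat order_refl zero_le_numeral)
    ultimately show False using p[OF i] j by metis
  qed
  have hdisj: "path_image (h i) \<inter> path_image (h j) = {}" if ij: "i < m" "j < m" "i \<noteq> j" for i j
  proof -
    have 1: "path_image (rise a) \<inter> path_image (rise b) = {}" if "a \<in> {fst (p i), snd (p i)}" "b \<in> {fst (p j), snd (p j)}" for a b
      using rise_disjoint[of a b] that p ij pd[OF ij] by blast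
    have 2: "path_image (g i) \<inter> path_image (rise b) = {}" if "b \<in> {fst (p j), snd (p j)}" for b
    proof -
      have b: "b < 2 * m" "b \<noteq> fst (p i)" "b \<noteq> snd (p i)" using that p[OF ij(2)] pd[OF ij] by auto
      then show ?thesis using gr[OF ij(1) b(1)] g8[OF ij(1) b] by blast
    qed
    have 3: "path_image (g j) \<inter> path_image (rise b) = {}" if "b \<in> {fst (p i), snd (p i)}" for b
    proof -
      have b: "b < 2 * m" "b \<noteq> fst (p j)" "b \<noteq> snd (p j)" using that p[OF ij(1)] pd[OF ij] by auto
      then show ?thesis using gr[OF ij(2) b(1)] g8[OF ij(2) b] by blast
    qed
    have 4: "path_image (g i) \<inter> path_image (g j) = {}" by (rule g(5)[OF ij])
    have "path_image (rise (fst (p i))) \<inter> path_image (rise (fst (p j))) = {}"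
      "path_image (rise (fst (p i))) \<inter> path_image (rise (snd (p j))) = {}"
      "path_image (rise (snd (p i))) \<inter> path_image (rise (fst (p j))) = {}"
      "path_image (rise (snd (p i))) \<inter> path_image (rise (snd (p j))) = {}"
      by (rule 1; simp)+
    moreover have "path_image (g i) \<inter> path_image (rise (fst (p j))) = {}" "path_image (g i) \<inter> path_image (rise (snd (p j))) = {}"
      by (rule 2; simp)+
    moreover have "path_image (g j) \<inter> path_image (rise (fst (p i))) = {}" "path_image (g j) \<inter> path_image (rise (snd (p i))) = {}"
      by (rule 3; simp)+
    moreover have "(A \<union> B \<union> C) \<inter> (A' \<union> B' \<union> C') = {}"
      if "A \<inter> A' = {}" "A \<inter> C' = {}" "C \<inter> A' = {}" "C \<inter> C' = {}" "B \<inter> A' = {}" "B \<inter> C' = {}"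
        "B' \<inter> A = {}" "B' \<inter> C = {}" "B \<inter> B' = {}" for A B C A' B' C' :: "complex set"
      using that by blast
    ultimately show ?thesis unfolding him[OF ij(1)] him[OF ij(2)] using 4 by simp
  qed
  have hnew: "path_image (h i) \<inter> path_image newcup = {}" if i: "i < m" for i
  proof -
    have "path_image (g i) \<inter> path_image newcup = {}"
    proof (rule ccontr)
      assume "path_image (g i) \<inter> path_image newcup \<noteq> {}"
      then obtain u w where u: "0 \<le> u" "u \<le> 1" "0 \<le> w" "w \<le> 1" "g i w = newcup u" by (auto simp: path_image_def)
      have "8 \<le> kink_y (5/2 + 7/4 * u)" using gIm[OF i u(3,4)] u(5) by (simp add: newcup_def kink_coords)
      then show False using kink_bounds(4)[of "5/2 + 7/4 * u"] u by simp
    qed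
    then show ?thesis unfolding him[OF i] using rise_newcup_disjoint p[OF i] by (simp add: Int_Un_distrib2)
  qed
  have hin: "h i u \<in> open_rect l r (5/2) t" if i: "i < m" and u: "0 < u" "u < 1" for i u
  proof -
    have "h i u \<in> path_image (h i)" using u by (simp add: path_image_def)
    then have mem: "h i u \<in> path_image (rise (fst (p i))) \<union> path_image (g i) \<union> path_image (rise (snd (p i)))"
      unfolding him[OF i] .
    have inj: "inj_on (h i) {0..1}" using harc[OF i] by (simp add: arc_def)
    have "h i u \<noteq> h i 0" "h i u \<noteq> h i 1" using inj_onD[OF inj, of u 0] inj_onD[OF inj, of u 1] u by auto
    then have ne: "h i u \<noteq> rise (fst (p i)) 0" "h i u \<noteq> rise (snd (p i)) 0"
      using hs[of i] by (simp_all add: pathstart_def pathfinish_def)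
    have rin: "w \<in> open_rect l r (5/2) t" if "w \<in> path_image (rise j)" "w \<noteq> rise j 0" "j < 2 * m" for w j
    proof -
      obtain x where x: "0 \<le> x" "x \<le> 1" "w = rise j x" using \<open>w \<in> path_image (rise j)\<close> by (auto simp: path_image_def)
      then have "0 < x" using \<open>w \<noteq> rise j 0\<close> by (cases "x = 0") auto
      then show ?thesis using rise_bounds(1,2,4,5)[OF \<open>j < 2 * m\<close> x(1,2)] t8 x(3) by (simp add: in_box_complex_iff)
    qed
    have gin: "w \<in> open_rect l r (5/2) t" if "w \<in> path_image (g i)" for w
    proof -
      obtain x where x: "0 \<le> x" "x \<le> 1" "w = g i x" using \<open>w \<in> path_image (g i)\<close> by (auto simp: path_image_def)
      have e: "Complex (X j 8) 8 \<in> open_rect l r (5/2) t" if "j < 2 * m" for j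
        using legs0 that t8 by (simp add: in_box_complex_iff legs_def)
      consider "x = 0" | "x = 1" | "0 < x" "x < 1" using x by linarith
      then show ?thesis
      proof cases
        case 1 then show ?thesis using x g(2)[OF i] e p[OF i] by (simp add: pathstart_def)
      next
        case 2 then show ?thesis using x g(3)[OF i] e p[OF i] by (simp add: pathfinish_def)
      next
        case 3 then show ?thesis using x g(4)[OF i, of x] by (auto simp: in_box_complex_iff)
      qed
    qed
    show ?thesis using mem ne rin gin p[OF i] by blast
  qed
  define b where "b \<longleftrightarrow> \<sigma> = 1"
  define new where "new = (if b then newcup else reversepath newcup)"
  have new_ends: "pathstart new = Complex (if b then 0 else - 2) (5/2)" "pathfinish new = Complex (if b then 2 else 0) (5/2)"
  proof -
    have s: "2 * \<sigma> = (if b then 2 else -2)" using sgn by (auto simp: b_def)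
    show "pathstart new = Complex (if b then 0 else - 2) (5/2)" "pathfinish new = Complex (if b then 2 else 0) (5/2)"
      using newcup_ends unfolding s by (simp_all add: new_def)
  qed
  have new: "arc new" "path_image new = path_image newcup"
    using arc_newcup by (simp_all add: new_def arc_reversepath)
  have newin: "new u \<in> open_rect l r (5/2) t" if "0 < u" "u < 1" for u
  proof -
    have "newcup x \<in> open_rect l r (5/2) t" if "0 < x" "x < 1" for x
      using newcup_bounds[of x] that l3 r3 t8 by (auto simp: in_box_complex_iff abs_le_iff)
    then show ?thesis using that by (simp add: new_def reversepath_def)
  qed
  define G where "G i = (if i = c then new else h (if i < c then i else i - 1))" for i
  define old where "old i = (if i < c then i else i - 1)" for i
  have old: "old i < m" if "i < Suc m" "i \<noteq> c" for i using that c by (auto simp: old_def)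
  have old_inj: "old i \<noteq> old j" if "i \<noteq> j" "i \<noteq> c" "j \<noteq> c" for i j
    using that by (auto simp: old_def split: if_splits)
  have old_sur: "\<exists>i<Suc m. i \<noteq> c \<and> old i = j" if "j < m" for j
    using that by (intro exI[of _ "if j < c then j else Suc j"]) (auto simp: old_def)
  have G: "G i = (if i = c then new else h (old i))" for i by (simp add: G_def old_def)
  have np: "new_pairs c i = (if i = c then (if b then (2, 3) else (1, 2)) else map_prod shift shift (p (old i)))" for i
    by (simp only: new_pairs_def old_def b_def)
  have Xn: "Xn 1 y = -2" "Xn 2 y = 0" "Xn 3 y = 2" for y by (simp_all add: Xn_def)
  have cE: "cups (drawing E k) l r (5/2) t (Suc m) (\<lambda>j. Xn j (5/2)) (new_pairs c) G"
    unfolding cups_def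
  proof (intro conjI allI impI)
    fix i assume i: "i < Suc m"
    show "arc (G i)" using new(1) harc old i by (simp add: G)
    show "pathstart (G i) = Complex (Xn (fst (new_pairs c i)) (5/2)) (5/2)"
      using new_ends Xn rise_ends(1) p old[OF i] hs by (auto simp: G np)
    show "pathfinish (G i) = Complex (Xn (snd (new_pairs c i)) (5/2)) (5/2)"
      using new_ends Xn rise_ends(1) p old[OF i] hs by (auto simp: G np)
    show "G i u \<in> open_rect l r (5/2) t" if "0 < u" "u < 1" for u
      using newin hin[OF old[OF i]] that by (simp add: G)
    show "path_image (G i) \<inter> path_image (G j) = {}" if j: "j < Suc m" "i \<noteq> j" for j
      using hdisj[OF old[OF i] old[OF j(1)]] hnew[OF old[OF i]] hnew[OF old[OF j(1)]] new(2) old_inj[OF j(2)] j(2)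
      by (auto simp: G Int_commute)
  next
    have "(\<Union>i<Suc m. path_image (G i)) = path_image new \<union> (\<Union>i<m. path_image (h i))"
    proof
      show "(\<Union>i<Suc m. path_image (G i)) \<subseteq> path_image new \<union> (\<Union>i<m. path_image (h i))"
        using old by (auto simp: G split: if_splits)
      have "path_image new \<subseteq> (\<Union>i<Suc m. path_image (G i))" using c by (intro UN_upper[of c, THEN subset_trans[rotated]]) (auto simp: G)
      moreover have "path_image (h j) \<subseteq> (\<Union>i<Suc m. path_image (G i))" if j: "j < m" for j
      proof -
        obtain i where "i < Suc m" "i \<noteq> c" "old i = j" using old_sur[OF j] by blast
        then show ?thesis by (intro UN_upper[of i, THEN subset_trans[rotated]]) (auto simp: G)
      qed
      ultimately show "path_image new \<union> (\<Union>i<m. path_image (h i)) \<subseteq> (\<Union>i<Suc m. path_image (G i))" by blast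
    qed
    also have "(\<Union>i<m. path_image (h i)) = (\<Union>j<2*m. path_image (rise j)) \<union> (\<Union>i<m. path_image (g i))"
    proof
      show "(\<Union>i<m. path_image (h i)) \<subseteq> (\<Union>j<2*m. path_image (rise j)) \<union> (\<Union>i<m. path_image (g i))"
        using him p by fastforce
      show "(\<Union>j<2*m. path_image (rise j)) \<union> (\<Union>i<m. path_image (g i)) \<subseteq> (\<Union>i<m. path_image (h i))"
      proof (intro Un_least UN_least)
        fix j assume "j \<in> {..<2*m}"
        then obtain i where "i < m" "j = fst (p i) \<or> j = snd (p i)" using pc by auto
        then show "path_image (rise j) \<subseteq> (\<Union>i<m. path_image (h i))" using him by blast
      next
        fix i assume "i \<in> {..<m}"
        then show "path_image (g i) \<subseteq> (\<Union>i<m. path_image (h i))" using him by blast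
      qed
    qed
    finally show "rect l r (5/2) t \<inter> drawing E k = (\<Union>i<Suc m. path_image (G i))"
      unfolding upper_E[OF cups] new(2) by blast
  qed
  have "crossings E \<inter> k ` rect l r 2 t = {}"
  proof -
    have "k \<i> \<notin> k ` rect l r 2 t"
    proof
      assume "k \<i> \<in> k ` rect l r 2 t"
      moreover have "\<i> \<in> Q" using kbsub(3) kink_in_box[of 1] kink_ends(3) by auto
      ultimately have "\<i> \<in> rect l r 2 t" using plane_chart_mem[OF chart0 Rsub(3)] by blast
      then show False by (simp add: in_cbox_complex_iff)
    qed
    moreover have "crossings D \<inter> k ` rect l r 2 t = {}"
    proof -
      have "rect l r 2 t \<subseteq> rect l r 0 t" by (auto simp: in_cbox_complex_iff subset_iff)
      then show ?thesis using free0 by blast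
    qed
    ultimately show ?thesis using kinked_crossings mirror_simps(5)[OF sgn] by simp
  qed
  then show ?thesis unfolding plat_def using slab_E cE by blast
qed

end

lemma kink_low:
  assumes "0 \<le> u" "u \<le> 8"
  shows "kink_y u \<le> 5/2 \<longleftrightarrow> u \<le> 5/2 \<or> (17/4 \<le> u \<and> u \<le> 27/4)"
  using assms unfolding kink_y_def by auto

lemma kink_symmetric: "17/4 \<le> u \<Longrightarrow> u \<le> 27/4 \<Longrightarrow> kink (11 - u) = mirror (-1) (kink u)"
  by (auto simp: kink_def mirror_def kink_x_def kink_y_def)

lemma kink_tail: "u \<le> 5/2 \<Longrightarrow> mirror \<sigma> (kink u) = Complex 0 u"
  by (auto simp: kink_def mirror_def kink_x_def kink_y_def)

context kinkable
begin

lemma kbI: "mirror \<sigma> (kink u) \<in> Q" if "0 \<le> u" "u \<le> 8"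
  using mk_kb[OF that] kbsub(3) by blast

lemma v_axis: "0 \<le> y \<Longrightarrow> y \<le> 8 \<Longrightarrow> curve D (v y) = k (Complex 0 y)"
  using v(3) by (simp add: mirror_def)

lemma interior_R: "interior (k ` rect l r b t) = k ` open_rect l r b t" if "0 \<le> b"
proof -
  have "rect l r b t \<subseteq> Q" using sub0 that by (auto simp: in_cbox_complex_iff subset_iff)
  then show ?thesis using plane_chart_interior[OF chart0] by (simp add: interior_cbox)
qed

lemma interior_R_iff: "k w \<in> interior (k ` rect l r b t) \<longleftrightarrow> w \<in> open_rect l r b t" if "0 \<le> b" "w \<in> Q"
proof -
  have "open_rect l r b t \<subseteq> Q" using sub0 that by (auto simp: in_cbox_complex_iff in_box_complex_iff subset_iff)
  then show ?thesis unfolding interior_R[OF that(1)] by (rule plane_chart_mem[OF chart0 _ that(2)])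
qed

lemma interior_kb_axis: "k (Complex 0 y) \<in> interior (k ` kink_box) \<longleftrightarrow> 0 < y \<and> y < 8" if "0 \<le> y" "y \<le> 8"
  using kB_interior_iff[OF axis_in_box[OF that]] axis_inside[of y] unfolding kmB by (simp add: mirror_def)

definition outer :: "(nat \<times> complex) set" where
  "outer = {z \<in> circles D. curve D z \<in> - (interior (k ` rect l r (5/2) t) \<union> interior (k ` kink_box))}"

lemma outer_cases:
  assumes "z \<in> outer"
  shows "z = v 0 \<or> curve D z \<notin> k ` kink_box" "curve E z = curve D z"
proof -
  have z: "z \<in> circles D" "curve D z \<notin> interior (k ` rect l r (5/2) t)" "curve D z \<notin> interior (k ` kink_box)"
    using assms by (auto simp: outer_def)
  have "(z = v 0 \<or> curve D z \<notin> k ` kink_box) \<and> curve E z = curve D z"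
    using z(1)
  proof (cases rule: v_cases)
    case (strand y)
    have c: "curve D z = k (Complex 0 y)" using strand v_axis by simp
    have "\<not> (0 < y \<and> y < 8)" using z(3) interior_kb_axis[OF strand(1,2)] unfolding c by blast
    moreover have "y \<noteq> 8"
    proof
      assume "y = 8"
      then have "k (Complex 0 y) \<in> interior (k ` rect l r (5/2) t)"
        using interior_R_iff[of "5/2" "Complex 0 y"] axis_in_box[of y] kbsub(3) t8 l3 r3 by (auto simp: in_box_complex_iff)
      then show False using z(2) c by simp
    qed
    ultimately have "y = 0" using strand by auto
    then show ?thesis using strand c kink_ends(1) by (simp add: mirror_def)
  next
    case outside
    then show ?thesis using kmB by simp
  qed
  then show "z = v 0 \<or> curve D z \<notin> k ` kink_box" "curve E z = curve D z" by blast+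
qed

lemma low_part:
  "{z \<in> circles D. curve E z \<notin> interior (k ` rect l r (5/2) t)} = outer \<union> v ` {0..5/2} \<union> v ` {17/4..27/4}"
proof -
  have low: "k (mirror \<sigma> (kink u)) \<notin> interior (k ` rect l r (5/2) t) \<longleftrightarrow> u \<le> 5/2 \<or> (17/4 \<le> u \<and> u \<le> 27/4)"
    if u: "0 \<le> u" "u \<le> 8" for u
  proof -
    have "\<bar>\<sigma> * kink_x u\<bar> \<le> 2" using kink_bounds(1)[OF u(2)] sgn by (auto simp: abs_mult)
    then have b: "-2 \<le> \<sigma> * kink_x u" "\<sigma> * kink_x u \<le> 2" by linarith+
    have "k (mirror \<sigma> (kink u)) \<notin> interior (k ` rect l r (5/2) t) \<longleftrightarrow> \<not> mirror \<sigma> (kink u) \<in> open_rect l r (5/2) t"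
      using interior_R_iff[of "5/2"] kbI[OF u] by simp
    also have "\<dots> \<longleftrightarrow> kink_y u \<le> 5/2"
      using b l3 r3 t8 kink_bounds(3)[OF u(2) u(2)] by (auto simp: kink_coords in_box_complex_iff)
    finally show ?thesis using kink_low[OF u] by simp
  qed
  show ?thesis
  proof
    show "{z \<in> circles D. curve E z \<notin> interior (k ` rect l r (5/2) t)} \<subseteq> outer \<union> v ` {0..5/2} \<union> v ` {17/4..27/4}"
    proof
      fix z assume "z \<in> {z \<in> circles D. curve E z \<notin> interior (k ` rect l r (5/2) t)}"
      then have z: "z \<in> circles D" "curve E z \<notin> interior (k ` rect l r (5/2) t)" by simp_all
      from z(1) show "z \<in> outer \<union> v ` {0..5/2} \<union> v ` {17/4..27/4}"
      proof (cases rule: v_cases)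
        case (strand y)
        then have "y \<le> 5/2 \<or> (17/4 \<le> y \<and> y \<le> 27/4)" using low[of y] z(2) by simp
        then show ?thesis using strand by auto
      next
        case outside
        then have "curve D z \<notin> interior (k ` kink_box)" using kmB interior_subset by blast
        then show ?thesis using z outside unfolding outer_def by auto
      qed
    qed
    show "outer \<union> v ` {0..5/2} \<union> v ` {17/4..27/4} \<subseteq> {z \<in> circles D. curve E z \<notin> interior (k ` rect l r (5/2) t)}"
    proof (intro Un_least subsetI)
      fix z assume "z \<in> outer"
      then show "z \<in> {z \<in> circles D. curve E z \<notin> interior (k ` rect l r (5/2) t)}"
        using outer_cases(2)[of z] by (simp add: outer_def)
    next
      fix z assume "z \<in> v ` {0..5/2}"
      then obtain u where u: "0 \<le> u" "u \<le> 5/2" "z = v u" by auto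
      then show "z \<in> {z \<in> circles D. curve E z \<notin> interior (k ` rect l r (5/2) t)}"
        using kinked_v[of u] low[of u] v_circles[of u] by simp
    next
      fix z assume "z \<in> v ` {17/4..27/4}"
      then obtain u where u: "17/4 \<le> u" "u \<le> 27/4" "z = v u" by auto
      then show "z \<in> {z \<in> circles D. curve E z \<notin> interior (k ` rect l r (5/2) t)}"
        using kinked_v[of u] low[of u] v_circles[of u] by simp
    qed
  qed
qed

lemma outer_T2: "v u \<notin> outer" if "17/4 \<le> u" "u \<le> 27/4"
proof
  assume "v u \<in> outer"
  then have "curve D (v u) \<notin> interior (k ` kink_box)" by (simp add: outer_def)
  then show False using interior_kb_axis[of u] v_axis[of u] that by simp
qed

lemma compact_outer: "compact outer"
proof -
  have "outer = circles D \<inter> curve D -` (- (interior (k ` rect l r (5/2) t) \<union> interior (k ` kink_box)))"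
    unfolding outer_def by blast
  moreover have "closed (- (interior (k ` rect l r (5/2) t) \<union> interior (k ` kink_box)))"
    by (intro closed_Compl open_Un) auto
  ultimately show ?thesis
    using continuous_closedin_preimage[OF virtual_link_diagramD(1)[OF vld0]] compact_circles closedin_compact by metis
qed

lemma v_not_over: "0 \<le> u \<Longrightarrow> u \<le> 8 \<Longrightarrow> v u \<notin> overs D"
proof
  assume u: "0 \<le> u" "u \<le> 8" and "v u \<in> overs D"
  then have "curve D (v u) \<in> crossings D" using virtual_link_diagramD(5)[OF vld0] by blast
  moreover have "curve D (v u) \<in> k ` kink_box" using v_axis[OF u] axis_in_box[OF u] by simp
  moreover have "k ` kink_box \<subseteq> k ` rect l r 0 t" using kbsub(1) by blast
  ultimately show False using free0 by blast
qed

end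

text \<open>
  Outside the new, larger disk the two kinked diagrams consist of the common exterior of the old disk, of the
  first piece of the kinked leg, and of the bridge.  The mirrored kink runs through the bridge in the
  opposite direction, which accounts for the reflection \<open>u \<mapsto> 11 - u\<close> of its parameter.
\<close>

lemma kinked_pair_agree:
  assumes A: "kinkable D Q k l r t m X p 1" and B: "kinkable D' Q k l r t m X p' (-1)"
    and ag: "agree_outside (k ` rect l r 8 t) D D'"
  shows "agree_outside (k ` rect l r (5/2) t) (kinked (k \<circ> mirror 1) D) (kinked (k \<circ> mirror (-1)) D')"
proof (rule agree_outsideE[OF ag])
  interpret A: kinkable D Q k l r t m X p 1 by (rule A)
  interpret B: kinkable D' Q k l r t m X p' "-1" by (rule B)
  fix f g
  assume h: "homeomorphism {z \<in> circles D. curve D z \<notin> interior (k ` rect l r 8 t)}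
      {z \<in> circles D'. curve D' z \<notin> interior (k ` rect l r 8 t)} f g"
    and e: "\<And>z. z \<in> circles D \<Longrightarrow> curve D z \<notin> interior (k ` rect l r 8 t) \<Longrightarrow> curve D' (f z) = curve D z"
    and o: "\<And>z. z \<in> circles D \<Longrightarrow> curve D z \<notin> interior (k ` rect l r 8 t) \<Longrightarrow> (f z \<in> overs D') = (z \<in> overs D)"
    and vi: "virtuals D' - interior (k ` rect l r 8 t) = virtuals D - interior (k ` rect l r 8 t)"
  let ?R = "interior (k ` rect l r 8 t)" and ?R' = "interior (k ` rect l r (5/2) t)"
  let ?E = "kinked (k \<circ> mirror 1) D" and ?E' = "kinked (k \<circ> mirror (-1)) D'"
  have RR: "?R \<subseteq> ?R'" by (intro interior_mono image_mono) (auto simp: in_cbox_complex_iff subset_iff)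
  have outA: "z \<in> circles D" "curve D z \<notin> ?R" "curve D z \<notin> ?R'" "curve D z \<notin> interior (k ` kink_box)" if "z \<in> A.outer" for z
    using that RR unfolding A.outer_def by blast+
  have f_out: "f z \<in> B.outer" "g (f z) = z" "curve D' (f z) = curve D z" if "z \<in> A.outer" for z
  proof -
    note z = outA[OF that]
    have "z \<in> {z \<in> circles D. curve D z \<notin> ?R}" using z by simp
    note fz = homeomorphism_apply(1,2)[OF h this]
    show eq: "curve D' (f z) = curve D z" using e z by simp
    show "g (f z) = z" by (rule fz(2))
    show "f z \<in> B.outer" using fz(1) eq z unfolding B.outer_def by simp
  qed
  have g_out: "\<exists>w\<in>A.outer. f w = z" if z: "z \<in> B.outer" for z
  proof -
    have zz: "z \<in> circles D'" "curve D' z \<notin> ?R'" "curve D' z \<notin> interior (k ` kink_box)" using z unfolding B.outer_def by blast+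
    then have "z \<in> {z \<in> circles D'. curve D' z \<notin> ?R}" using RR by blast
    note gz = homeomorphism_apply(3,4)[OF h this]
    have "curve D (g z) = curve D' z" using e[of "g z"] gz by simp
    then have "g z \<in> A.outer" using gz(1) zz unfolding A.outer_def by simp
    then show ?thesis using gz(2) by blast
  qed
  define inv where "inv = the_inv_into {0..8} A.v"
  have inv: "inv (A.v u) = u" if "0 \<le> u" "u \<le> 8" for u
  proof -
    have "inj_on A.v {0..8}" by (rule inj_onI) (use A.v_inj in auto)
    then show ?thesis unfolding inv_def by (rule the_inv_into_f_f) (use that in simp)
  qed
  \<comment> \<open>The three cases overlap only at the lower end of the kink, where they give the same value.\<close>
  define F where "F z = (if z \<in> A.v ` {0..5/2} then B.v (inv z) else if z \<in> A.v ` {17/4..27/4} then B.v (11 - inv z) else f z)" for z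
  have v0: "f (A.v 0) = B.v 0" if "A.v 0 \<in> A.outer"
  proof (rule ccontr)
    assume ne: "f (A.v 0) \<noteq> B.v 0"
    have "curve D' (f (A.v 0)) = k (Complex 0 0)" "f (A.v 0) \<in> circles D'"
      using f_out[OF that] A.v_axis[of 0] by (simp_all add: B.outer_def)
    moreover have "curve D' (B.v 0) = k (Complex 0 0)" "B.v 0 \<in> circles D'" using B.v_axis[of 0] B.v_circles[of 0] by simp_all
    ultimately have "k (Complex 0 0) \<in> crossings D'" unfolding crossings_def using ne by blast
    moreover have "k (Complex 0 0) \<in> k ` rect l r 0 t" using A.axis_in_box[of 0] A.kbsub(1) by auto
    ultimately show False using B.free0 by blast
  qed
  have F1: "F (A.v u) = B.v u" if "0 \<le> u" "u \<le> 5/2" for u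
    using that inv[of u] by (simp add: F_def)
  have F2: "F (A.v u) = B.v (11 - u)" if "17/4 \<le> u" "u \<le> 27/4" for u
  proof -
    have "A.v u \<notin> A.v ` {0..5/2}"
    proof
      assume "A.v u \<in> A.v ` {0..5/2}"
      then obtain x where "x \<in> {0..5/2}" "A.v u = A.v x" by (elim imageE)
      then show False using A.v_inj[of u x] \<open>17/4 \<le> u\<close> \<open>u \<le> 27/4\<close> by simp
    qed
    then show ?thesis using that inv[of u] by (simp add: F_def)
  qed
  have F3: "F z = f z" if "z \<in> A.outer" for z
  proof (cases "z \<in> A.v ` {0..5/2}")
    case True
    then obtain u where u: "0 \<le> u" "u \<le> 5/2" "z = A.v u" by auto
    then have "curve D z \<in> k ` kink_box" using A.v_axis[of u] A.axis_in_box[of u] by simp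
    then have "z = A.v 0" using A.outer_cases(1)[OF that] by blast
    then show ?thesis using F1[of 0] v0 that by simp
  next
    case False
    moreover have "z \<notin> A.v ` {17/4..27/4}" using A.outer_T2 that by auto
    ultimately show ?thesis by (simp add: F_def)
  qed
  define P where "P = A.outer \<union> A.v ` {0..5/2} \<union> A.v ` {17/4..27/4}"
  have PE: "{z \<in> circles ?E. curve ?E z \<notin> ?R'} = P" unfolding P_def using A.low_part by simp
  have PE': "{z \<in> circles ?E'. curve ?E' z \<notin> ?R'} = B.outer \<union> B.v ` {0..5/2} \<union> B.v ` {17/4..27/4}" using B.low_part by simp
  have Pcases: thesis if "z \<in> P" "z \<in> A.outer \<Longrightarrow> thesis" "\<And>u. 0 \<le> u \<Longrightarrow> u \<le> 5/2 \<Longrightarrow> z = A.v u \<Longrightarrow> thesis"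
    "\<And>u. 17/4 \<le> u \<Longrightarrow> u \<le> 27/4 \<Longrightarrow> z = A.v u \<Longrightarrow> thesis" for z thesis
    using that unfolding P_def by auto
  have Fcurve: "curve ?E' (F z) = curve ?E z" and Fover: "F z \<in> overs D' \<longleftrightarrow> z \<in> overs D" if z: "z \<in> P" for z
  proof -
    have "curve ?E' (F z) = curve ?E z \<and> (F z \<in> overs D' \<longleftrightarrow> z \<in> overs D)"
    proof (rule Pcases[OF z])
      assume z: "z \<in> A.outer"
      show ?thesis using A.outer_cases(2)[OF z] B.outer_cases(2)[OF f_out(1)[OF z]] f_out(3)[OF z] F3[OF z] o[of z] outA[OF z] by simp
    next
      fix u assume u: "0 \<le> u" "u \<le> 5/2" "z = A.v u"
      then have u8: "u \<le> 8" by simp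
      show ?thesis using F1[OF u(1,2)] A.kinked_v[OF u(1) u8] B.kinked_v[OF u(1) u8] kink_tail[OF u(2)]
        A.v_not_over[OF u(1) u8] B.v_not_over[OF u(1) u8] u(3) by simp
    next
      fix u assume u: "17/4 \<le> u" "u \<le> 27/4" "z = A.v u"
      then have u8: "0 \<le> u" "u \<le> 8" "0 \<le> 11 - u" "11 - u \<le> 8" by simp_all
      have "mirror (-1) (kink (11 - u)) = mirror 1 (kink u)"
        unfolding kink_symmetric[OF u(1,2)] by (simp add: mirror_def)
      then show ?thesis using F2[OF u(1,2)] A.kinked_v[OF u8(1,2)] B.kinked_v[OF u8(3,4)]
        A.v_not_over[OF u8(1,2)] B.v_not_over[OF u8(3,4)] u(3) by simp
    qed
    then show "curve ?E' (F z) = curve ?E z" "F z \<in> overs D' \<longleftrightarrow> z \<in> overs D" by blast+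
  qed
  have cA: "continuous_on S A.v" "continuous_on S B.v" if "S \<subseteq> {0..8}" for S
    using A.v(1) B.v(1) that continuous_on_subset by blast+
  have contF: "continuous_on P F"
    unfolding P_def
  proof (intro continuous_on_closed_Un)
    show "closed A.outer" using A.compact_outer by (rule compact_imp_closed)
    show c1: "closed (A.v ` {0..5/2})" "closed (A.v ` {17/4..27/4})"
      by (auto intro!: compact_imp_closed compact_continuous_image cA)
    show "closed (A.outer \<union> A.v ` {0..5/2})" using c1 A.compact_outer compact_imp_closed by blast
    have "continuous_on A.outer f"
      by (rule continuous_on_subset[OF homeomorphism_cont1[OF h]]) (use outA in blast)
    then show "continuous_on A.outer F" by (rule continuous_on_eq) (simp add: F3)
    show "continuous_on (A.v ` {0..5/2}) F"
    proof (rule continuous_on_factor)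
      have "continuous_on {0..5/2} B.v" by (rule cA) auto
      then show "continuous_on {0..5/2} (F \<circ> A.v)" by (rule continuous_on_eq) (simp add: F1)
    qed (auto intro: cA)
    show "continuous_on (A.v ` {17/4..27/4}) F"
    proof (rule continuous_on_factor)
      have "continuous_on {17/4..27/4} (\<lambda>u. B.v (11 - u))"
        by (rule continuous_on_compose2[OF B.v(1)]) (auto intro!: continuous_intros)
      then show "continuous_on {17/4..27/4} (F \<circ> A.v)" by (rule continuous_on_eq) (simp add: F2)
    qed (auto intro: cA)
  qed
  have compP: "compact P" unfolding P_def
    by (intro compact_Un A.compact_outer compact_continuous_image cA) auto
  have imF: "F ` P = B.outer \<union> B.v ` {0..5/2} \<union> B.v ` {17/4..27/4}"
  proof -
    have "F ` A.outer = B.outer" using F3 f_out(1) g_out by (force simp: image_iff)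
    moreover have "F ` A.v ` {0..5/2} = B.v ` {0..5/2}"
      unfolding image_image by (rule image_cong) (simp_all add: F1)
    moreover have "F ` A.v ` {17/4..27/4} = B.v ` {17/4..27/4}"
    proof -
      have "F ` A.v ` {17/4..27/4} = B.v ` (\<lambda>u. 11 - u) ` {17/4..27/4}"
        unfolding image_image by (rule image_cong) (simp_all add: F2)
      also have "(\<lambda>u. 11 - u) ` {17/4..27/4} = {17/4..27/4::real}" by (simp add: image_diff_atLeastAtMost)
      finally show ?thesis .
    qed
    ultimately show ?thesis unfolding P_def by (simp only: image_Un)
  qed
  have strand: "\<exists>a b. 0 \<le> a \<and> a \<le> 8 \<and> 0 \<le> b \<and> b \<le> 8 \<and> z = A.v a \<and> F z = B.v b \<and>
      (a \<le> 5/2 \<and> b = a \<or> 17/4 \<le> a \<and> 17/4 \<le> b \<and> b = 11 - a)" if z: "z \<in> P" "curve ?E z \<in> k ` kink_box" for z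
  proof (rule Pcases[OF z(1)])
    assume "z \<in> A.outer"
    then have "z = A.v 0" using A.outer_cases[of z] z(2) by auto
    then show ?thesis using F1[of 0] by (intro exI[of _ 0]) simp
  next
    fix u assume "0 \<le> u" "u \<le> 5/2" "z = A.v u"
    then show ?thesis using F1[of u] by (intro exI[of _ u]) simp
  next
    fix u assume "17/4 \<le> u" "u \<le> 27/4" "z = A.v u"
    then show ?thesis using F2[of u] by (intro exI[of _ u] exI[of _ "11 - u"]) simp
  qed
  have injF: "inj_on F P"
  proof (rule inj_onI)
    fix z w assume zw: "z \<in> P" "w \<in> P" "F z = F w"
    have eq: "curve ?E z = curve ?E w" using Fcurve[OF zw(1)] Fcurve[OF zw(2)] zw(3) by simp
    show "z = w"
    proof (cases "curve ?E z \<in> k ` kink_box")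
      case True
      obtain a b where ab: "0 \<le> b" "b \<le> 8" "z = A.v a" "F z = B.v b" "a \<le> 5/2 \<and> b = a \<or> 17/4 \<le> a \<and> 17/4 \<le> b \<and> b = 11 - a"
        using strand[OF zw(1) True] by blast
      obtain a' b' where ab': "0 \<le> b'" "b' \<le> 8" "w = A.v a'" "F w = B.v b'" "a' \<le> 5/2 \<and> b' = a' \<or> 17/4 \<le> a' \<and> 17/4 \<le> b' \<and> b' = 11 - a'"
        using strand[OF zw(2)] True eq by auto
      have "b = b'" using B.v_inj[OF ab(1,2) ab'(1,2)] ab ab' zw(3) by simp
      then have "a = a'" using ab(5) ab'(5) by auto
      then show ?thesis using ab ab' by simp
    next
      case False
      have out: "x \<in> A.outer" if x: "x \<in> P" "curve ?E x \<notin> k ` kink_box" for x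
      proof (rule Pcases[OF x(1)])
        have 1: "curve ?E (A.v u) \<in> k ` kink_box" if "0 \<le> u" "u \<le> 8" for u
          using A.kinked_v[OF that] A.mk_kb[OF that] by simp
        show "x \<in> A.outer" if "0 \<le> u" "u \<le> 5/2" "x = A.v u" for u using 1[of u] x that by simp
        show "x \<in> A.outer" if "17/4 \<le> u" "u \<le> 27/4" "x = A.v u" for u using 1[of u] x that by simp
      qed
      have "z \<in> A.outer" "w \<in> A.outer" using out zw False eq by simp_all
      then show ?thesis using f_out(2) F3 zw(3) by metis
    qed
  qed
  obtain G where G: "homeomorphism P (B.outer \<union> B.v ` {0..5/2} \<union> B.v ` {17/4..27/4}) F G"
    using homeomorphism_compact[OF compP contF imF injF] by blast
  have virt: "virtuals ?E' - ?R' = virtuals ?E - ?R'"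
    using vi RR mirror_simps(5)[of 1] mirror_simps(5)[of "-1"] by auto
  show "agree_outside (k ` rect l r (5/2) t) ?E ?E'"
    unfolding agree_outside_def PE PE'
  proof (intro exI conjI ballI impI)
    show "homeomorphism P (B.outer \<union> B.v ` {0..5/2} \<union> B.v ` {17/4..27/4}) F G" by (rule G)
    show "virtuals ?E' - ?R' = virtuals ?E - ?R'" by (rule virt)
    fix z assume "z \<in> circles ?E" "curve ?E z \<notin> ?R'"
    then have "z \<in> P" using PE by blast
    then show "curve ?E' (F z) = curve ?E z" "(F z \<in> overs ?E') = (z \<in> overs ?E)" using Fcurve Fover by simp_all
  qed
qed

lemma plat_cong:
  assumes "\<And>i. i < m \<Longrightarrow> p i = p' i"
  shows "plat D k l r e s t m X p \<longleftrightarrow> plat D k l r e s t m X p'"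
  unfolding plat_def cups_def using assms by auto

lemma pairing_before: "pairing m pairs_before"
  unfolding pairing_def pairs_before_def
proof (intro conjI allI impI)
  fix j :: nat assume "j < 2 * m"
  then show "\<exists>i<m. j = fst (2 * i, 2 * i + 1) \<or> j = snd (2 * i, 2 * i + 1)"
    by (intro exI[of _ "j div 2"]) auto
next
  fix i j :: nat assume "i \<noteq> j"
  then show "{fst (2 * i, 2 * i + 1), snd (2 * i, 2 * i + 1)} \<inter> {fst (2 * j, 2 * j + 1), snd (2 * j, 2 * j + 1)} = {}"
    by (auto; presburger)
qed auto

lemma pairs_after_eq: "i < m \<Longrightarrow> pairs_after m i = (2 * i + 1, if Suc i = m then 0 else 2 * i + 2)"
  unfolding pairs_after_def by auto

lemma pairing_after:
  assumes "0 < m" shows "pairing m (pairs_after m)"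
  unfolding pairing_def
proof (intro conjI allI impI)
  fix i assume "i < m"
  then show "fst (pairs_after m i) < 2 * m" "snd (pairs_after m i) < 2 * m" "fst (pairs_after m i) \<noteq> snd (pairs_after m i)"
    by (auto simp: pairs_after_eq)
next
  fix i j assume "i < m" "j < m" "i \<noteq> j"
  then show "{fst (pairs_after m i), snd (pairs_after m i)} \<inter> {fst (pairs_after m j), snd (pairs_after m j)} = {}"
    by (auto simp: pairs_after_eq; presburger)
next
  fix j assume j: "j < 2 * m"
  show "\<exists>i<m. j = fst (pairs_after m i) \<or> j = snd (pairs_after m i)"
  proof (cases "even j")
    case True
    then show ?thesis using j assms
      by (intro exI[of _ "if j = 0 then m - 1 else j div 2 - 1"]) (auto simp: pairs_after_eq elim!: evenE)
  next
    case False
    then show ?thesis using j by (intro exI[of _ "j div 2"]) (auto simp: pairs_after_eq elim!: oddE)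
  qed
qed

text \<open>
  Before the move the kink turns the ends \<open>0, 1, 2, \<dots>\<close> into \<open>0, 1, 4, \<dots>\<close> and adds a cup that joins \<open>2\<close> and \<open>3\<close>;
  after the move the mirrored kink turns them into \<open>0, 3, 4, \<dots>\<close> and adds a cup that joins \<open>1\<close> and \<open>2\<close>.
  So both pairings become those for \<open>m + 1\<close>.
\<close>

lemma H_config_kink:
  assumes H0: "H_config m D D' Q k l r e s t X x a" and m: "2 \<le> m"
  obtains E E' where "virtual_link_diagram E" "virtual_link_diagram E'" "VR1 E D" "VR1 E' D'"
    "\<exists>Q k l r e s t X x a. H_config (Suc m) E E' Q k l r e s t X x a"
proof (rule H_config_normalise[OF H0])
  fix Q k l r t X
  assume H: "H_config m D D' Q k l r 0 8 t X 0 3"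
  from H have H1: "virtual_link_diagram D" "virtual_link_diagram D'" "ncomp D' = ncomp D"
     "plane_chart Q k" "rect l r 0 t \<subseteq> Q" "8 < t" "l < - 3" "3 < r" "legs l r 0 8 m X"
     "\<And>y. 0 \<le> y \<Longrightarrow> y \<le> 8 \<Longrightarrow> X 1 y = 0"
     "\<And>j y. j < 2 * m \<Longrightarrow> j \<noteq> 1 \<Longrightarrow> 0 \<le> y \<Longrightarrow> y \<le> 8 \<Longrightarrow> 3 < \<bar>X j y\<bar>"
    and P: "plat D k l r 0 8 t m X pairs_before" "plat D' k l r 0 8 t m X (pairs_after m)"
    and ag: "agree_outside (k ` rect l r 8 t) D D'"
    by (simp_all add: H_config_def)
  interpret A: kinkable D Q k l r t m X pairs_before 1
    by unfold_locales (use H1 P pairing_before m in simp_all)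
  interpret B: kinkable D' Q k l r t m X "pairs_after m" "-1"
    by unfold_locales (use H1 P pairing_after[of m] m in simp_all)
  let ?E = "kinked (k \<circ> mirror 1) D" and ?E' = "kinked (k \<circ> mirror (-1)) D'"
  have pa: "plat ?E k l r 2 (5/2) t (Suc m) A.Xn pairs_before"
  proof -
    have "A.new_pairs 1 i = pairs_before i" if "i < Suc m" for i
      using that m by (cases "i = 0") (auto simp: A.new_pairs_def pairs_before_def A.shift_def)
    then show ?thesis using A.kinked_plat[of 1] m plat_cong[of "Suc m" "A.new_pairs 1" pairs_before] by simp
  qed
  have pb: "plat ?E' k l r 2 (5/2) t (Suc m) B.Xn (pairs_after (Suc m))"
  proof -
    have "B.new_pairs 0 i = pairs_after (Suc m) i" if "i < Suc m" for i
      using that m by (cases "i = 0") (auto simp: B.new_pairs_def pairs_after_eq B.shift_def)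
    then show ?thesis using B.kinked_plat[of 0] plat_cong[of "Suc m" "B.new_pairs 0" "pairs_after (Suc m)"] by simp
  qed
  have X: "a < \<bar>A.Xn j y - (-2)\<bar>" if j: "j < 2 * Suc m" "j \<noteq> 1" and y: "y \<in> {2..5/2}" and a: "a = 1/2" for j y a
  proof -
    have y': "0 \<le> y" "y \<le> 8" using y by auto
    have "j = 0 \<or> j = 2 \<or> j = 3 \<or> 4 \<le> j" using j by auto
    moreover have "3 < X (j - 2) y" if "4 \<le> j" using A.X2[of "j - 2" y] y' j(1) that by simp
    ultimately show ?thesis using A.X0[OF y'] a by (elim disjE) (auto simp: A.Xn_def)
  qed
  have "H_config (Suc m) ?E ?E' Q k l r 2 (5/2) t A.Xn (-2) (1/2)"
    unfolding H_config_def
  proof (intro conjI)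
    show "virtual_link_diagram ?E" "virtual_link_diagram ?E'" by (rule A.kinked_vld B.kinked_vld)+
    show "ncomp ?E' = ncomp ?E" using H1(3) by simp
    show "plane_chart Q k" by fact
    show "rect l r 2 t \<subseteq> Q" using A.Rsub(3) .
    show "legs l r 2 (5/2) (Suc m) A.Xn" by (rule A.legs_Xn)
    show "\<forall>y\<in>{2..5/2}. A.Xn 1 y = -2" by (simp add: A.Xn_def)
    show "\<forall>j<2 * Suc m. j \<noteq> 1 \<longrightarrow> (\<forall>y\<in>{2..5/2}. 1/2 < \<bar>A.Xn j y - (-2)\<bar>)" using X by blast
    show "plat ?E k l r 2 (5/2) t (Suc m) A.Xn pairs_before" by (rule pa)
    show "plat ?E' k l r 2 (5/2) t (Suc m) A.Xn (pairs_after (Suc m))" by (rule pb)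
    show "agree_outside (k ` rect l r (5/2) t) ?E ?E'"
      by (rule kinked_pair_agree[OF A.kinkable_axioms B.kinkable_axioms ag])
  qed (use H1 in simp_all)
  then show thesis using that[OF A.kinked_vld B.kinked_vld A.kinked_VR1 B.kinked_VR1] by blast
qed

text \<open>
  Each step back to a smaller \<open>m\<close> costs the insertion of a kink before and the removal of the
  mirrored kink after the larger move.
\<close>

theorem H_config_reach:
  assumes "H_config m D D' Q k l r e s t X x a" "2 \<le> m" "m \<le> n"
  shows "(\<lambda>E F. H_move n E F \<or> welded_move E F)\<^sup>*\<^sup>* D D'"
  using assms
proof (induction "n - m" arbitrary: m D D' Q k l r e s t X x a)
  case 0
  then have "m = n" by simp
  then have "H_move n D D'" using H_config_H_move 0 by blast
  then show ?case by blast
next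
  case (Suc d)
  then have d: "d = n - Suc m" "Suc m \<le> n" by simp_all
  obtain E E' where E: "virtual_link_diagram E" "virtual_link_diagram E'" "VR1 E D" "VR1 E' D'"
    "\<exists>Q k l r e s t X x a. H_config (Suc m) E E' Q k l r e s t X x a"
    by (rule H_config_kink[OF Suc(3,4)])
  have D: "virtual_link_diagram D" "virtual_link_diagram D'" using Suc(3) by (simp_all add: H_config_def)
  have 1: "welded_move D E" "welded_move E' D'"
    unfolding welded_move_def elementary_welded_move_def using E D by blast+
  have 2: "(\<lambda>E F. H_move n E F \<or> welded_move E F)\<^sup>*\<^sup>* E E'"
    using Suc(1)[OF d(1)] E(5) d(2) Suc(4) by force
  show ?case
    using converse_rtranclp_into_rtranclp[of "\<lambda>E F. H_move n E F \<or> welded_move E F", OF _ rtranclp.rtrancl_into_rtrancl[OF 2]] 1 by blast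
qed

section \<open>A chart at a crossing\<close>

definition pt :: "complex \<Rightarrow> real \<Rightarrow> nat \<times> complex" where
  "pt w t = (0, w * cis (2 * pi * t))"

lemma continuous_pt: "continuous_on S (pt w)"
proof -
  have "pt w = (\<lambda>t. (0, w * cis (2 * pi * t)))" by (rule ext) (simp add: pt_def)
  then show ?thesis by (simp add: cis_conv_exp continuous_intros)
qed

lemma cis_eq_iff: 
  assumes "0 \<le> s" "s \<le> 1" "0 \<le> t" "t \<le> 1"
  shows "cis (2 * pi * s) = cis (2 * pi * t) \<longleftrightarrow> s = t \<or> (s = 0 \<and> t = 1) \<or> (s = 1 \<and> t = 0)"
proof
  assume "cis (2 * pi * s) = cis (2 * pi * t)"
  then have "exp (\<i> * of_real (2 * pi * s)) = exp (\<i> * of_real (2 * pi * t))" by (simp add: cis_conv_exp)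
  then obtain n :: int where "\<i> * of_real (2 * pi * s) = \<i> * of_real (2 * pi * t) + (of_int (2 * n) * pi) * \<i>"
    unfolding exp_eq by blast
  then have "complex_of_real (2 * pi * s) = of_real (2 * pi * t + 2 * of_int n * pi)"
    by (simp add: algebra_simps) (metis (no_types, lifting) complex_i_not_zero distrib_left mult.assoc mult.commute mult_left_cancel)
  then have "2 * pi * s = 2 * pi * t + 2 * of_int n * pi" by (simp only: of_real_eq_iff)
  then have "2 * pi * s = 2 * pi * (t + of_int n)" by (simp add: algebra_simps)
  then have st: "s = t + of_int n" by simp
  then have "- 1 \<le> real_of_int n" "real_of_int n \<le> 1" using assms by linarith+
  then have "n = -1 \<or> n = 0 \<or> n = 1" by linarith
  then show "s = t \<or> (s = 0 \<and> t = 1) \<or> (s = 1 \<and> t = 0)" using st assms by auto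
qed (auto simp: cis_2pi)

lemma pt_eq_iff:
  assumes "norm w = 1" "0 \<le> s" "s \<le> 1" "0 \<le> t" "t \<le> 1"
  shows "pt w s = pt w t \<longleftrightarrow> s = t \<or> (s = 0 \<and> t = 1) \<or> (s = 1 \<and> t = 0)"
proof -
  have "w \<noteq> 0" using assms(1) by auto
  then show ?thesis using cis_eq_iff[OF assms(2-5)] by (simp add: pt_def)
qed

lemma unit_cis:
  assumes "norm z = 1" obtains t where "0 \<le> t" "t < 1" "z = cis (2 * pi * t)"
proof -
  have "z = cis (Arg2pi z)" using Arg2pi_eq[of z] assms by (simp add: cis_conv_exp)
  moreover have "0 \<le> Arg2pi z / (2 * pi)" "Arg2pi z / (2 * pi) < 1" "2 * pi * (Arg2pi z / (2 * pi)) = Arg2pi z"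
    using Arg2pi_ge_0[of z] Arg2pi_lt_2pi[of z] by (simp_all add: field_simps)
  ultimately show thesis using that[of "Arg2pi z / (2 * pi)"] by simp
qed

lemma pt_surj:
  assumes "norm w = 1" "z \<in> {0} \<times> sphere 0 1" obtains t where "0 \<le> t" "t < 1" "z = pt w t"
proof -
  obtain z' where z: "z = (0, z')" "norm z' = 1" using assms(2) by auto
  have "norm (z' / w) = 1" using z assms(1) by (simp add: norm_divide)
  then obtain t where t: "0 \<le> t" "t < 1" "z' / w = cis (2 * pi * t)" using unit_cis by metis
  have "w \<noteq> 0" using assms(1) by auto
  then have "z' = w * cis (2 * pi * t)" using t(3) by (simp add: field_simps)
  then show thesis using that t z by (simp add: pt_def)
qed

lemma pt_in: "norm w = 1 \<Longrightarrow> pt w t \<in> {0} \<times> sphere 0 1"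
  by (simp add: pt_def norm_mult)

lemma circles_1: "ncomp D = 1 \<Longrightarrow> circles D = {0} \<times> sphere 0 1"
  by (auto simp: circles_def)

text \<open>
  A continuous injective function on an interval is strictly monotone; the sign \<open>\<sigma>\<close> makes it increasing.
  Applied to both branches of a crossing, the two signs orient the axes of the chart so that the curve
  runs along both in the positive direction.
\<close>

lemma branch:
  fixes f :: "real \<Rightarrow> real"
  assumes "0 < d" "continuous_on {s-d..s+d} f" "inj_on f {s-d..s+d}" "f s = 0"
  obtains \<sigma> e where "\<sigma> = 1 \<or> \<sigma> = (-1::real)" "0 < e" "strict_mono_on {s-d..s+d} (\<lambda>t. \<sigma> * f t)"
    "\<sigma> * f (s - d) \<le> - e" "e \<le> \<sigma> * f (s + d)"
proof -
  have "strict_mono_on {s-d..s+d} f \<or> strict_antimono_on {s-d..s+d} f"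
    using injective_eq_monotone_map[of "{s-d..s+d}" f] assms(2,3) by (simp add: is_interval_cc)
  then obtain \<sigma> :: real where \<sigma>: "\<sigma> = 1 \<or> \<sigma> = -1" "strict_mono_on {s-d..s+d} (\<lambda>t. \<sigma> * f t)"
  proof
    assume "strict_mono_on {s-d..s+d} f" then show thesis using that[of 1] by simp
  next
    assume "strict_antimono_on {s-d..s+d} f"
    then have "strict_mono_on {s-d..s+d} (\<lambda>t. (-1) * f t)" by (auto simp: monotone_on_def)
    then show thesis using that[of "-1"] by simp
  qed
  have "\<sigma> * f (s - d) < \<sigma> * f s" "\<sigma> * f s < \<sigma> * f (s + d)"
    using strict_mono_onD[OF \<sigma>(2), of "s - d" s] strict_mono_onD[OF \<sigma>(2), of s "s + d"] assms(1) by simp_all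
  then show thesis using assms(4) \<sigma> by (intro that[of \<sigma> "min (- (\<sigma> * f (s - d))) (\<sigma> * f (s + d))"]) auto
qed

text \<open>
  The passage of the curve along an axis of a chart, as a function of time.  The bound \<open>40\<close> is only a
  convenient size: the piecewise linear pictures below fit into the disk of this radius.
\<close>

definition arc_time :: "real \<Rightarrow> real \<Rightarrow> (real \<Rightarrow> real) \<Rightarrow> bool" where
  "arc_time a b f \<longleftrightarrow> a < b \<and> continuous_on {a..b} f \<and> strict_mono_on {a..b} f \<and> f a = -40 \<and> f b = 40"

lemma arc_time_exists:
  fixes f :: "real \<Rightarrow> real"
  assumes "0 < d" "continuous_on {s-d..s+d} f" "strict_mono_on {s-d..s+d} f" "f (s - d) < -40" "40 < f (s + d)"
  obtains a b where "s - d < a" "b < s + d" "arc_time a b f"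
proof -
  obtain a where a: "s - d \<le> a" "a \<le> s + d" "f a = -40"
    using IVT'[of f "s - d" "-40" "s + d"] assms by auto
  obtain b where b: "s - d \<le> b" "b \<le> s + d" "f b = 40"
    using IVT'[of f "s - d" "40" "s + d"] assms by auto
  have "a \<noteq> s - d" "b \<noteq> s + d" using a b assms by auto
  moreover have "a < b"
  proof (rule ccontr)
    assume "\<not> a < b"
    then have "f b \<le> f a" using strict_mono_onD[OF assms(3), of b a] a b by (cases "a = b") auto
    then show False using a b by simp
  qed
  moreover have "{a..b} \<subseteq> {s-d..s+d}" using a b by auto
  ultimately have "arc_time a b f" unfolding arc_time_def
    using a b continuous_on_subset[OF assms(2)] monotone_on_subset[OF assms(3)] by blast
  moreover have "s - d < a" "b < s + d" using a b \<open>a \<noteq> s - d\<close> \<open>b \<noteq> s + d\<close> by auto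
  ultimately show thesis using that by blast
qed

lemma arc_timeD:
  assumes "arc_time a b f"
  shows "a < b" "continuous_on {a..b} f" "s \<in> {a..b} \<Longrightarrow> t \<in> {a..b} \<Longrightarrow> f s < f t \<longleftrightarrow> s < t"
    "s \<in> {a..b} \<Longrightarrow> t \<in> {a..b} \<Longrightarrow> f s = f t \<longleftrightarrow> s = t" "s \<in> {a..b} \<Longrightarrow> t \<in> {a..b} \<Longrightarrow> f s \<le> f t \<longleftrightarrow> s \<le> t"
    "f a = -40" "f b = 40"
    "s \<in> {a..b} \<Longrightarrow> -40 \<le> f s \<and> f s \<le> 40" "-40 \<le> u \<Longrightarrow> u \<le> 40 \<Longrightarrow> \<exists>t\<in>{a..b}. f t = u"
proof -
  show ab: "a < b" "continuous_on {a..b} f" "f a = -40" "f b = 40" using assms by (auto simp: arc_time_def)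
  have sm: "strict_mono_on {a..b} f" using assms by (simp add: arc_time_def)
  show 1: "f s < f t \<longleftrightarrow> s < t" "f s = f t \<longleftrightarrow> s = t" "f s \<le> f t \<longleftrightarrow> s \<le> t" if "s \<in> {a..b}" "t \<in> {a..b}" for s t
    using strict_mono_onD[OF sm that] strict_mono_onD[OF sm that(2,1)] by (metis linorder_neqE_linordered_idom order_less_irrefl order_less_asym linorder_not_less)+
  show "s \<in> {a..b} \<Longrightarrow> -40 \<le> f s \<and> f s \<le> 40" using 1(3)[of a s] 1(3)[of s b] ab by auto
  show "-40 \<le> u \<Longrightarrow> u \<le> 40 \<Longrightarrow> \<exists>t\<in>{a..b}. f t = u" using IVT'[of f a u b] ab by auto
qed

text \<open>
  The base point \<open>w\<close> of the parameter circle is chosen so that both passages through the crossing happen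
  at times strictly between \<open>0\<close> and \<open>1\<close>.  The chart of the transverse double point is restricted to a disk
  that the curve meets only near these two times, and it is scaled and reflected such that both
  passages run in the positive direction of the axes.
\<close>

lemma chart_at_crossing:
  assumes D: "virtual_link_diagram D" "ncomp D = 1" and x: "x \<in> crossings D"
  obtains w k a1 a2 f1 c1 c2 f2 where "norm w = 1" "plane_chart (ball 0 50) k" "k 0 = x"
    "arc_time a1 a2 f1" "arc_time c1 c2 f2" "0 < a1" "a2 < c1" "c2 < 1"
    "\<And>t. t \<in> {a1..a2} \<Longrightarrow> curve D (pt w t) = k (of_real (f1 t))"
    "\<And>t. t \<in> {c1..c2} \<Longrightarrow> curve D (pt w t) = k (\<i> * of_real (f2 t))"
    "\<And>t. 0 \<le> t \<Longrightarrow> t \<le> 1 \<Longrightarrow> curve D (pt w t) \<in> k ` ball 0 40 \<Longrightarrow> t \<in> {a1..a2} \<union> {c1..c2}"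
proof (rule transverse_shrink[OF virtual_link_diagramD(3)[OF D(1) x] open_UNIV UNIV_I virtual_link_diagramD(1)[OF D(1)]])
  fix z z2 N M U h l
  assume zz: "z \<noteq> z2" and zN: "z \<in> N" and zM: "z2 \<in> M" and cz: "curve D z = x" and cz2: "curve D z2 = x"
    and xU: "x \<in> U" and oN: "openin (top_of_set (circles D)) N" and oM: "openin (top_of_set (circles D)) M"
    and iN: "inj_on (curve D) N" and iM: "inj_on (curve D) M" and oU: "open U"
    and all: "{v \<in> circles D. curve D v \<in> U} = N \<union> M"
    and hom: "homeomorphism U (ball (0::complex) 1) h l"
    and hN: "h ` curve D ` N = {u \<in> ball 0 1. Im u = 0}" and hM: "h ` curve D ` M = {u \<in> ball 0 1. Re u = 0}"
    and hx: "h x = 0"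
  note C = circles_1[OF D(2)]
  have NM: "v \<in> circles D" "curve D v \<in> U" if "v \<in> N \<union> M" for v using all that by blast+
  have zc: "z \<in> {0} \<times> sphere 0 1" "z2 \<in> {0} \<times> sphere 0 1" using NM[of z] NM[of z2] zN zM C by simp_all
  obtain z' z2' where zs: "z = (0, z')" "z2 = (0, z2')" "norm z' = 1" "norm z2' = 1" using zc by auto
  have "norm (z2' / z') = 1" using zs by (simp add: norm_divide)
  then obtain d where d: "0 \<le> d" "d < 1" "z2' / z' = cis (2 * pi * d)" using unit_cis by metis
  have z'0: "z' \<noteq> 0" using zs by auto
  have "d \<noteq> 0" using d(3) zz zs z'0 by auto
  then have d0: "0 < d" using d by simp
  \<comment> \<open>The second passage happens \<open>d\<close> later than the first, so both are in the open unit interval.\<close>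
  define s where "s = (1 - d) / 2"
  define w where "w = z' * cis (- (2 * pi * s))"
  have w: "norm w = 1" using zs by (simp add: w_def norm_mult)
  have s: "0 < s" "s + d < 1" using d by (simp_all add: s_def field_simps)
  have pz: "pt w s = z" by (simp add: pt_def w_def zs mult.assoc cis_mult)
  have pz2: "pt w (s + d) = z2"
  proof -
    have "w * cis (2 * pi * (s + d)) = z' * cis (2 * pi * d)"
      unfolding w_def mult.assoc cis_mult by (simp add: algebra_simps)
    also have "\<dots> = z2'" using d(3) z'0 by (simp add: field_simps)
    finally show ?thesis by (simp add: pt_def zs)
  qed
  have near: "\<exists>e>0. \<forall>t. \<bar>t - s0\<bar> \<le> e \<longrightarrow> pt w t \<in> S" if S: "openin (top_of_set (circles D)) S" "pt w s0 \<in> S" for S s0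
  proof -
    obtain T where T: "open T" "S = circles D \<inter> T" using S(1) openin_open by blast
    have "open (pt w -` T)" using T(1) continuous_pt open_vimage by blast
    moreover have "s0 \<in> pt w -` T" using S T by blast
    ultimately obtain e where e: "e > 0" "cball s0 e \<subseteq> pt w -` T" using open_contains_cball by metis
    have "pt w t \<in> S" if "\<bar>t - s0\<bar> \<le> e" for t
    proof -
      have "t \<in> cball s0 e" using that by (simp add: dist_real_def abs_minus_commute)
      then show ?thesis using e(2) T(2) pt_in[OF w] C by blast
    qed
    then show ?thesis using e(1) by blast
  qed
  obtain e1 where e1: "e1 > 0" "\<And>t. \<bar>t - s\<bar> \<le> e1 \<Longrightarrow> pt w t \<in> N" using near[OF oN, of s] pz zN by auto
  obtain e2 where e2: "e2 > 0" "\<And>t. \<bar>t - (s + d)\<bar> \<le> e2 \<Longrightarrow> pt w t \<in> M" using near[OF oM, of "s + d"] pz2 zM by auto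
  define b where "b = Min {e1, e2, s / 2, d / 3, (1 - s - d) / 2}"
  have b: "0 < b" "b \<le> e1" "b \<le> e2" "b \<le> s / 2" "b \<le> d / 3" "b \<le> (1 - s - d) / 2"
    using e1(1) e2(1) s d0 by (simp add: b_def) (unfold b_def, rule Min_le; simp)+
  have inN: "pt w t \<in> N" if "t \<in> {s-b..s+b}" for t using e1(2)[of t] that b(2) by auto
  have inM: "pt w t \<in> M" if "t \<in> {s+d-b..s+d+b}" for t using e2(2)[of t] that b(3) by (auto simp: abs_le_iff)
  have t01: "0 < t \<and> t < 1" if "t \<in> {s-b..s+b} \<or> t \<in> {s+d-b..s+d+b}" for t
    using that b s d0 by auto
  have ptinj: "s' = t" if "pt w s' = pt w t" "0 < s' \<and> s' < 1" "0 \<le> t \<and> t \<le> 1" for s' t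
    using pt_eq_iff[OF w, of s' t] that by auto
  have hinj: "y = y'" if "y \<in> U" "y' \<in> U" "h y = h y'" for y y' using homeomorphism_apply(2)[OF hom] that by metis
  define g where "g t = h (curve D (pt w t))" for t
  have gN: "g t = of_real (Re (g t))" if "pt w t \<in> N" for t
  proof -
    have "g t \<in> h ` curve D ` N" using that unfolding g_def by blast
    then show ?thesis unfolding hN by (simp add: complex_eq_iff)
  qed
  have gM: "g t = \<i> * of_real (Im (g t))" if "pt w t \<in> M" for t
  proof -
    have "g t \<in> h ` curve D ` M" using that unfolding g_def by blast
    then show ?thesis unfolding hM by (simp add: complex_eq_iff)
  qed
  have gcont: "continuous_on S g" if "\<And>t. t \<in> S \<Longrightarrow> pt w t \<in> N \<union> M" for S
  proof -
    have "continuous_on S (\<lambda>t. curve D (pt w t))"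
      by (rule continuous_on_compose2[OF virtual_link_diagramD(1)[OF D(1)] continuous_pt]) (use pt_in[OF w] C in blast)
    then have "continuous_on S (\<lambda>t. h (curve D (pt w t)))"
      by (rule continuous_on_compose2[OF homeomorphism_cont1[OF hom]]) (use that NM in blast)
    then show ?thesis unfolding g_def .
  qed
  have ginjN: "s' = t" if "g s' = g t" "pt w s' \<in> N" "pt w t \<in> N" "0 < s' \<and> s' < 1" "0 \<le> t \<and> t \<le> 1" for s' t
  proof -
    have "curve D (pt w s') = curve D (pt w t)" using that(1-3) NM hinj unfolding g_def by blast
    then show ?thesis using inj_onD[OF iN _ that(2,3)] ptinj that(4,5) by blast
  qed
  have ginjM: "s' = t" if "g s' = g t" "pt w s' \<in> M" "pt w t \<in> M" "0 < s' \<and> s' < 1" "0 \<le> t \<and> t \<le> 1" for s' t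
  proof -
    have "curve D (pt w s') = curve D (pt w t)" using that(1-3) NM hinj unfolding g_def by blast
    then show ?thesis using inj_onD[OF iM _ that(2,3)] ptinj that(4,5) by blast
  qed
  have g0: "g s = 0" "g (s + d) = 0" using pz pz2 cz cz2 hx by (simp_all add: g_def)
  have c1: "continuous_on {s-b..s+b} (\<lambda>t. Re (g t))" using gcont[of "{s-b..s+b}"] inN by (intro continuous_intros) blast
  have c2: "continuous_on {s+d-b..s+d+b} (\<lambda>t. Im (g t))" using gcont[of "{s+d-b..s+d+b}"] inM by (intro continuous_intros) blast
  have i1: "inj_on (\<lambda>t. Re (g t)) {s-b..s+b}"
  proof (rule inj_onI)
    fix u v assume "u \<in> {s-b..s+b}" "v \<in> {s-b..s+b}" "Re (g u) = Re (g v)"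
    then show "u = v" using ginjN[of u v] gN[of u] gN[of v] inN t01[of u] t01[of v] by auto
  qed
  have i2: "inj_on (\<lambda>t. Im (g t)) {s+d-b..s+d+b}"
  proof (rule inj_onI)
    fix u v assume "u \<in> {s+d-b..s+d+b}" "v \<in> {s+d-b..s+d+b}" "Im (g u) = Im (g v)"
    then show "u = v" using ginjM[of u v] gM[of u] gM[of v] inM t01[of u] t01[of v] by auto
  qed
  obtain \<sigma> q1 where S1: "\<sigma> = 1 \<or> \<sigma> = (-1::real)" "0 < q1" "strict_mono_on {s-b..s+b} (\<lambda>t. \<sigma> * Re (g t))"
    "\<sigma> * Re (g (s - b)) \<le> - q1" "q1 \<le> \<sigma> * Re (g (s + b))"
    by (rule branch[OF b(1) c1 i1]) (use g0 in auto)
  obtain \<tau> q2 where S2: "\<tau> = 1 \<or> \<tau> = (-1::real)" "0 < q2" "strict_mono_on {s+d-b..s+d+b} (\<lambda>t. \<tau> * Im (g t))"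
    "\<tau> * Im (g (s + d - b)) \<le> - q2" "q2 \<le> \<tau> * Im (g (s + d + b))"
    by (rule branch[OF b(1) c2 i2]) (use g0 in auto)
  \<comment> \<open>With \<open>q \<le> 1\<close> the disk of radius \<open>50\<close>, scaled by \<open>la\<close>, fits into the unit disk of the given chart, and with
    \<open>q \<le> q1\<close>, \<open>q \<le> q2\<close> both branches pass the values \<open>-40\<close> and \<open>40\<close> inside the time intervals considered.\<close>
  define q where "q = Min {q1, q2, 1}"
  have q: "0 < q" "q \<le> q1" "q \<le> q2" "q \<le> 1" using S1 S2 by (auto simp: q_def)
  define la where "la = q / 50"
  have la: "0 < la" "50 * la = q" using q by (simp_all add: la_def)
  define f1 where "f1 t = \<sigma> * Re (g t) / la" for t
  define f2 where "f2 t = \<tau> * Im (g t) / la" for t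
  obtain a1 a2 where A: "s - b < a1" "a2 < s + b" "arc_time a1 a2 f1"
  proof (rule arc_time_exists[OF b(1)])
    show "continuous_on {s-b..s+b} f1" unfolding f1_def
      by (rule continuous_on_divide[OF continuous_on_mult[OF continuous_on_const c1] continuous_on_const]) (use la in auto)
    show "strict_mono_on {s-b..s+b} f1" using S1(3) la unfolding f1_def by (auto simp: monotone_on_def divide_strict_right_mono)
    have "\<sigma> * Re (g (s - b)) < - 40 * la" "40 * la < \<sigma> * Re (g (s + b))" using S1(4,5) la q by linarith+
    then show "f1 (s - b) < - 40" "40 < f1 (s + b)" using la by (simp_all add: f1_def field_simps)
  qed
  obtain c1 c2 where B: "s + d - b < c1" "c2 < s + d + b" "arc_time c1 c2 f2"
  proof (rule arc_time_exists[OF b(1), of "s + d"])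
    show "continuous_on {s+d-b..s+d+b} f2" unfolding f2_def
      by (rule continuous_on_divide[OF continuous_on_mult[OF continuous_on_const c2] continuous_on_const]) (use la in auto)
    show "strict_mono_on {s+d-b..s+d+b} f2" using S2(3) la unfolding f2_def by (auto simp: monotone_on_def divide_strict_right_mono)
    have "\<tau> * Im (g (s + d - b)) < - 40 * la" "40 * la < \<tau> * Im (g (s + d + b))" using S2(4,5) la q by linarith+
    then show "f2 (s + d - b) < - 40" "40 < f2 (s + d + b)" using la by (simp_all add: f2_def field_simps)
  qed
  define r where "r v = Complex (la * \<sigma> * Re v) (la * \<tau> * Im v)" for v
  define k where "k v = l (r v)" for v
  have nr: "norm (r v) = la * norm v" for v
  proof -
    have "(la * \<sigma> * Re v)^2 + (la * \<tau> * Im v)^2 = la^2 * ((Re v)^2 + (Im v)^2)"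
      using S1(1) S2(1) by (auto simp: power_mult_distrib algebra_simps)
    then show ?thesis using la(1) by (simp add: r_def cmod_def real_sqrt_mult)
  qed
  have rb: "r v \<in> ball 0 1" if "v \<in> ball 0 50" for v
  proof -
    have "la * norm v < la * 50" using that la by simp
    then show ?thesis using nr[of v] la(2) q(4) by simp
  qed
  have rinj: "v = v'" if "r v = r v'" for v v'
    using that la S1(1) S2(1) by (auto simp: r_def complex_eq_iff)
  have pc: "plane_chart (ball 0 50) k" unfolding plane_chart_def
  proof (intro conjI)
    have "continuous_on (ball 0 50) r"
    proof -
      have "r = (\<lambda>v. Complex (la * \<sigma> * Re v) (la * \<tau> * Im v))" by (rule ext) (simp add: r_def)
      then show ?thesis by (simp add: continuous_intros)
    qed
    then show "continuous_on (ball 0 50) k" unfolding k_def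
      by (rule continuous_on_compose2[OF homeomorphism_cont2[OF hom]]) (use rb in blast)
    show "inj_on k (ball 0 50)"
    proof (rule inj_onI)
      fix v v' :: complex assume v: "v \<in> ball 0 50" "v' \<in> ball 0 50" "k v = k v'"
      then have "h (l (r v)) = h (l (r v'))" unfolding k_def by simp
      then show "v = v'" using homeomorphism_apply(4)[OF hom] rb v rinj by metis
    qed
  qed simp
  have kh: "k v = y" if "y \<in> U" "h y = r v" for v y
    unfolding k_def using homeomorphism_apply(2)[OF hom that(1)] that(2) by simp
  have k0: "k 0 = x" by (rule kh[OF xU]) (simp add: hx r_def complex_eq_iff)
  have p1: "curve D (pt w t) = k (of_real (f1 t))" if "t \<in> {s-b..s+b}" for t
  proof (rule kh[symmetric])
    show "curve D (pt w t) \<in> U" using inN[OF that] NM by blast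
    show "h (curve D (pt w t)) = r (of_real (f1 t))"
      using gN[OF inN[OF that]] la S1(1) unfolding r_def f1_def g_def[symmetric] by (auto simp: complex_eq_iff)
  qed
  have p2: "curve D (pt w t) = k (\<i> * of_real (f2 t))" if "t \<in> {s+d-b..s+d+b}" for t
  proof (rule kh[symmetric])
    show "curve D (pt w t) \<in> U" using inM[OF that] NM by blast
    show "h (curve D (pt w t)) = r (\<i> * of_real (f2 t))"
      using gM[OF inM[OF that]] la S2(1) unfolding r_def f2_def g_def[symmetric] by (auto simp: complex_eq_iff)
  qed
  have cover: "t \<in> {a1..a2} \<union> {c1..c2}" if t: "0 \<le> t" "t \<le> 1" and m: "curve D (pt w t) \<in> k ` ball 0 40" for t
  proof -
    obtain v where v: "v \<in> ball 0 40" "curve D (pt w t) = k v" using m by blast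
    have rv: "r v \<in> ball 0 1" by (rule rb) (use v in simp)
    have "curve D (pt w t) \<in> U" using v(2) homeomorphism_apply(3)[OF hom rv] by (simp add: k_def)
    then have "pt w t \<in> N \<union> M" using all pt_in[OF w] C by blast
    have gv: "g t = r v" unfolding g_def v(2) k_def by (rule homeomorphism_apply(4)[OF hom rv])
    have "\<bar>Re v\<bar> < 40" "\<bar>Im v\<bar> < 40" using v(1) abs_Re_le_cmod[of v] abs_Im_le_cmod[of v] by auto
    then have vb: "-40 \<le> Re v" "Re v \<le> 40" "-40 \<le> Im v" "Im v \<le> 40" by linarith+
    from \<open>pt w t \<in> N \<union> M\<close> show ?thesis
    proof
      assume N: "pt w t \<in> N"
      obtain t' where t': "t' \<in> {a1..a2}" "f1 t' = Re v" using arc_timeD(9)[OF A(3) vb(1,2)] by blast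
      then have t'b: "t' \<in> {s-b..s+b}" using A by auto
      have "Re (g t') = Re (g t)" using t'(2) gv la S1(1) by (auto simp: f1_def r_def field_simps)
      then have "g t' = g t" using gN[OF N] gN[OF inN[OF t'b]] by simp
      then have "t' = t" using ginjN[OF _ inN[OF t'b] N] t01 t'b t by blast
      then show ?thesis using t' by blast
    next
      assume M: "pt w t \<in> M"
      obtain t' where t': "t' \<in> {c1..c2}" "f2 t' = Im v" using arc_timeD(9)[OF B(3) vb(3,4)] by blast
      then have t'b: "t' \<in> {s+d-b..s+d+b}" using B by auto
      have "Im (g t') = Im (g t)" using t'(2) gv la S2(1) by (auto simp: f2_def r_def field_simps)
      then have "g t' = g t" using gM[OF M] gM[OF inM[OF t'b]] by simp
      then have "t' = t" using ginjM[OF _ inM[OF t'b] M] t01 t'b t by blast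
      then show ?thesis using t' by blast
    qed
  qed
  show thesis
  proof (rule that[OF w pc k0 A(3) B(3)])
    have "2 * b \<le> 1 - s - d" using b(6) by simp
    then show "c2 < 1" using B(2) s(2) by linarith
    show "0 < a1" "a2 < c1" using A(1,2) B(1) b s(1) d0 by linarith+
    show "curve D (pt w t) = k (of_real (f1 t))" if "t \<in> {a1..a2}" for t using p1[of t] that A by auto
    show "curve D (pt w t) = k (\<i> * of_real (f2 t))" if "t \<in> {c1..c2}" for t using p2[of t] that B by auto
  qed (rule cover)
qed

section \<open>Reconnecting the outgoing arms of a crossing\<close>

text \<open>
  The inverse \<open>unstraighten\<close> turns the axes by \<open>45\<close> degrees, folds the four arms down at distance \<open>1\<close> from the
  vertical axis, and shears the picture horizontally by its height.  Afterwards the two positive (outgoing)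
  arms \<open>arm1\<close> and \<open>arm2\<close> rise from the origin, turn round at height \<open>1\<close> and come down again, so that between
  the heights \<open>1/4\<close> and \<open>1/2\<close> they form four legs; the shear makes the second of them vertical.
\<close>

definition straighten :: "complex \<Rightarrow> complex" where
  "straighten z = (let x = Re z - Im z; y = Im z + 2 * max 0 (\<bar>x\<bar> - 1) in Complex ((x + y) / 2) ((y - x) / 2))"

definition unstraighten :: "complex \<Rightarrow> complex" where
  "unstraighten w = (let x = Re w - Im w; y = Re w + Im w - 2 * max 0 (\<bar>x\<bar> - 1) in Complex (x + y) y)"

definition arm1 :: "real \<Rightarrow> complex" where
  "arm1 u = (if u > 1 then Complex 2 (2 - u) else if u \<ge> -1 then Complex (2 * u) u else Complex (4 * u + 2) (3 * u + 2))"

definition arm2 :: "real \<Rightarrow> complex" where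
  "arm2 v = (if v > 1 then Complex (2 - 2 * v) (2 - v) else if v \<ge> -1 then Complex 0 v else Complex (2 * v + 2) (3 * v + 2))"

lemma straighten_inverse: "straighten (unstraighten w) = w" "unstraighten (straighten w) = w"
proof -
  define m where "m x = max 0 (\<bar>x\<bar> - 1)" for x :: real
  have f: "unstraighten w = Complex (2 * Re w - 2 * m (Re w - Im w)) (Re w + Im w - 2 * m (Re w - Im w))" for w
    by (simp add: unstraighten_def Let_def m_def)
  have s: "straighten z = Complex ((Re z + 2 * m (Re z - Im z)) / 2) ((2 * Im z + 2 * m (Re z - Im z) - Re z) / 2)" for z
    by (simp add: straighten_def Let_def m_def)
  have "Re (unstraighten w) - Im (unstraighten w) = Re w - Im w" by (simp add: f)
  then show "straighten (unstraighten w) = w" by (simp add: s complex_eq_iff) (simp add: f)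
  have "Re (straighten w) - Im (straighten w) = Re w - Im w" by (simp add: s field_simps)
  then show "unstraighten (straighten w) = w" by (simp add: f complex_eq_iff) (simp add: s field_simps)
qed

lemma straighten_bij: "bij straighten"
  by (rule bij_betw_byWitness[of _ unstraighten]) (auto simp: straighten_inverse)

lemma straighten_continuous: "continuous_on S straighten"
proof -
  have "straighten = (\<lambda>z. Complex ((Re z - Im z + (Im z + 2 * max 0 (\<bar>Re z - Im z\<bar> - 1))) / 2)
     ((Im z + 2 * max 0 (\<bar>Re z - Im z\<bar> - 1) - (Re z - Im z)) / 2))"
    by (rule ext) (simp add: straighten_def Let_def)
  moreover have "continuous_on S (\<lambda>z. Complex ((Re z - Im z + (Im z + 2 * max 0 (\<bar>Re z - Im z\<bar> - 1))) / 2)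
     ((Im z + 2 * max 0 (\<bar>Re z - Im z\<bar> - 1) - (Re z - Im z)) / 2))"
    by (intro continuous_intros) auto
  ultimately show ?thesis by metis
qed

lemma straighten_arms: "straighten (arm1 u) = of_real u" "straighten (arm2 v) = \<i> * of_real v" "straighten 0 = 0"
  by (auto simp: straighten_def arm1_def arm2_def Let_def complex_eq_iff max_def abs_if)

lemma straighten_bound: "z \<in> rect (-2) 3 (-1) 4 \<Longrightarrow> straighten z \<in> ball 0 40"
proof -
  assume "z \<in> rect (-2) 3 (-1) 4"
  then have z: "-2 \<le> Re z" "Re z \<le> 3" "-1 \<le> Im z" "Im z \<le> 4" by (auto simp: in_cbox_complex_iff)
  define m where "m = max 0 (\<bar>Re z - Im z\<bar> - 1)"
  have m: "0 \<le> m" "m \<le> 6" using z by (auto simp: m_def)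
  have "\<bar>Re (straighten z)\<bar> \<le> 19" "\<bar>Im (straighten z)\<bar> \<le> 19"
    using z m unfolding straighten_def Let_def m_def[symmetric] by (simp_all add: abs_le_iff)
  then show ?thesis using cmod_le[of "straighten z"] by simp
qed

text \<open>
  The times \<open>b1 < b2\<close> and \<open>d1 < d2\<close> are those at which the outgoing arms enter and leave the disk of the
  H-move; \<open>a0\<close> and \<open>s0\<close> are the times at which the curve enters the disk of the subsequent R1-move on its
  first and on its second passage.
\<close>

locale crossing_chart =
  fixes D :: diagram and w :: complex and Q k a1 a2 f1 c1 c2 f2 a0 b1 b2 s0 d1 d2
  assumes vldD: "virtual_link_diagram D" and one: "ncomp D = 1" and w: "norm w = 1"
    and chartQ: "plane_chart Q k" and QB: "rect (-2) 3 (-1) 4 \<subseteq> Q"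
    and armsQ: "-40 \<le> u \<Longrightarrow> u \<le> 40 \<Longrightarrow> arm1 u \<in> Q" "-40 \<le> u \<Longrightarrow> u \<le> 40 \<Longrightarrow> arm2 u \<in> Q"
    and arc1: "arc_time a1 a2 f1" and arc2: "arc_time c1 c2 f2" and a1: "0 < a1" and ac: "a2 < c1" and c2: "c2 < 1"
    and p1: "t \<in> {a1..a2} \<Longrightarrow> curve D (pt w t) = k (arm1 (f1 t))"
    and p2: "t \<in> {c1..c2} \<Longrightarrow> curve D (pt w t) = k (arm2 (f2 t))"
    and cover: "0 \<le> t \<Longrightarrow> t \<le> 1 \<Longrightarrow> curve D (pt w t) \<in> k ` rect (-2) 3 (-1) 4 \<Longrightarrow> t \<in> {a1..a2} \<union> {c1..c2}"
    and x0: "k 0 \<in> crossings D"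
    and a0: "a0 \<in> {a1..a2}" "f1 a0 = -1/8" and b1: "b1 \<in> {a1..a2}" "f1 b1 = 1/2" and b2: "b2 \<in> {a1..a2}" "f1 b2 = 3/2"
    and s0: "s0 \<in> {c1..c2}" "f2 s0 = -1/4" and d1: "d1 \<in> {c1..c2}" "f2 d1 = 1/2" and d2: "d2 \<in> {c1..c2}" "f2 d2 = 3/2"
begin

lemma order: "0 < a1" "a1 \<le> a0" "a0 < b1" "b1 < b2" "b2 \<le> a2" "a2 < c1" "c1 \<le> s0" "s0 < d1" "d1 < d2" "d2 \<le> c2" "c2 < 1"
proof -
  show "a0 < b1" using arc_timeD(3)[OF arc1 a0(1) b1(1)] a0 b1 by simp
  show "b1 < b2" using arc_timeD(3)[OF arc1 b1(1) b2(1)] b1 b2 by simp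
  show "s0 < d1" using arc_timeD(3)[OF arc2 s0(1) d1(1)] s0 d1 by simp
  show "d1 < d2" using arc_timeD(3)[OF arc2 d1(1) d2(1)] d1 d2 by simp
qed (use a1 ac c2 a0 b2 s0 d2 in auto)

lemma circ: "circles D = {0} \<times> sphere 0 1" by (rule circles_1[OF one])

lemma pt_circ: "pt w t \<in> circles D" using pt_in[OF w] circ by simp

lemma circ_cases: assumes "z \<in> circles D" obtains t where "0 \<le> t" "t < 1" "z = pt w t"
  using pt_surj[OF w] assms circ by metis

definition p where "p t = curve D (pt w t)"

lemma p_ends: "p 0 = p 1" using pt_eq_iff[OF w, of 0 1] by (simp add: p_def)

lemma p_cont: "continuous_on S p"
proof -
  have "continuous_on S (\<lambda>t. curve D (pt w t))"
    by (rule continuous_on_compose2[OF virtual_link_diagramD(1)[OF vldD] continuous_pt]) (use pt_circ in blast)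
  then show ?thesis unfolding p_def[abs_def] .
qed

lemma f1_le: "s \<in> {a1..a2} \<Longrightarrow> t \<in> {a1..a2} \<Longrightarrow> f1 s \<le> f1 t \<longleftrightarrow> s \<le> t"
  and f1_less: "s \<in> {a1..a2} \<Longrightarrow> t \<in> {a1..a2} \<Longrightarrow> f1 s < f1 t \<longleftrightarrow> s < t"
  and f2_le: "s \<in> {c1..c2} \<Longrightarrow> t \<in> {c1..c2} \<Longrightarrow> f2 s \<le> f2 t \<longleftrightarrow> s \<le> t"
  and f2_less: "s \<in> {c1..c2} \<Longrightarrow> t \<in> {c1..c2} \<Longrightarrow> f2 s < f2 t \<longleftrightarrow> s < t"
  using arc_timeD(3,5)[OF arc1] arc_timeD(3,5)[OF arc2] by blast+

lemma arm_inQ: "t \<in> {a1..a2} \<Longrightarrow> arm1 (f1 t) \<in> Q" "t \<in> {c1..c2} \<Longrightarrow> arm2 (f2 t) \<in> Q"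
  using arc_timeD(8)[OF arc1, of t] arc_timeD(8)[OF arc2, of t] armsQ by blast+

lemma k_mem: "C \<subseteq> rect (-2) 3 (-1) 4 \<Longrightarrow> z \<in> Q \<Longrightarrow> k z \<in> k ` C \<longleftrightarrow> z \<in> C"
  using plane_chart_mem[OF chartQ] QB by blast

lemma k_eq: "z \<in> Q \<Longrightarrow> z' \<in> Q \<Longrightarrow> k z = k z' \<longleftrightarrow> z = z'"
  by (rule plane_chart_inj[OF chartQ])

lemma p_in:
  assumes "C \<subseteq> rect (-2) 3 (-1) 4" "0 \<le> t" "t \<le> 1"
  shows "p t \<in> k ` C \<longleftrightarrow> (t \<in> {a1..a2} \<and> arm1 (f1 t) \<in> C) \<or> (t \<in> {c1..c2} \<and> arm2 (f2 t) \<in> C)"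
proof (cases "t \<in> {a1..a2} \<union> {c1..c2}")
  case True
  then show ?thesis
  proof
    assume t: "t \<in> {a1..a2}"
    then have "t \<notin> {c1..c2}" using ac by auto
    then show ?thesis using t p1[OF t] k_mem[OF assms(1) arm_inQ(1)[OF t]] unfolding p_def by metis
  next
    assume t: "t \<in> {c1..c2}"
    then have "t \<notin> {a1..a2}" using ac by auto
    then show ?thesis using t p2[OF t] k_mem[OF assms(1) arm_inQ(2)[OF t]] unfolding p_def by metis
  qed
next
  case False
  then show ?thesis using cover[OF assms(2,3)] assms(1) unfolding p_def by blast
qed

abbreviation "R \<equiv> rect (-2) 3 (1/2) 4"
abbreviation "B \<equiv> k ` R"

lemma R_big: "R \<subseteq> rect (-2) 3 (-1) 4" "open_rect (-2) 3 (1/2) 4 \<subseteq> rect (-2) 3 (-1) 4"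
  "rect (-2) 3 (1/4) 4 \<subseteq> rect (-2) 3 (-1) 4" "rect (-2) 3 (1/4) (1/2) \<subseteq> rect (-2) 3 (-1) 4"
  by (auto simp: in_cbox_complex_iff in_box_complex_iff subset_iff)

lemma int_B: "interior B = k ` open_rect (-2) 3 (1/2) 4"
  using plane_chart_interior[OF chartQ, of R] R_big QB by (simp add: interior_cbox)

lemma closed_B: "closed B"
  using plane_chart_compact[OF chartQ, of R] R_big QB by (simp add: compact_imp_closed)

lemma arm_R: "arm1 u \<in> R \<longleftrightarrow> 1/2 \<le> u \<and> u \<le> 3/2" "arm2 u \<in> R \<longleftrightarrow> 1/2 \<le> u \<and> u \<le> 3/2"
  "arm1 u \<in> open_rect (-2) 3 (1/2) 4 \<longleftrightarrow> 1/2 < u \<and> u < 3/2" "arm2 u \<in> open_rect (-2) 3 (1/2) 4 \<longleftrightarrow> 1/2 < u \<and> u < 3/2"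
  by (auto simp: arm1_def arm2_def in_cbox_complex_iff in_box_complex_iff)

lemma p_B:
  assumes "0 \<le> t" "t \<le> 1"
  shows "p t \<in> B \<longleftrightarrow> t \<in> {b1..b2} \<union> {d1..d2}" "p t \<in> interior B \<longleftrightarrow> t \<in> {b1<..<b2} \<union> {d1<..<d2}"
proof -
  have 1: "1/2 \<le> f1 t \<longleftrightarrow> b1 \<le> t" "f1 t \<le> 3/2 \<longleftrightarrow> t \<le> b2" "1/2 < f1 t \<longleftrightarrow> b1 < t" "f1 t < 3/2 \<longleftrightarrow> t < b2" if "t \<in> {a1..a2}"
    using f1_le[OF b1(1) that] f1_le[OF that b2(1)] f1_less[OF b1(1) that] f1_less[OF that b2(1)] b1 b2 by simp_all
  have 2: "1/2 \<le> f2 t \<longleftrightarrow> d1 \<le> t" "f2 t \<le> 3/2 \<longleftrightarrow> t \<le> d2" "1/2 < f2 t \<longleftrightarrow> d1 < t" "f2 t < 3/2 \<longleftrightarrow> t < d2" if "t \<in> {c1..c2}"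
    using f2_le[OF d1(1) that] f2_le[OF that d2(1)] f2_less[OF d1(1) that] f2_less[OF that d2(1)] d1 d2 by simp_all
  show "p t \<in> B \<longleftrightarrow> t \<in> {b1..b2} \<union> {d1..d2}"
    unfolding p_in[OF R_big(1) assms] arm_R using 1 2 order by auto
  show "p t \<in> interior B \<longleftrightarrow> t \<in> {b1<..<b2} \<union> {d1<..<d2}"
    unfolding int_B p_in[OF R_big(2) assms] arm_R using 1 2 order by auto
qed

lemma p_at: "p b1 = k (Complex 1 (1/2))" "p b2 = k (Complex 2 (1/2))" "p d1 = k (Complex 0 (1/2))" "p d2 = k (Complex (-1) (1/2))"
  using p1[OF b1(1)] p1[OF b2(1)] p2[OF d1(1)] p2[OF d2(1)] b1 b2 d1 d2 by (simp_all add: p_def arm1_def arm2_def)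

text \<open>
  The two arcs that replace the cut pieces of the outgoing arms: \<open>inner\<close> joins the ends next to the crossing,
  \<open>outer\<close> arches over it and joins the far ends.
\<close>

definition inner :: "real \<Rightarrow> complex" where "inner s = Complex (1 - s) (1 - \<bar>s - 1/2\<bar>)"
definition outer :: "real \<Rightarrow> complex" where "outer s = Complex (2 - 3 * s) (3 - 5 * \<bar>s - 1/2\<bar>)"

lemma inner_outer_cont: "continuous_on S inner" "continuous_on S outer"
  unfolding inner_def[abs_def] outer_def[abs_def] by (intro continuous_intros)+

lemma inner_outer_ends: "inner 0 = Complex 1 (1/2)" "inner 1 = Complex 0 (1/2)" "outer 0 = Complex 2 (1/2)" "outer 1 = Complex (-1) (1/2)"
  by (simp_all add: inner_def outer_def)

lemma inner_R: "0 \<le> s \<Longrightarrow> s \<le> 1 \<Longrightarrow> inner s \<in> R" "0 < s \<Longrightarrow> s < 1 \<Longrightarrow> inner s \<in> open_rect (-2) 3 (1/2) 4"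
  "0 \<le> s \<Longrightarrow> s \<le> 1 \<Longrightarrow> outer s \<in> R" "0 < s \<Longrightarrow> s < 1 \<Longrightarrow> outer s \<in> open_rect (-2) 3 (1/2) 4"
  by (auto simp: inner_def outer_def in_cbox_complex_iff in_box_complex_iff abs_if)

lemma inner_outer_inj: "inner s = inner t \<longleftrightarrow> s = t" "outer s = outer t \<longleftrightarrow> s = t"
  by (auto simp: inner_def outer_def)

lemma inner_outer_disjoint: "0 \<le> s \<Longrightarrow> s \<le> 1 \<Longrightarrow> inner s \<noteq> outer t"
  by (auto simp: inner_def outer_def abs_if split: if_splits)

definition flip :: "real \<Rightarrow> real" where "flip t = (if b2 \<le> t \<and> t \<le> d1 then b2 + d1 - t else t)"

text \<open>
  The new curve turns off the first outgoing arm into the second one, traverses the arc between the two cuts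
  backwards, and returns along the outer arc.  So it is a single closed curve.
\<close>

definition p' :: "real \<Rightarrow> complex" where
  "p' t = (if t \<le> b1 then p t else if t \<le> b2 then k (inner ((t - b1) / (b2 - b1))) else if t \<le> d1 then p (b2 + d1 - t)
     else if t \<le> d2 then k (outer ((t - d1) / (d2 - d1))) else p t)"

lemma p'_eq:
  "t \<le> b1 \<Longrightarrow> p' t = p t"
  "b1 \<le> t \<Longrightarrow> t \<le> b2 \<Longrightarrow> p' t = k (inner ((t - b1) / (b2 - b1)))"
  "b2 \<le> t \<Longrightarrow> t \<le> d1 \<Longrightarrow> p' t = p (b2 + d1 - t)"
  "d1 \<le> t \<Longrightarrow> t \<le> d2 \<Longrightarrow> p' t = k (outer ((t - d1) / (d2 - d1)))"
  "d2 \<le> t \<Longrightarrow> p' t = p t"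
proof -
  show "t \<le> b1 \<Longrightarrow> p' t = p t" by (simp add: p'_def)
  show "b1 \<le> t \<Longrightarrow> t \<le> b2 \<Longrightarrow> p' t = k (inner ((t - b1) / (b2 - b1)))"
    using p_at inner_outer_ends by (cases "t = b1") (simp_all add: p'_def)
  show "b2 \<le> t \<Longrightarrow> t \<le> d1 \<Longrightarrow> p' t = p (b2 + d1 - t)"
    using p_at inner_outer_ends order by (cases "t = b2") (simp_all add: p'_def)
  show "d1 \<le> t \<Longrightarrow> t \<le> d2 \<Longrightarrow> p' t = k (outer ((t - d1) / (d2 - d1)))"
    using p_at inner_outer_ends order by (cases "t = d1") (simp_all add: p'_def)
  show "d2 \<le> t \<Longrightarrow> p' t = p t"
    using p_at inner_outer_ends order by (cases "t = d2") (simp_all add: p'_def)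
qed

lemma frac: "a < b \<Longrightarrow> a \<le> t \<Longrightarrow> t \<le> b \<Longrightarrow> 0 \<le> (t - a) / (b - a) \<and> (t - a) / (b - a) \<le> 1"
  "a < b \<Longrightarrow> a < t \<Longrightarrow> t < b \<Longrightarrow> 0 < (t - a) / (b - a) \<and> (t - a) / (b - a) < 1" for a b t :: real
  by (simp_all add: field_simps)

lemma k_cont: "continuous_on Q k" using chartQ by (simp add: plane_chart_def)

lemma RQ: "R \<subseteq> Q" using R_big QB by blast

lemma p'_cont: "continuous_on {0..1} p'"
proof -
  have 1: "continuous_on {0..b1} p'" by (rule continuous_on_eq[OF p_cont]) (simp add: p'_eq)
  have "continuous_on {b1..b2} (\<lambda>t. k (inner ((t - b1) / (b2 - b1))))"
    by (rule continuous_on_compose2[OF k_cont continuous_on_compose2[OF inner_outer_cont(1)[of UNIV]]])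
       (use order frac(1)[of b1 b2] inner_R(1) RQ in \<open>auto intro!: continuous_intros\<close>)
  then have 2: "continuous_on {b1..b2} p'" by (rule continuous_on_eq) (simp add: p'_eq)
  have "continuous_on {b2..d1} (\<lambda>t. p (b2 + d1 - t))"
    by (rule continuous_on_compose2[OF p_cont[of UNIV]]) (auto intro!: continuous_intros)
  then have 3: "continuous_on {b2..d1} p'" by (rule continuous_on_eq) (simp add: p'_eq)
  have "continuous_on {d1..d2} (\<lambda>t. k (outer ((t - d1) / (d2 - d1))))"
    by (rule continuous_on_compose2[OF k_cont continuous_on_compose2[OF inner_outer_cont(2)[of UNIV]]])
       (use order frac(1)[of d1 d2] inner_R(3) RQ in \<open>auto intro!: continuous_intros\<close>)
  then have 4: "continuous_on {d1..d2} p'" by (rule continuous_on_eq) (simp add: p'_eq)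
  have 5: "continuous_on {d2..1} p'" by (rule continuous_on_eq[OF p_cont]) (simp add: p'_eq)
  have "{0..1} = {0..b1} \<union> {b1..b2} \<union> {b2..d1} \<union> {d1..d2} \<union> {d2..1}" using order by auto
  moreover have "continuous_on ({0..b1} \<union> {b1..b2} \<union> {b2..d1} \<union> {d1..d2} \<union> {d2..1}) p'"
    by (intro continuous_on_closed_Un closed_Un closed_atLeastAtMost 1 2 3 4 5)
  ultimately show ?thesis by simp
qed

lemma p'_ends: "p' 0 = p' 1" using p_ends order by (simp add: p'_eq)

definition tm :: "nat \<times> complex \<Rightarrow> real" where "tm z = (THE t. 0 \<le> t \<and> t < 1 \<and> z = pt w t)"

lemma tm: "0 \<le> t \<Longrightarrow> t < 1 \<Longrightarrow> tm (pt w t) = t"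
  unfolding tm_def by (rule the_equality) (use pt_eq_iff[OF w] in auto)

lemma pt_1: "pt w 1 = pt w 0" using pt_eq_iff[OF w, of 1 0] by simp

lemma tm_1: "tm (pt w 1) = 0" using tm[of 0] pt_1 by simp

lemma loop_tm: "0 \<le> t \<Longrightarrow> t \<le> 1 \<Longrightarrow> q 0 = q 1 \<Longrightarrow> q (tm (pt w t)) = q t"
  using tm[of t] tm_1 by (cases "t = 1") auto

lemma pt_tm: "z \<in> circles D \<Longrightarrow> pt w (tm z) = z \<and> 0 \<le> tm z \<and> tm z < 1"
  using tm circ_cases by metis

lemma circ_image: "circles D = pt w ` {0..1}"
proof
  show "circles D \<subseteq> pt w ` {0..1}"
  proof
    fix z assume "z \<in> circles D"
    then obtain t where "0 \<le> t" "t < 1" "z = pt w t" by (rule circ_cases)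
    then show "z \<in> pt w ` {0..1}" by auto
  qed
qed (use pt_circ in blast)

lemma loop_continuous:
  fixes q :: "real \<Rightarrow> complex"
  assumes "continuous_on {0..1} q" "q 0 = q 1"
  shows "continuous_on (circles D) (\<lambda>z. q (tm z))"
  unfolding circ_image
proof (rule continuous_on_factor)
  show "continuous_on {0..1} ((\<lambda>z. q (tm z)) \<circ> pt w)"
    by (rule continuous_on_eq[OF assms(1)]) (simp add: loop_tm assms(2))
qed (use continuous_pt in auto)

definition smoothed :: diagram where
  "smoothed = D\<lparr>curve := (\<lambda>z. p' (tm z)), overs := (\<lambda>z. pt w (flip (tm z))) ` overs D\<rparr>"

lemma smoothed_simps: "circles smoothed = circles D" "virtuals smoothed = virtuals D" "ncomp smoothed = 1"
  "0 \<le> t \<Longrightarrow> t \<le> 1 \<Longrightarrow> curve smoothed (pt w t) = p' t"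
  using one by (simp_all add: smoothed_def circles_def loop_tm p'_ends)

lemma flip_bounds: "0 \<le> t \<Longrightarrow> t \<le> 1 \<Longrightarrow> 0 \<le> flip t \<and> flip t \<le> 1" "0 \<le> t \<Longrightarrow> t < 1 \<Longrightarrow> flip t < 1" "flip (flip t) = t"
  using order by (auto simp: flip_def)

lemma p'_cases:
  assumes "0 \<le> t" "t \<le> 1"
  obtains (old) "t \<in> {0..b1} \<union> {b2..d1} \<union> {d2..1}" "p' t = p (flip t)" | (inner) "b1 < t" "t < b2" "p' t = k (inner ((t - b1) / (b2 - b1)))"
    | (outer) "d1 < t" "t < d2" "p' t = k (outer ((t - d1) / (d2 - d1)))"
proof -
  consider "t \<le> b1" | "b1 < t" "t < b2" | "b2 \<le> t" "t \<le> d1" | "d1 < t" "t < d2" | "d2 \<le> t" by linarith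
  then show thesis
    by cases (use order assms in \<open>auto simp: p'_eq flip_def intro: old inner outer\<close>)
qed

lemma flip_S: "t \<in> {0..b1} \<union> {b2..d1} \<union> {d2..1} \<Longrightarrow> flip t \<in> {0..b1} \<union> {b2..d1} \<union> {d2..1}"
  using order by (auto simp: flip_def)

lemma p'_flip: "t \<in> {0..b1} \<union> {b2..d1} \<union> {d2..1} \<Longrightarrow> p' (flip t) = p t"
  using order by (auto simp: flip_def p'_eq)

lemma p'_B:
  assumes "0 \<le> t" "t \<le> 1"
  shows "p' t \<in> B \<longleftrightarrow> t \<in> {b1..b2} \<union> {d1..d2}" "p' t \<in> interior B \<longleftrightarrow> t \<in> {b1<..<b2} \<union> {d1<..<d2}"
proof -
  have "(p' t \<in> B \<longleftrightarrow> t \<in> {b1..b2} \<union> {d1..d2}) \<and> (p' t \<in> interior B \<longleftrightarrow> t \<in> {b1<..<b2} \<union> {d1<..<d2})"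
    using assms
  proof (cases rule: p'_cases)
    case old
    have f: "0 \<le> flip t" "flip t \<le> 1" using flip_bounds assms by auto
    show ?thesis unfolding old(2) p_B[OF f] using old(1) order by (auto simp: flip_def)
  next
    case inner
    then show ?thesis using inner_R(1,2) frac[OF order(4), of t] order unfolding inner(3) int_B by auto
  next
    case outer
    then show ?thesis using inner_R(3,4) frac[OF order(9), of t] order unfolding outer(3) int_B by auto
  qed
  then show "p' t \<in> B \<longleftrightarrow> t \<in> {b1..b2} \<union> {d1..d2}" "p' t \<in> interior B \<longleftrightarrow> t \<in> {b1<..<b2} \<union> {d1<..<d2}" by blast+
qed

lemma outside_D: "{z \<in> circles D. curve D z \<notin> interior B} = pt w ` ({0..b1} \<union> {b2..d1} \<union> {d2..1})"
proof
  show "{z \<in> circles D. curve D z \<notin> interior B} \<subseteq> pt w ` ({0..b1} \<union> {b2..d1} \<union> {d2..1})"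
  proof
    fix z assume "z \<in> {z \<in> circles D. curve D z \<notin> interior B}"
    then have z: "z \<in> circles D" "curve D z \<notin> interior B" by auto
    obtain t where t: "0 \<le> t" "t < 1" "z = pt w t" using z(1) by (rule circ_cases)
    then have "t \<notin> {b1<..<b2} \<union> {d1<..<d2}" using p_B(2)[of t] z(2) by (simp add: p_def)
    then have "t \<in> {0..b1} \<union> {b2..d1} \<union> {d2..1}" using t by auto
    then show "z \<in> pt w ` ({0..b1} \<union> {b2..d1} \<union> {d2..1})" using t(3) by blast
  qed
  show "pt w ` ({0..b1} \<union> {b2..d1} \<union> {d2..1}) \<subseteq> {z \<in> circles D. curve D z \<notin> interior B}"
  proof
    fix z assume "z \<in> pt w ` ({0..b1} \<union> {b2..d1} \<union> {d2..1})"
    then obtain t where t: "t \<in> {0..b1} \<union> {b2..d1} \<union> {d2..1}" "z = pt w t" by blast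
    then have "0 \<le> t" "t \<le> 1" "t \<notin> {b1<..<b2} \<union> {d1<..<d2}" using order by auto
    then show "z \<in> {z \<in> circles D. curve D z \<notin> interior B}" using p_B(2)[of t] pt_circ t(2) by (simp add: p_def)
  qed
qed

lemma outside_smoothed: "{z \<in> circles smoothed. curve smoothed z \<notin> interior B} = pt w ` ({0..b1} \<union> {b2..d1} \<union> {d2..1})"
  unfolding smoothed_simps
proof
  show "{z \<in> circles D. curve smoothed z \<notin> interior B} \<subseteq> pt w ` ({0..b1} \<union> {b2..d1} \<union> {d2..1})"
  proof
    fix z assume "z \<in> {z \<in> circles D. curve smoothed z \<notin> interior B}"
    then have z: "z \<in> circles D" "curve smoothed z \<notin> interior B" by auto
    obtain t where t: "0 \<le> t" "t < 1" "z = pt w t" using z(1) by (rule circ_cases)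
    then have "t \<notin> {b1<..<b2} \<union> {d1<..<d2}" using p'_B(2)[of t] z(2) smoothed_simps(4)[of t] by simp
    then have "t \<in> {0..b1} \<union> {b2..d1} \<union> {d2..1}" using t by auto
    then show "z \<in> pt w ` ({0..b1} \<union> {b2..d1} \<union> {d2..1})" using t(3) by blast
  qed
  show "pt w ` ({0..b1} \<union> {b2..d1} \<union> {d2..1}) \<subseteq> {z \<in> circles D. curve smoothed z \<notin> interior B}"
  proof
    fix z assume "z \<in> pt w ` ({0..b1} \<union> {b2..d1} \<union> {d2..1})"
    then obtain t where t: "t \<in> {0..b1} \<union> {b2..d1} \<union> {d2..1}" "z = pt w t" by blast
    then have "0 \<le> t" "t \<le> 1" "t \<notin> {b1<..<b2} \<union> {d1<..<d2}" using order by auto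
    then show "z \<in> {z \<in> circles D. curve smoothed z \<notin> interior B}" using p'_B(2)[of t] pt_circ t(2) smoothed_simps(4)[of t] by simp
  qed
qed

text \<open>
  The parameters outside the disk are matched by the involution that reverses the time interval between the two
  cuts.
\<close>

lemma smoothed_agree: "agree_outside B D smoothed"
proof -
  let ?S = "{0..b1} \<union> {b2..d1} \<union> {d2..1}"
  define F where "F z = pt w (flip (tm z))" for z
  have Fpt: "F (pt w t) = pt w (flip t)" if "t \<in> ?S" for t
  proof (cases "t = 1")
    case True
    then show ?thesis using tm_1 pt_1 order by (simp add: F_def flip_def)
  next
    case False
    then have "0 \<le> t" "t < 1" using that order by auto
    then show ?thesis using tm[of t] by (simp add: F_def)
  qed
  have FF: "F (F z) = z" if "z \<in> pt w ` ?S" for z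
  proof -
    from that obtain t where t: "t \<in> ?S" "z = pt w t" by blast
    then show ?thesis using Fpt[OF t(1)] Fpt[OF flip_S[OF t(1)]] flip_bounds(3) by simp
  qed
  have Fim: "F z \<in> pt w ` ?S" if "z \<in> pt w ` ?S" for z
  proof -
    from that obtain t where t: "t \<in> ?S" "z = pt w t" by blast
    then show ?thesis using Fpt[OF t(1)] flip_S[OF t(1)] by blast
  qed
  have cont: "continuous_on (pt w ` ?S) F"
  proof (rule continuous_on_factor)
    show "compact ?S" by (intro compact_Un) auto
    have "continuous_on ?S flip"
    proof (intro continuous_on_closed_Un)
      show "continuous_on {0..b1} flip" by (rule continuous_on_eq[OF continuous_on_id]) (use order in \<open>auto simp: flip_def\<close>)
      have "continuous_on {b2..d1} (\<lambda>t. b2 + d1 - t)" by (intro continuous_intros)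
      then show "continuous_on {b2..d1} flip" by (rule continuous_on_eq) (auto simp: flip_def)
      show "continuous_on {d2..1} flip" by (rule continuous_on_eq[OF continuous_on_id]) (use order in \<open>auto simp: flip_def\<close>)
    qed (auto intro: closed_Un)
    then have "continuous_on ?S (\<lambda>t. pt w (flip t))"
      by (rule continuous_on_compose2[OF continuous_pt[of UNIV]]) auto
    then show "continuous_on ?S (F \<circ> pt w)" by (rule continuous_on_eq) (simp only: o_apply Fpt)
  qed (rule continuous_pt)
  have over: "F z \<in> overs smoothed \<longleftrightarrow> z \<in> overs D" if z: "z \<in> pt w ` ?S" for z
  proof
    assume "z \<in> overs D"
    then show "F z \<in> overs smoothed" by (simp add: smoothed_def F_def)
  next
    assume "F z \<in> overs smoothed"
    then obtain y where y: "y \<in> overs D" "F z = pt w (flip (tm y))" by (auto simp: smoothed_def)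
    have yc: "y \<in> circles D" using y(1) virtual_link_diagramD(5)[OF vldD] by blast
    then have yt: "pt w (tm y) = y" "0 \<le> tm y" "tm y < 1" using pt_tm by auto
    obtain t where t: "0 \<le> t" "t < 1" "z = pt w t" using z outside_D circ_cases by blast
    then have "pt w (flip t) = pt w (flip (tm y))" using y(2) tm[of t] by (simp add: F_def)
    then have "flip t = flip (tm y)"
      using pt_eq_iff[OF w, of "flip t" "flip (tm y)"] flip_bounds(1,2)[of t] flip_bounds(1,2)[of "tm y"] t yt by auto
    then have "t = tm y" using flip_bounds(3) by metis
    then show "z \<in> overs D" using t yt y by simp
  qed
  show ?thesis unfolding agree_outside_def
  proof (intro exI conjI ballI impI)
    show "homeomorphism {z \<in> circles D. curve D z \<notin> interior B} {z \<in> circles smoothed. curve smoothed z \<notin> interior B} F F"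
      unfolding outside_D outside_smoothed homeomorphism_def
    proof (intro conjI ballI)
      have sub: "F ` pt w ` ?S \<subseteq> pt w ` ?S" by (rule image_subsetI) (rule Fim)
      have "z \<in> F ` pt w ` ?S" if "z \<in> pt w ` ?S" for z
        using imageI[OF Fim[OF that], of F] FF[OF that] by simp
      then have "F ` pt w ` ?S = pt w ` ?S" using sub by blast
      then show "F ` pt w ` ?S = pt w ` ?S" "F ` pt w ` ?S = pt w ` ?S" by blast+
      show "F (F z) = z" "F (F z) = z" if "z \<in> pt w ` ?S" for z using FF[OF that] by blast+
    qed (rule cont)+
    show "virtuals smoothed - interior B = virtuals D - interior B" by (simp add: smoothed_simps)
    fix z assume "z \<in> circles D" "curve D z \<notin> interior B"
    then have z: "z \<in> pt w ` ?S" using outside_D by blast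
    then show "(F z \<in> overs smoothed) = (z \<in> overs D)" by (rule over)
    obtain t where t: "t \<in> ?S" "z = pt w t" using z by blast
    then have "0 \<le> t" "t \<le> 1" using order by auto
    then show "curve smoothed (F z) = curve D z"
      using Fpt[OF t(1)] t smoothed_simps(4)[of "flip t"] flip_bounds(1)[of t] p'_flip[OF t(1)] by (simp add: p_def)
  qed
qed

end

lemma agree_outside_image:
  assumes "agree_outside B D E"
  shows "curve E ` circles E - interior B = curve D ` circles D - interior B"
proof -
  have *: "curve E ` circles E - interior B \<supseteq> curve D ` circles D - interior B" if "agree_outside B D E" for D E
  proof (rule agree_outsideE[OF that])
    fix f g
    assume h: "homeomorphism {z \<in> circles D. curve D z \<notin> interior B} {z \<in> circles E. curve E z \<notin> interior B} f g"
      and e: "\<And>z. z \<in> circles D \<Longrightarrow> curve D z \<notin> interior B \<Longrightarrow> curve E (f z) = curve D z"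
    show "curve E ` circles E - interior B \<supseteq> curve D ` circles D - interior B"
    proof
      fix x assume "x \<in> curve D ` circles D - interior B"
      then obtain z where z: "z \<in> circles D" "x = curve D z" "x \<notin> interior B" by blast
      then have "f z \<in> circles E" "curve E (f z) = x"
        using homeomorphism_apply(1)[OF h, of z] e[of z] by simp_all
      then show "x \<in> curve E ` circles E - interior B" using z(3) by blast
    qed
  qed
  show ?thesis using *[OF assms] *[OF agree_outside_sym[OF assms]] by blast
qed

context crossing_chart
begin

lemma crossing_times:
  assumes "x \<in> crossings E" "circles E = circles D"
  obtains s t where "0 \<le> s" "s < 1" "0 \<le> t" "t < 1" "s \<noteq> t" "curve E (pt w s) = x" "curve E (pt w t) = x"
proof -
  obtain y z where yz: "y \<in> circles D" "z \<in> circles D" "y \<noteq> z" "curve E y = x" "curve E z = x"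
    using assms unfolding crossings_def by blast
  obtain s where s: "0 \<le> s" "s < 1" "y = pt w s" using yz(1) by (rule circ_cases)
  obtain t where t: "0 \<le> t" "t < 1" "z = pt w t" using yz(2) by (rule circ_cases)
  show thesis by (rule that[of s t]) (use s t yz in auto)
qed

lemma arms_eq: "arm1 u = arm1 v \<longleftrightarrow> u = v" "arm2 u = arm2 v \<longleftrightarrow> u = v" "arm1 u = arm2 v \<Longrightarrow> u = 0"
proof -
  have "u = Re (straighten (arm1 u))" "u = Im (straighten (arm2 u))" for u by (simp_all add: straighten_arms)
  then show "arm1 u = arm1 v \<longleftrightarrow> u = v" "arm2 u = arm2 v \<longleftrightarrow> u = v" by metis+
  assume "arm1 u = arm2 v"
  then have "straighten (arm1 u) = straighten (arm2 v)" by simp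
  then have "complex_of_real u = \<i> * of_real v" unfolding straighten_arms .
  then show "u = 0" by (simp add: complex_eq_iff)
qed

lemma crossings_D: "crossings D \<inter> k ` rect (-2) 3 (-1) 4 = {k 0}"
proof
  show "{k 0} \<subseteq> crossings D \<inter> k ` rect (-2) 3 (-1) 4"
    using x0 by (auto simp: in_cbox_complex_iff intro!: imageI)
  show "crossings D \<inter> k ` rect (-2) 3 (-1) 4 \<subseteq> {k 0}"
  proof
    fix x assume x: "x \<in> crossings D \<inter> k ` rect (-2) 3 (-1) 4"
    then have xc: "x \<in> crossings D" by blast
    obtain s t where st: "0 \<le> s" "s < 1" "0 \<le> t" "t < 1" "s \<noteq> t" "curve D (pt w s) = x" "curve D (pt w t) = x"
      by (rule crossing_times[OF xc refl])
    have st': "s \<in> {a1..a2} \<union> {c1..c2}" "t \<in> {a1..a2} \<union> {c1..c2}"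
      using cover[of s] cover[of t] st x by auto
    have mixed: "x = k 0" if "u \<in> {a1..a2}" "v \<in> {c1..c2}" "curve D (pt w u) = x" "curve D (pt w v) = x" for u v
    proof -
      have "k (arm1 (f1 u)) = k (arm2 (f2 v))" using p1[OF that(1)] p2[OF that(2)] that by simp
      then have "arm1 (f1 u) = arm2 (f2 v)" using k_eq[OF arm_inQ(1)[OF that(1)] arm_inQ(2)[OF that(2)]] by simp
      then have "f1 u = 0" by (rule arms_eq(3))
      moreover have "arm1 0 = 0" by (simp add: arm1_def complex_eq_iff)
      ultimately show ?thesis using p1[OF that(1)] that(3) by simp
    qed
    have same1: "\<not> (s \<in> {a1..a2} \<and> t \<in> {a1..a2})"
    proof
      assume a: "s \<in> {a1..a2} \<and> t \<in> {a1..a2}"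
      then have "k (arm1 (f1 s)) = k (arm1 (f1 t))" using p1[of s] p1[of t] st by simp
      then have "f1 s = f1 t" using k_eq[OF arm_inQ(1) arm_inQ(1)] a arms_eq(1) by simp
      then show False using arc_timeD(4)[OF arc1, of s t] a st by simp
    qed
    have same2: "\<not> (s \<in> {c1..c2} \<and> t \<in> {c1..c2})"
    proof
      assume a: "s \<in> {c1..c2} \<and> t \<in> {c1..c2}"
      then have "k (arm2 (f2 s)) = k (arm2 (f2 t))" using p2[of s] p2[of t] st by simp
      then have "f2 s = f2 t" using k_eq[OF arm_inQ(2) arm_inQ(2)] a arms_eq(2) by simp
      then show False using arc_timeD(4)[OF arc2, of s t] a st by simp
    qed
    have "x = k 0" using st' same1 same2 mixed[of s t] mixed[of t s] st(6,7) by blast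
    then show "x \<in> {k 0}" by simp
  qed
qed

lemma crossings_D_B: "crossings D \<inter> k ` rect (-2) 3 (1/4) 4 = {}"
proof -
  have "k 0 \<notin> k ` rect (-2) 3 (1/4) 4"
  proof
    assume "k 0 \<in> k ` rect (-2) 3 (1/4) 4"
    moreover have "0 \<in> Q" using QB by (auto simp: in_cbox_complex_iff subset_iff)
    ultimately have "0 \<in> rect (-2) 3 (1/4) 4" using k_mem[OF R_big(3)] by blast
    then show False by (simp add: in_cbox_complex_iff)
  qed
  moreover have "crossings D \<inter> k ` rect (-2) 3 (1/4) 4 \<subseteq> {k 0}"
    unfolding crossings_D[symmetric] by (intro Int_mono subset_refl image_mono R_big(3))
  moreover have "X \<inter> Y = {}" if "a \<notin> Y" "X \<inter> Y \<subseteq> {a}" for X Y :: "complex set" and a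
    using that by blast
  ultimately show ?thesis by simp
qed

lemma new_arc_value:
  assumes "t \<in> {b1..b2} \<union> {d1..d2}"
  obtains s where "0 \<le> s" "s \<le> 1" "t \<in> {b1..b2}" "s = (t - b1) / (b2 - b1)" "p' t = k (inner s)"
    | s where "0 \<le> s" "s \<le> 1" "t \<in> {d1..d2}" "s = (t - d1) / (d2 - d1)" "p' t = k (outer s)"
  using assms
proof
  assume t: "t \<in> {b1..b2}"
  then show thesis using that(1)[of "(t - b1) / (b2 - b1)"] frac(1)[OF order(4), of t] p'_eq(2)[of t] by auto
next
  assume t: "t \<in> {d1..d2}"
  then show thesis using that(2)[of "(t - d1) / (d2 - d1)"] frac(1)[OF order(9), of t] p'_eq(4)[of t] by auto
qed

lemma smoothed_crossings_B: "crossings smoothed \<inter> B = {}"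
proof (rule ccontr)
  assume "crossings smoothed \<inter> B \<noteq> {}"
  then obtain x where x: "x \<in> crossings smoothed" "x \<in> B" by blast
  obtain s t where st: "0 \<le> s" "s < 1" "0 \<le> t" "t < 1" "s \<noteq> t" "curve smoothed (pt w s) = x" "curve smoothed (pt w t) = x"
    by (rule crossing_times[OF x(1) smoothed_simps(1)])
  have eq: "p' s = x" "p' t = x" using st smoothed_simps(4) by simp_all
  have mem: "s \<in> {b1..b2} \<union> {d1..d2}" "t \<in> {b1..b2} \<union> {d1..d2}"
    using p'_B(1)[of s] p'_B(1)[of t] eq x(2) st by simp_all
  have Rk: "k a = k b \<longleftrightarrow> a = b" if "a \<in> R" "b \<in> R" for a b using k_eq[of a b] that RQ by blast
  have d: "b2 - b1 > 0" "d2 - d1 > 0" using order by simp_all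
  show False
  proof (rule new_arc_value[OF mem(1)]; rule new_arc_value[OF mem(2)])
    fix u v assume u: "0 \<le> u" "u \<le> 1" "u = (s - b1) / (b2 - b1)" "p' s = k (inner u)"
      and v: "0 \<le> v" "v \<le> 1" "v = (t - b1) / (b2 - b1)" "p' t = k (inner v)"
    then have "u = v" using eq Rk[OF inner_R(1) inner_R(1)] inner_outer_inj by simp
    then show False using u(3) v(3) d st(5) by (simp add: field_simps)
  next
    fix u v assume u: "0 \<le> u" "u \<le> 1" "u = (s - d1) / (d2 - d1)" "p' s = k (outer u)"
      and v: "0 \<le> v" "v \<le> 1" "v = (t - d1) / (d2 - d1)" "p' t = k (outer v)"
    then have "u = v" using eq Rk[OF inner_R(3) inner_R(3)] inner_outer_inj by simp
    then show False using u(3) v(3) d st(5) by (simp add: field_simps)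
  next
    fix u v assume u: "0 \<le> u" "u \<le> 1" "p' s = k (inner u)" and v: "0 \<le> v" "v \<le> 1" "p' t = k (outer v)"
    then have "inner u = outer v" using eq Rk[OF inner_R(1) inner_R(3)] by simp
    then show False using inner_outer_disjoint u by blast
  next
    fix u v assume u: "0 \<le> u" "u \<le> 1" "p' s = k (outer u)" and v: "0 \<le> v" "v \<le> 1" "p' t = k (inner v)"
    then have "k (inner v) = k (outer u)" using eq by simp
    then have "inner v = outer u" using Rk[OF inner_R(1)[OF v(1,2)] inner_R(3)[OF u(1,2)]] by simp
    then show False using inner_outer_disjoint v by blast
  qed
qed

lemma smoothed_cont: "continuous_on (circles smoothed) (curve smoothed)"
  using loop_continuous[OF p'_cont p'_ends] by (simp add: smoothed_def circles_def)

lemma D_crossing_free_B: "crossings D \<inter> B = {}"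
proof -
  have "B \<subseteq> k ` rect (-2) 3 (1/4) 4" by (intro image_mono) (auto simp: in_cbox_complex_iff subset_iff)
  then show ?thesis using crossings_D_B by blast
qed

lemma overs_outside:
  assumes "z \<in> overs smoothed"
  shows "z \<in> circles smoothed" "curve smoothed z \<notin> B"
proof -
  obtain y where y: "y \<in> overs D" "z = pt w (flip (tm y))" using assms by (auto simp: smoothed_def)
  have yc: "y \<in> circles D" "curve D y \<in> crossings D" using y(1) virtual_link_diagramD(5)[OF vldD] by blast+
  then have yt: "pt w (tm y) = y" "0 \<le> tm y" "tm y < 1" using pt_tm by auto
  have "p (tm y) \<notin> B" using yc(2) D_crossing_free_B yt(1) by (auto simp: p_def)
  then have "tm y \<notin> {b1..b2} \<union> {d1..d2}" using p_B(1)[of "tm y"] yt by simp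
  then have "flip (tm y) \<notin> {b1..b2} \<union> {d1..d2}" using order by (auto simp: flip_def)
  moreover have f: "0 \<le> flip (tm y)" "flip (tm y) \<le> 1" using flip_bounds(1)[of "tm y"] yt by auto
  ultimately have "p' (flip (tm y)) \<notin> B" using p'_B(1) by blast
  then show "curve smoothed z \<notin> B" using smoothed_simps(4)[OF f] y(2) by simp
  show "z \<in> circles smoothed" using y(2) pt_circ smoothed_simps(1) by simp
qed

lemma smoothed_vld: "virtual_link_diagram smoothed"
proof (rule virtual_link_diagram_agree[OF vldD smoothed_agree closed_B smoothed_cont])
  show "crossings smoothed \<inter> B = virtuals smoothed \<inter> B"
    using smoothed_crossings_B D_crossing_free_B virtual_link_diagramD(4)[OF vldD] smoothed_simps(2) by blast
qed (use smoothed_crossings_B overs_outside in auto)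

definition legX :: "nat \<Rightarrow> real \<Rightarrow> real" where
  "legX j y = (if j = 0 then 2 * y - 2 else if j = 1 then 0 else if j = 2 then 2 * y else 2)"

lemma drawing_D:
  assumes z: "z \<in> rect (-2) 3 (-1) 4"
  shows "z \<in> drawing D k \<longleftrightarrow> (\<exists>u. -40 \<le> u \<and> u \<le> 40 \<and> z = arm1 u) \<or> (\<exists>u. -40 \<le> u \<and> u \<le> 40 \<and> z = arm2 u)"
proof
  assume "z \<in> drawing D k"
  then obtain y where "y \<in> circles D" "k z = curve D y" unfolding drawing_def by blast
  then obtain t where t: "0 \<le> t" "t < 1" "k z = curve D (pt w t)" using circ_cases by metis
  then have "t \<in> {a1..a2} \<union> {c1..c2}" using cover[of t] z by (metis imageI less_imp_le)
  then show "(\<exists>u. -40 \<le> u \<and> u \<le> 40 \<and> z = arm1 u) \<or> (\<exists>u. -40 \<le> u \<and> u \<le> 40 \<and> z = arm2 u)"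
  proof
    assume a: "t \<in> {a1..a2}"
    then have "z = arm1 (f1 t)" using p1[OF a] t(3) k_eq[OF _ arm_inQ(1)[OF a], of z] z QB by auto
    then show ?thesis using arc_timeD(8)[OF arc1 a] by blast
  next
    assume a: "t \<in> {c1..c2}"
    then have "z = arm2 (f2 t)" using p2[OF a] t(3) k_eq[OF _ arm_inQ(2)[OF a], of z] z QB by auto
    then show ?thesis using arc_timeD(8)[OF arc2 a] by blast
  qed
next
  assume "(\<exists>u. -40 \<le> u \<and> u \<le> 40 \<and> z = arm1 u) \<or> (\<exists>u. -40 \<le> u \<and> u \<le> 40 \<and> z = arm2 u)"
  then have "\<exists>t. k z = curve D (pt w t)"
  proof
    assume "\<exists>u. -40 \<le> u \<and> u \<le> 40 \<and> z = arm1 u"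
    then obtain u where u: "-40 \<le> u" "u \<le> 40" "z = arm1 u" by blast
    obtain t where "t \<in> {a1..a2}" "f1 t = u" using arc_timeD(9)[OF arc1 u(1,2)] by blast
    then show ?thesis using p1[of t] u(3) by (intro exI[of _ t]) simp
  next
    assume "\<exists>u. -40 \<le> u \<and> u \<le> 40 \<and> z = arm2 u"
    then obtain u where u: "-40 \<le> u" "u \<le> 40" "z = arm2 u" by blast
    obtain t where "t \<in> {c1..c2}" "f2 t = u" using arc_timeD(9)[OF arc2 u(1,2)] by blast
    then show ?thesis using p2[of t] u(3) by (intro exI[of _ t]) simp
  qed
  then show "z \<in> drawing D k" unfolding drawing_def using pt_circ by auto
qed

lemma UN_four: "(\<Union>j<2*2. F j) = F 0 \<union> F 1 \<union> F 2 \<union> F (3::nat)"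
  by (auto simp: numeral_eq_Suc lessThan_Suc)

lemma UN_two: "(\<Union>i<2. F i) = F 0 \<union> F (1::nat)"
  by (auto simp: numeral_eq_Suc lessThan_Suc)

lemma slab_D: "rect (-2) 3 (1/4) (1/2) \<inter> drawing D k = (\<Union>j<2*2. (\<lambda>y. Complex (legX j y) y) ` {1/4..1/2})"
proof
  show "rect (-2) 3 (1/4) (1/2) \<inter> drawing D k \<subseteq> (\<Union>j<2*2. (\<lambda>y. Complex (legX j y) y) ` {1/4..1/2})"
  proof
    fix z assume z: "z \<in> rect (-2) 3 (1/4) (1/2) \<inter> drawing D k"
    then have "z \<in> rect (-2) 3 (-1) 4" using R_big(4) by blast
    from drawing_D[OF this] z consider u where "z = arm1 u" | u where "z = arm2 u" by blast
    then have "\<exists>j\<in>{0,1,2,3}. Re z = legX j (Im z)"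
    proof cases
      case 1
      then show ?thesis using z by (auto simp: in_cbox_complex_iff arm1_def legX_def split: if_splits)
    next
      case 2
      then show ?thesis using z by (auto simp: in_cbox_complex_iff arm2_def legX_def split: if_splits)
    qed
    then obtain j where j: "j \<in> {0,1,2,3}" "Re z = legX j (Im z)" by blast
    then have "z = Complex (legX j (Im z)) (Im z)" by (simp add: complex_eq_iff)
    moreover have "Im z \<in> {1/4..1/2}" using z by (auto simp: in_cbox_complex_iff)
    ultimately have "z \<in> (\<lambda>y. Complex (legX j y) y) ` {1/4..1/2}" by blast
    then show "z \<in> (\<Union>j<2*2. (\<lambda>y. Complex (legX j y) y) ` {1/4..1/2})" unfolding UN_four using j(1) by blast
  qed
  show "(\<Union>j<2*2. (\<lambda>y. Complex (legX j y) y) ` {1/4..1/2}) \<subseteq> rect (-2) 3 (1/4) (1/2) \<inter> drawing D k"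
  proof
    fix z assume "z \<in> (\<Union>j<2*2. (\<lambda>y. Complex (legX j y) y) ` {1/4..1/2})"
    then have "\<exists>j\<in>{0,1,2,3}. z \<in> (\<lambda>y. Complex (legX j y) y) ` {1/4..1/2}" unfolding UN_four by blast
    then obtain j where j1: "j \<in> {0,1,2,3}" and "z \<in> (\<lambda>y. Complex (legX j y) y) ` {1/4..1/2}" by blast
    then obtain y where "z = Complex (legX j y) y" and y: "1/4 \<le> y" "y \<le> 1/2" by (elim imageE) simp
    with j1 have j: "j \<in> {0,1,2,3}" "z = Complex (legX j y) y" by simp_all
    have R: "z \<in> rect (-2) 3 (1/4) (1/2)" using j y by (auto simp: in_cbox_complex_iff legX_def)
    have "(\<exists>u. -40 \<le> u \<and> u \<le> 40 \<and> z = arm1 u) \<or> (\<exists>u. -40 \<le> u \<and> u \<le> 40 \<and> z = arm2 u)"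
    proof -
      consider "j = 0" | "j = 1" | "j = 2" | "j = 3" using j(1) by auto
      then show ?thesis
      proof cases
        case 1
        then have "z = arm2 (2 - y)" using j(2) y by (simp add: legX_def arm2_def)
        then show ?thesis using y by (intro disjI2 exI[of _ "2 - y"]) simp
      next
        case 2
        then have "z = arm2 y" using j(2) y by (simp add: legX_def arm2_def)
        then show ?thesis using y by (intro disjI2 exI[of _ y]) simp
      next
        case 3
        then have "z = arm1 y" using j(2) y by (simp add: legX_def arm1_def)
        then show ?thesis using y by (intro disjI1 exI[of _ y]) simp
      next
        case 4
        then have "z = arm1 (2 - y)" using j(2) y by (simp add: legX_def arm1_def)
        then show ?thesis using y by (intro disjI1 exI[of _ "2 - y"]) simp
      qed
    qed
    then show "z \<in> rect (-2) 3 (1/4) (1/2) \<inter> drawing D k" using R drawing_D R_big(4) by blast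
  qed
qed

definition cup :: "nat \<Rightarrow> real \<Rightarrow> complex" where
  "cup i s = (if i = 0 then Complex (min (2 * s - 1) 0) (1 - \<bar>s - 1/2\<bar>) else Complex (min (1 + 2 * s) 2) (1 - \<bar>s - 1/2\<bar>))"

lemma cup_arm: "0 \<le> s \<Longrightarrow> s \<le> 1 \<Longrightarrow> cup 0 s = arm2 (3/2 - s)" "0 \<le> s \<Longrightarrow> s \<le> 1 \<Longrightarrow> cup 1 s = arm1 (1/2 + s)"
  by (auto simp: cup_def arm1_def arm2_def min_def abs_if)

lemma arc_graph:
  fixes x y :: "real \<Rightarrow> real"
  assumes "continuous_on {0..1} x" "continuous_on {0..1} y"
    and "\<And>s t. 0 \<le> s \<Longrightarrow> s \<le> 1 \<Longrightarrow> 0 \<le> t \<Longrightarrow> t \<le> 1 \<Longrightarrow> x s = x t \<Longrightarrow> y s = y t \<Longrightarrow> s = t"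
  shows "arc (\<lambda>s. Complex (x s) (y s))"
  unfolding arc_def path_def
proof
  show "continuous_on {0..1} (\<lambda>s. Complex (x s) (y s))" using assms(1,2) by (intro continuous_intros)
  show "inj_on (\<lambda>s. Complex (x s) (y s)) {0..1}" by (rule inj_onI) (use assms(3) in auto)
qed

lemma cups_D: "cups (drawing D k) (-2) 3 (1/2) 4 2 (\<lambda>j. legX j (1/2)) pairs_before cup"
  unfolding cups_def
proof (intro conjI allI impI)
  fix i :: nat assume i: "i < 2"
  show "arc (cup i)"
  proof (cases "i = 0")
    case True
    have "arc (\<lambda>s. Complex (min (2 * s - 1) 0) (1 - \<bar>s - 1/2\<bar>))"
    proof (rule arc_graph)
      fix s t :: real assume "1 - \<bar>s - 1/2\<bar> = 1 - \<bar>t - 1/2\<bar>" "min (2 * s - 1) 0 = min (2 * t - 1) 0"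
      then show "s = t" by (auto simp: min_def abs_if split: if_splits)
    qed (intro continuous_intros)+
    then show ?thesis using True unfolding cup_def[abs_def] by simp
  next
    case False
    have "arc (\<lambda>s. Complex (min (1 + 2 * s) 2) (1 - \<bar>s - 1/2\<bar>))"
    proof (rule arc_graph)
      fix s t :: real assume "1 - \<bar>s - 1/2\<bar> = 1 - \<bar>t - 1/2\<bar>" "min (1 + 2 * s) 2 = min (1 + 2 * t) 2"
      then show "s = t" by (auto simp: min_def abs_if split: if_splits)
    qed (intro continuous_intros)+
    then show ?thesis using False unfolding cup_def[abs_def] by simp
  qed
  have i': "i = 0 \<or> i = 1" using i by auto
  then show "pathstart (cup i) = Complex (legX (fst (pairs_before i)) (1/2)) (1/2)"
    by (auto simp: pathstart_def cup_def pairs_before_def legX_def)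
  show "pathfinish (cup i) = Complex (legX (snd (pairs_before i)) (1/2)) (1/2)"
    using i' by (auto simp: pathfinish_def cup_def pairs_before_def legX_def)
  show "cup i u \<in> open_rect (-2) 3 (1/2) 4" if "0 < u" "u < 1" for u
    using that by (auto simp: cup_def in_box_complex_iff abs_if)
  have disj: "path_image (cup 0) \<inter> path_image (cup 1) = {}"
    by (auto simp: path_image_def cup_def min_def split: if_splits)
  show "path_image (cup i) \<inter> path_image (cup j) = {}" if "j < 2" "i \<noteq> j" for j
  proof -
    have "i = 0 \<and> j = 1 \<or> i = 1 \<and> j = 0" using i that by auto
    then show ?thesis using disj by auto
  qed
next
  have 0: "path_image (cup 0) = arm2 ` {1/2..3/2}"
  proof -
    have "(\<lambda>s. 3/2 - s) ` {0..1} = {1/2..3/2::real}" by (simp add: image_diff_atLeastAtMost)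
    moreover have "cup 0 ` {0..1} = arm2 ` (\<lambda>s. 3/2 - s) ` {0..1}"
      unfolding image_image by (rule image_cong) (simp_all add: cup_arm(1))
    ultimately show ?thesis by (simp add: path_image_def)
  qed
  have 1: "path_image (cup 1) = arm1 ` {1/2..3/2}"
  proof -
    have "(\<lambda>s. 1/2 + s) ` {0..1} = {1/2..3/2::real}" by (simp add: image_add_atLeastAtMost)
    moreover have "cup 1 ` {0..1} = arm1 ` (\<lambda>s. 1/2 + s) ` {0..1}"
      unfolding image_image by (rule image_cong[OF refl]) (rule cup_arm(2); simp)
    ultimately show ?thesis by (simp add: path_image_def)
  qed
  show "R \<inter> drawing D k = (\<Union>i<2. path_image (cup i))"
    unfolding UN_two 0 1
  proof
    show "R \<inter> drawing D k \<subseteq> arm2 ` {1/2..3/2} \<union> arm1 ` {1/2..3/2}"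
    proof
      fix z assume z: "z \<in> R \<inter> drawing D k"
      then have "z \<in> rect (-2) 3 (-1) 4" using R_big(1) by blast
      from drawing_D[OF this] z consider u where "z = arm1 u" | u where "z = arm2 u" by blast
      then show "z \<in> arm2 ` {1/2..3/2} \<union> arm1 ` {1/2..3/2}"
      proof cases
        case 1 then show ?thesis using z arm_R(1)[of u] by auto
      next
        case 2 then show ?thesis using z arm_R(2)[of u] by auto
      qed
    qed
    show "arm2 ` {1/2..3/2} \<union> arm1 ` {1/2..3/2} \<subseteq> R \<inter> drawing D k"
    proof
      fix z assume "z \<in> arm2 ` {1/2..3/2} \<union> arm1 ` {1/2..3/2}"
      then obtain u where u: "1/2 \<le> u" "u \<le> 3/2" "z = arm1 u \<or> z = arm2 u" by auto
      then have "z \<in> R" using arm_R by blast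
      moreover have "-40 \<le> u" "u \<le> 40" using u by simp_all
      ultimately show "z \<in> R \<inter> drawing D k" using drawing_D[of z] R_big(1) u(3) by blast
    qed
  qed
qed

definition newcup :: "nat \<Rightarrow> real \<Rightarrow> complex" where
  "newcup i s = (if i = 0 then inner (1 - s) else outer s)"

lemma upper_smoothed: "R \<inter> drawing smoothed k = inner ` {0..1} \<union> outer ` {0..1}"
proof
  show "R \<inter> drawing smoothed k \<subseteq> inner ` {0..1} \<union> outer ` {0..1}"
  proof
    fix z assume z: "z \<in> R \<inter> drawing smoothed k"
    then obtain y where "y \<in> circles D" "k z = curve smoothed y" unfolding drawing_def smoothed_simps by blast
    then obtain t where t: "0 \<le> t" "t < 1" "k z = curve smoothed (pt w t)" using circ_cases by metis
    then have kz: "k z = p' t" using smoothed_simps(4) by simp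
    have "k z \<in> B" using z by blast
    then have t': "t \<in> {b1..b2} \<union> {d1..d2}" using p'_B(1)[of t] kz t by simp
    have Rk: "k a = k b \<longleftrightarrow> a = b" if "a \<in> R" "b \<in> R" for a b using k_eq[of a b] that RQ by blast
    show "z \<in> inner ` {0..1} \<union> outer ` {0..1}"
    proof (rule new_arc_value[OF t'])
      fix s assume s: "0 \<le> s" "s \<le> 1" "p' t = k (inner s)"
      then have "z = inner s" using kz Rk[OF _ inner_R(1)[OF s(1,2)]] z by simp
      then show ?thesis using s by auto
    next
      fix s assume s: "0 \<le> s" "s \<le> 1" "p' t = k (outer s)"
      then have "z = outer s" using kz Rk[OF _ inner_R(3)[OF s(1,2)]] z by simp
      then show ?thesis using s by auto
    qed
  qed
  have hit: "z \<in> drawing smoothed k" if "k z = p' t" "0 \<le> t" "t \<le> 1" for z t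
    unfolding drawing_def smoothed_simps using smoothed_simps(4)[of t] that pt_circ by (metis image_eqI vimageI)
  show "inner ` {0..1} \<union> outer ` {0..1} \<subseteq> R \<inter> drawing smoothed k"
  proof (intro Un_least image_subsetI IntI)
    fix s :: real assume "s \<in> {0..1}"
    then have s: "0 \<le> s" "s \<le> 1" by auto
    show "inner s \<in> R" "outer s \<in> R" using inner_R(1,3)[OF s] .
    have pos: "0 < b2 - b1" "0 < d2 - d1" using order by simp_all
    have "0 \<le> s * (b2 - b1)" "s * (b2 - b1) \<le> b2 - b1" "0 \<le> s * (d2 - d1)" "s * (d2 - d1) \<le> d2 - d1"
      using s pos by (simp_all add: mult_left_le_one_le)
    then have "b1 \<le> b1 + s * (b2 - b1)" "b1 + s * (b2 - b1) \<le> b2" "d1 \<le> d1 + s * (d2 - d1)" "d1 + s * (d2 - d1) \<le> d2"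
      by linarith+
    then show "inner s \<in> drawing smoothed k" "outer s \<in> drawing smoothed k"
      using hit[of "inner s" "b1 + s * (b2 - b1)"] hit[of "outer s" "d1 + s * (d2 - d1)"] order pos
      by (simp_all add: p'_eq)
  qed
qed

lemma cups_smoothed: "cups (drawing smoothed k) (-2) 3 (1/2) 4 2 (\<lambda>j. legX j (1/2)) (pairs_after 2) newcup"
  unfolding cups_def
proof (intro conjI allI impI)
  fix i :: nat assume i: "i < 2"
  show "arc (newcup i)"
  proof (cases "i = 0")
    case True
    have "arc (\<lambda>s. Complex (1 - (1 - s)) (1 - \<bar>1 - s - 1/2\<bar>))"
      by (rule arc_graph) (auto intro!: continuous_intros)
    then show ?thesis using True unfolding newcup_def[abs_def] inner_def[abs_def] by simp
  next
    case False
    have "arc (\<lambda>s. Complex (2 - 3 * s) (3 - 5 * \<bar>s - 1/2\<bar>))"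
      by (rule arc_graph) (auto intro!: continuous_intros)
    then show ?thesis using False unfolding newcup_def[abs_def] outer_def[abs_def] by simp
  qed
  have i': "i = 0 \<or> i = 1" using i by auto
  then show "pathstart (newcup i) = Complex (legX (fst (pairs_after 2 i)) (1/2)) (1/2)"
    by (auto simp: pathstart_def newcup_def inner_outer_ends pairs_after_def legX_def)
  show "pathfinish (newcup i) = Complex (legX (snd (pairs_after 2 i)) (1/2)) (1/2)"
    using i' by (auto simp: pathfinish_def newcup_def inner_outer_ends pairs_after_def legX_def)
  show "newcup i u \<in> open_rect (-2) 3 (1/2) 4" if "0 < u" "u < 1" for u
    using that inner_R(2)[of "1 - u"] inner_R(4)[of u] by (simp add: newcup_def)
  have disj: "path_image (newcup 0) \<inter> path_image (newcup 1) = {}"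
  proof -
    have "newcup 0 s \<noteq> newcup 1 t" if "0 \<le> s" "s \<le> 1" for s t
      using inner_outer_disjoint[of "1 - s" t] that by (simp add: newcup_def)
    then show ?thesis by (force simp: path_image_def)
  qed
  show "path_image (newcup i) \<inter> path_image (newcup j) = {}" if "j < 2" "i \<noteq> j" for j
  proof -
    have "i = 0 \<and> j = 1 \<or> i = 1 \<and> j = 0" using i that by auto
    then show ?thesis using disj by auto
  qed
next
  have "path_image (newcup 0) = inner ` {0..1}"
  proof -
    have "(\<lambda>s. 1 - s) ` {0..1} = {0..1::real}" by (simp add: image_diff_atLeastAtMost)
    moreover have "newcup 0 ` {0..1} = inner ` (\<lambda>s. 1 - s) ` {0..1}"
      unfolding image_image by (rule image_cong) (simp_all add: newcup_def)
    ultimately show ?thesis by (simp add: path_image_def)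
  qed
  moreover have "path_image (newcup 1) = outer ` {0..1}"
    unfolding path_image_def by (rule image_cong) (simp_all add: newcup_def)
  ultimately show "R \<inter> drawing smoothed k = (\<Union>i<2. path_image (newcup i))"
    unfolding UN_two upper_smoothed by simp
qed

lemma slab_smoothed: "rect (-2) 3 (1/4) (1/2) \<inter> drawing smoothed k = rect (-2) 3 (1/4) (1/2) \<inter> drawing D k"
proof -
  have "z \<in> drawing smoothed k \<longleftrightarrow> z \<in> drawing D k" if z: "z \<in> rect (-2) 3 (1/4) (1/2)" for z
  proof -
    have "z \<notin> open_rect (-2) 3 (1/2) 4" using z by (auto simp: in_cbox_complex_iff in_box_complex_iff)
    then have "k z \<notin> interior B" unfolding int_B using k_mem[OF R_big(2), of z] z R_big(4) QB by blast
    then show ?thesis unfolding drawing_def using agree_outside_image[OF smoothed_agree] by blast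
  qed
  then show ?thesis by blast
qed

lemma smoothed_crossings: "crossings smoothed = crossings D"
proof -
  have "crossings smoothed - interior B = crossings D - interior B" by (rule agree_outside_crossings[OF smoothed_agree])
  moreover have "interior B \<subseteq> B" by (rule interior_subset)
  ultimately show ?thesis using smoothed_crossings_B D_crossing_free_B by blast
qed

text \<open>
  The reconnection is an \<open>H(2)\<close>-move with the collar that the kinks need.
\<close>

theorem H_config_smoothed: "H_config 2 D smoothed Q k (-2) 3 (1/4) (1/2) 4 legX 0 (1/4)"
  unfolding H_config_def
proof (intro conjI)
  show "virtual_link_diagram D" "virtual_link_diagram smoothed" "ncomp smoothed = ncomp D" "plane_chart Q k"
    using vldD smoothed_vld smoothed_simps(3) one chartQ by simp_all
  show "rect (-2) 3 (1/4) 4 \<subseteq> Q" using R_big(3) QB by blast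
  show "legs (-2) 3 (1/4) (1/2) 2 legX"
    unfolding legs_def
  proof (intro conjI allI impI ballI)
    fix j show "continuous_on {1/4..1/2} (legX j)" unfolding legX_def[abs_def]
      by (cases "j = 0"; cases "j = 1"; cases "j = 2") (auto intro!: continuous_intros)
    fix y :: real assume "y \<in> {1/4..1/2}"
    then show "-2 < legX j y" "legX j y < 3" by (auto simp: legX_def)
  next
    fix i j :: nat and y :: real assume ij: "i < j" "j < 2 * 2" and y: "y \<in> {1/4..1/2}"
    then have "j = 1 \<or> j = 2 \<or> j = 3" by auto
    then show "legX i y < legX j y" using ij y by (auto simp: legX_def)
  qed
  show "\<forall>y\<in>{1/4..1/2}. legX 1 y = 0" by (simp add: legX_def)
  show "\<forall>j<2 * 2. j \<noteq> 1 \<longrightarrow> (\<forall>y\<in>{1/4..1/2}. 1/4 < \<bar>legX j y - 0\<bar>)" by (auto simp: legX_def abs_if)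
  show "plat D k (-2) 3 (1/4) (1/2) 4 2 legX pairs_before"
    unfolding plat_def using crossings_D_B slab_D cups_D by blast
  show "plat smoothed k (-2) 3 (1/4) (1/2) 4 2 legX (pairs_after 2)"
    unfolding plat_def smoothed_crossings slab_smoothed using crossings_D_B slab_D cups_smoothed by blast
  show "agree_outside (k ` rect (-2) 3 (1/2) 4) D smoothed" by (rule smoothed_agree)
qed simp_all

end

section \<open>Removing the remaining kink\<close>

context crossing_chart
begin

text \<open>
  In the reconnected diagram the second passage is traversed backwards, so it leaves the disk of the R1-move at
  the reflected time.
\<close>

definition te :: real where "te = b2 + d1 - s0"

lemma te_order: "b2 < te" "te < d1" using order by (simp_all add: te_def)

text \<open>
  This square contains the crossing and the loop closed up by the inner arc, but nothing of the outer arc.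
\<close>

abbreviation "T \<equiv> rect (- (1/4)) (5/4) (- (1/4)) (5/4)"
abbreviation "T_open \<equiv> open_rect (- (1/4)) (5/4) (- (1/4)) (5/4)"

lemma T_big: "T \<subseteq> rect (-2) 3 (-1) 4" "T_open \<subseteq> rect (-2) 3 (-1) 4" "T_open \<subseteq> T"
  by (auto simp: in_cbox_complex_iff in_box_complex_iff subset_iff)

lemma TQ: "T \<subseteq> Q" using T_big QB by blast

lemma int_T: "interior (k ` T) = k ` T_open"
  using plane_chart_interior[OF chartQ TQ] by (simp add: interior_cbox)

lemma closed_T: "closed (k ` T)"
  using plane_chart_compact[OF chartQ TQ] by (simp add: compact_imp_closed)

lemma arm_T: "arm1 u \<in> T \<longleftrightarrow> -1/8 \<le> u \<and> u \<le> 5/8" "arm2 u \<in> T \<longleftrightarrow> -1/4 \<le> u \<and> u \<le> 9/8"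
  "arm1 u \<in> T_open \<longleftrightarrow> -1/8 < u \<and> u < 5/8" "arm2 u \<in> T_open \<longleftrightarrow> -1/4 < u \<and> u < 9/8"
  by (auto simp: arm1_def arm2_def in_cbox_complex_iff in_box_complex_iff)

lemma inner_T: "0 \<le> s \<Longrightarrow> s \<le> 1 \<Longrightarrow> inner s \<in> T_open"
  by (auto simp: inner_def in_box_complex_iff abs_if)

lemma outer_T: "outer s \<notin> T"
  by (auto simp: outer_def in_cbox_complex_iff abs_if)

lemma p'_T:
  assumes t: "0 \<le> t" "t \<le> 1"
  shows "p' t \<in> k ` T \<longleftrightarrow> a0 \<le> t \<and> t \<le> te" "p' t \<in> k ` T_open \<longleftrightarrow> a0 < t \<and> t < te"
proof -
  have A: "p u \<in> k ` T \<longleftrightarrow> a0 \<le> u" "p u \<in> k ` T_open \<longleftrightarrow> a0 < u" if u: "0 \<le> u" "u \<le> b1" for u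
  proof -
    have u1: "u \<le> 1" using u order by simp
    have c: "u \<notin> {c1..c2}" using u order by auto
    have e: "f1 u \<le> 1/2" "-1/8 \<le> f1 u \<longleftrightarrow> a0 \<le> u" "-1/8 < f1 u \<longleftrightarrow> a0 < u" if "u \<in> {a1..a2}"
      using f1_le[OF that b1(1)] f1_le[OF a0(1) that] f1_less[OF a0(1) that] u a0(2) b1(2) by simp_all
    have m: "a0 \<le> u \<Longrightarrow> u \<in> {a1..a2}" using u order by auto
    show "p u \<in> k ` T \<longleftrightarrow> a0 \<le> u" unfolding p_in[OF T_big(1) u(1) u1] arm_T using c e m by auto
    show "p u \<in> k ` T_open \<longleftrightarrow> a0 < u" unfolding p_in[OF T_big(2) u(1) u1] arm_T using c e m by auto
  qed
  have M: "p u \<in> k ` T \<longleftrightarrow> s0 \<le> u" "p u \<in> k ` T_open \<longleftrightarrow> s0 < u" if u: "b2 \<le> u" "u \<le> d1" for u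
  proof -
    have u1: "0 \<le> u" "u \<le> 1" using u order by simp_all
    have e: "3/2 \<le> f1 u" if "u \<in> {a1..a2}" using f1_le[OF b2(1) that] u b2(2) by simp
    have f: "f2 u \<le> 1/2" "-1/4 \<le> f2 u \<longleftrightarrow> s0 \<le> u" "-1/4 < f2 u \<longleftrightarrow> s0 < u" if "u \<in> {c1..c2}"
      using f2_le[OF that d1(1)] f2_le[OF s0(1) that] f2_less[OF s0(1) that] u s0(2) d1(2) by simp_all
    have m: "s0 \<le> u \<Longrightarrow> u \<in> {c1..c2}" using u order by auto
    show "p u \<in> k ` T \<longleftrightarrow> s0 \<le> u" unfolding p_in[OF T_big(1) u1] arm_T using e f m by fastforce
    show "p u \<in> k ` T_open \<longleftrightarrow> s0 < u" unfolding p_in[OF T_big(2) u1] arm_T using e f m by fastforce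
  qed
  have Z: "p u \<notin> k ` T" "p u \<notin> k ` T_open" if u: "d2 \<le> u" "u \<le> 1" for u
  proof -
    have u1: "0 \<le> u" using u order by simp
    have a: "u \<notin> {a1..a2}" using u order by auto
    have e: "3/2 \<le> f2 u" if "u \<in> {c1..c2}" using f2_le[OF d2(1) that] u d2(2) by simp
    show "p u \<notin> k ` T" unfolding p_in[OF T_big(1) u1 u(2)] arm_T using a e by fastforce
    show "p u \<notin> k ` T_open" unfolding p_in[OF T_big(2) u1 u(2)] arm_T using a e by fastforce
  qed
  have "(p' t \<in> k ` T \<longleftrightarrow> a0 \<le> t \<and> t \<le> te) \<and> (p' t \<in> k ` T_open \<longleftrightarrow> a0 < t \<and> t < te)"
  proof -
    consider "t \<le> b1" | "b1 < t" "t < b2" | "b2 \<le> t" "t \<le> d1" | "d1 < t" "t < d2" | "d2 \<le> t" by linarith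
    then show ?thesis
    proof cases
      case 1
      then show ?thesis using A[OF t(1) 1] order te_order by (auto simp: p'_eq)
    next
      case 2
      then have "inner ((t - b1) / (b2 - b1)) \<in> T_open" using frac(2)[of b1 b2 t] by (intro inner_T) auto
      then have "p' t \<in> k ` T_open" "p' t \<in> k ` T" using 2 T_big(3) by (auto simp: p'_eq)
      then show ?thesis using 2 order te_order by auto
    next
      case 3
      have "b2 \<le> b2 + d1 - t" "b2 + d1 - t \<le> d1" using 3 by simp_all
      from M[OF this] have "p' t \<in> k ` T \<longleftrightarrow> s0 \<le> b2 + d1 - t" "p' t \<in> k ` T_open \<longleftrightarrow> s0 < b2 + d1 - t"
        using 3 by (simp_all add: p'_eq)
      then show ?thesis using 3 order unfolding te_def by auto
    next
      case 4
      define s where "s = (t - d1) / (d2 - d1)"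
      have pt: "p' t = k (outer s)" using 4 by (simp add: p'_eq s_def)
      have s: "0 \<le> s" "s \<le> 1" using frac(2)[OF order(9) 4] by (auto simp: s_def)
      have q: "outer s \<in> Q" using inner_R(3)[OF s] RQ by blast
      have "p' t \<notin> k ` T" "p' t \<notin> k ` T_open"
        using k_mem[OF T_big(1) q] k_mem[OF T_big(2) q] outer_T[of s] T_big(3) unfolding pt by blast+
      then show ?thesis using 4 te_order by auto
    next
      case 5
      then show ?thesis using Z[OF 5 t(2)] te_order order by (auto simp: p'_eq)
    qed
  qed
  then show "p' t \<in> k ` T \<longleftrightarrow> a0 \<le> t \<and> t \<le> te" "p' t \<in> k ` T_open \<longleftrightarrow> a0 < t \<and> t < te" by blast+
qed

definition chord :: "real \<Rightarrow> complex" where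
  "chord s = Complex (- (1 - s) / 4) (- (1 + s) / 8)"

lemma chord_T: "0 \<le> s \<Longrightarrow> s \<le> 1 \<Longrightarrow> chord s \<in> T" "0 < s \<Longrightarrow> s < 1 \<Longrightarrow> chord s \<in> T_open"
  "chord 0 \<notin> T_open" "chord 1 \<notin> T_open" "chord s = chord u \<longleftrightarrow> s = u"
  by (auto simp: chord_def in_cbox_complex_iff in_box_complex_iff)

lemma chord_ends: "p' a0 = k (chord 0)" "p' te = k (chord 1)"
proof -
  show "p' a0 = k (chord 0)"
    using p1[OF a0(1)] a0(2) order by (simp add: p'_eq p_def arm1_def chord_def)
  have "p' te = p s0" using te_order by (simp add: p'_eq te_def)
  then show "p' te = k (chord 1)" using p2[OF s0(1)] s0(2) by (simp add: p_def arm2_def chord_def)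
qed

definition p'' :: "real \<Rightarrow> complex" where
  "p'' t = (if a0 \<le> t \<and> t \<le> te then k (chord ((t - a0) / (te - a0))) else p' t)"

lemma a0_te: "0 < a0" "a0 < te" "te < 1" using order te_order by linarith+

lemma p''_eq: "a0 \<le> t \<Longrightarrow> t \<le> te \<Longrightarrow> p'' t = k (chord ((t - a0) / (te - a0)))"
  "t \<le> a0 \<or> te \<le> t \<Longrightarrow> p'' t = p' t"
  using chord_ends a0_te by (auto simp: p''_def)

lemma p''_ends: "p'' 0 = p'' 1" using p''_eq(2)[of 0] p''_eq(2)[of 1] a0_te p'_ends by simp

lemma p''_cont: "continuous_on {0..1} p''"
proof -
  have 1: "continuous_on {0..a0} p''"
    by (rule continuous_on_eq[OF continuous_on_subset[OF p'_cont]]) (use a0_te p''_eq(2) in auto)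
  have c: "continuous_on UNIV chord" unfolding chord_def[abs_def] by (intro continuous_intros) auto
  have "continuous_on {a0..te} (\<lambda>t. (t - a0) / (te - a0))" using a0_te by (intro continuous_intros) auto
  then have "continuous_on {a0..te} (\<lambda>t. chord ((t - a0) / (te - a0)))" by (rule continuous_on_compose2[OF c]) simp
  then have "continuous_on {a0..te} (\<lambda>t. k (chord ((t - a0) / (te - a0))))"
  proof (rule continuous_on_compose2[OF k_cont])
    show "(\<lambda>t. chord ((t - a0) / (te - a0))) ` {a0..te} \<subseteq> Q"
    proof (rule image_subsetI)
      fix t assume "t \<in> {a0..te}"
      then have "chord ((t - a0) / (te - a0)) \<in> T" using frac(1)[OF a0_te(2), of t] by (intro chord_T(1)) auto
      then show "chord ((t - a0) / (te - a0)) \<in> Q" using TQ by blast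
    qed
  qed
  then have 2: "continuous_on {a0..te} p''" by (rule continuous_on_eq) (simp add: p''_eq)
  have 3: "continuous_on {te..1} p''"
    by (rule continuous_on_eq[OF continuous_on_subset[OF p'_cont]]) (use a0_te p''_eq(2) in auto)
  have "{0..1} = {0..a0} \<union> {a0..te} \<union> {te..1}" using a0_te by auto
  moreover have "continuous_on ({0..a0} \<union> {a0..te} \<union> {te..1}) p''"
    by (intro continuous_on_closed_Un closed_Un closed_atLeastAtMost 1 2 3)
  ultimately show ?thesis by simp
qed

lemma p''_T:
  assumes t: "0 \<le> t" "t \<le> 1"
  shows "p'' t \<in> k ` T \<longleftrightarrow> a0 \<le> t \<and> t \<le> te" "p'' t \<in> k ` T_open \<longleftrightarrow> a0 < t \<and> t < te"
proof -
  have "(p'' t \<in> k ` T \<longleftrightarrow> a0 \<le> t \<and> t \<le> te) \<and> (p'' t \<in> k ` T_open \<longleftrightarrow> a0 < t \<and> t < te)"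
  proof (cases "a0 < t \<and> t < te")
    case True
    then have "chord ((t - a0) / (te - a0)) \<in> T_open" using frac(2)[of a0 te t] by (intro chord_T(2)) auto
    then have "p'' t \<in> k ` T_open" using True by (auto simp: p''_eq)
    then show ?thesis using True T_big(3) by (auto intro: imageI)
  next
    case False
    then have "p'' t = p' t" using p''_eq(2)[of t] by linarith
    then show ?thesis using p'_T[OF t] by simp
  qed
  then show "p'' t \<in> k ` T \<longleftrightarrow> a0 \<le> t \<and> t \<le> te" "p'' t \<in> k ` T_open \<longleftrightarrow> a0 < t \<and> t < te" by blast+
qed

text \<open>
  The loop is cut off by a chord of the square.
\<close>

definition reduced :: diagram where
  "reduced = D\<lparr>curve := (\<lambda>z. p'' (tm z)), virtuals := virtuals D - {k 0}, overs := {z \<in> overs smoothed. curve smoothed z \<noteq> k 0}\<rparr>"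

lemma reduced_simps: "circles reduced = circles D" "virtuals reduced = virtuals D - {k 0}" "ncomp reduced = 1"
  "overs reduced = {z \<in> overs smoothed. curve smoothed z \<noteq> k 0}"
  "0 \<le> t \<Longrightarrow> t \<le> 1 \<Longrightarrow> curve reduced (pt w t) = p'' t"
  using one by (simp_all add: reduced_def circles_def loop_tm p''_ends)

lemma k0_T: "k 0 \<in> k ` T_open"
  by (rule imageI) (simp add: in_box_complex_iff)

lemma smoothed_crossings_T: "crossings smoothed \<inter> k ` T = {k 0}"
proof
  show "crossings smoothed \<inter> k ` T \<subseteq> {k 0}"
    unfolding crossings_D[symmetric] smoothed_crossings by (intro Int_mono subset_refl image_mono T_big(1))
  show "{k 0} \<subseteq> crossings smoothed \<inter> k ` T"
    using x0 k0_T T_big(3) unfolding smoothed_crossings by blast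
qed

lemma smoothed_cases:
  assumes "z \<in> circles D"
  obtains t where "0 \<le> t" "t \<le> 1" "z = pt w t" "curve smoothed z = p' t" "curve reduced z = p'' t"
proof -
  obtain t where t: "0 \<le> t" "t < 1" "z = pt w t" using assms by (rule circ_cases)
  then show thesis using that[of t] smoothed_simps(4)[of t] reduced_simps(5)[of t] by simp
qed

lemma reduced_agree: "agree_outside (k ` T) smoothed reduced"
proof (rule agree_outside_same_parameters)
  show "circles reduced = circles smoothed" by (simp add: reduced_simps smoothed_simps)
  show "virtuals reduced - interior (k ` T) = virtuals smoothed - interior (k ` T)"
    using k0_T unfolding int_T reduced_simps smoothed_simps by blast
  fix z assume "z \<in> circles smoothed"
  then have "z \<in> circles D" by (simp add: smoothed_simps)
  then obtain t where t: "0 \<le> t" "t \<le> 1" "z = pt w t" "curve smoothed z = p' t" "curve reduced z = p'' t"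
    by (rule smoothed_cases)
  show "curve smoothed z \<notin> interior (k ` T) \<longleftrightarrow> curve reduced z \<notin> interior (k ` T)"
    unfolding int_T t(4,5) p'_T(2)[OF t(1,2)] p''_T(2)[OF t(1,2)] ..
  assume o: "curve smoothed z \<notin> interior (k ` T)"
  then have "\<not> (a0 < t \<and> t < te)" unfolding int_T t(4) p'_T(2)[OF t(1,2)] .
  then show "curve reduced z = curve smoothed z" unfolding t(4,5) using p''_eq(2)[of t] by linarith
  show "z \<in> overs reduced \<longleftrightarrow> z \<in> overs smoothed"
    unfolding reduced_simps using o k0_T int_T by auto
qed

lemma reduced_crossings_T: "crossings reduced \<inter> k ` T = {}"
proof (rule ccontr)
  assume "crossings reduced \<inter> k ` T \<noteq> {}"
  then obtain x where x: "x \<in> crossings reduced" "x \<in> k ` T" by blast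
  obtain s t where st: "0 \<le> s" "s < 1" "0 \<le> t" "t < 1" "s \<noteq> t" "curve reduced (pt w s) = x" "curve reduced (pt w t) = x"
    by (rule crossing_times[OF x(1) reduced_simps(1)])
  have eq: "p'' s = x" "p'' t = x" using st reduced_simps(5) by simp_all
  have s: "a0 \<le> s" "s \<le> te" and t: "a0 \<le> t" "t \<le> te"
    using p''_T(1)[of s] p''_T(1)[of t] eq x(2) st by simp_all
  let ?u = "(s - a0) / (te - a0)" and ?v = "(t - a0) / (te - a0)"
  have "k (chord ?u) = k (chord ?v)" using eq p''_eq(1)[OF s] p''_eq(1)[OF t] by simp
  moreover have "chord ?u \<in> Q" "chord ?v \<in> Q"
    using chord_T(1) frac(1)[OF a0_te(2) s] frac(1)[OF a0_te(2) t] TQ by blast+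
  ultimately have "chord ?u = chord ?v" using k_eq by simp
  then have "?u = ?v" by (simp add: chord_T(5))
  then show False using st(5) a0_te by (simp add: divide_simps)
qed

lemma reduced_vld: "virtual_link_diagram reduced"
proof (rule virtual_link_diagram_agree[OF smoothed_vld reduced_agree closed_T])
  show "continuous_on (circles reduced) (curve reduced)"
    using loop_continuous[OF p''_cont p''_ends] by (simp add: reduced_def circles_def)
  have "virtuals D \<inter> k ` T \<subseteq> {k 0}"
    using smoothed_crossings_T virtual_link_diagramD(4)[OF vldD] smoothed_crossings by blast
  then show "crossings reduced \<inter> k ` T = virtuals reduced \<inter> k ` T"
    using reduced_crossings_T unfolding reduced_simps by blast
  fix z assume "z \<in> overs reduced"
  then have z: "z \<in> overs smoothed" "curve smoothed z \<noteq> k 0" by (simp_all add: reduced_simps)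
  then have zc: "z \<in> circles D" using overs_outside(1)[OF z(1)] by (simp add: smoothed_simps)
  have "curve smoothed z \<in> crossings smoothed" using virtual_link_diagramD(5)[OF smoothed_vld] z(1) by blast
  then have out: "curve smoothed z \<notin> k ` T" using smoothed_crossings_T z(2) by blast
  obtain t where t: "0 \<le> t" "t \<le> 1" "z = pt w t" "curve smoothed z = p' t" "curve reduced z = p'' t"
    using zc by (rule smoothed_cases)
  have "curve reduced z \<notin> k ` T" using out unfolding t(4,5) p'_T(1)[OF t(1,2)] p''_T(1)[OF t(1,2)] .
  then show "z \<in> circles reduced \<and> curve reduced z \<notin> k ` T" using zc by (simp add: reduced_simps)
qed (use reduced_crossings_T in auto)

lemma reduced_crossings: "crossings reduced \<subseteq> crossings D - {k 0}"
proof -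
  have "crossings reduced - interior (k ` T) = crossings smoothed - interior (k ` T)"
    by (rule agree_outside_crossings[OF reduced_agree])
  moreover have "interior (k ` T) \<subseteq> k ` T" by (rule interior_subset)
  moreover have "k 0 \<in> k ` T" using k0_T T_big(3) by blast
  ultimately show ?thesis using reduced_crossings_T smoothed_crossings by blast
qed

lemma reduced_replacement: "\<exists>q. replacement_rel_ends smoothed reduced (k ` T) 1 q q"
proof -
  define q where "q i s = pt w (a0 + s * (te - a0))" for i :: nat and s :: real
  have qt: "0 \<le> a0 + s * (te - a0) \<and> a0 + s * (te - a0) < 1" "a0 \<le> a0 + s * (te - a0) \<and> a0 + s * (te - a0) \<le> te"
    if "0 \<le> s" "s \<le> 1" for s
  proof -
    have "0 \<le> s * (te - a0)" "s * (te - a0) \<le> te - a0" using that a0_te by (simp_all add: mult_left_le_one_le)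
    then show "0 \<le> a0 + s * (te - a0) \<and> a0 + s * (te - a0) < 1" "a0 \<le> a0 + s * (te - a0) \<and> a0 + s * (te - a0) \<le> te"
      using a0_te by linarith+
  qed
  have qti: "a0 < a0 + s * (te - a0) \<and> a0 + s * (te - a0) < te" if "0 < s" "s < 1" for s
  proof -
    have "0 < s * (te - a0)" "s * (te - a0) < 1 * (te - a0)" using that a0_te by (simp_all add: mult_strict_right_mono)
    then show ?thesis by simp
  qed
  have qarc: "arc (q i)" for i
  proof -
    have "continuous_on {0..1} (\<lambda>s. pt w (a0 + s * (te - a0)))"
      by (rule continuous_on_compose2[OF continuous_pt[of UNIV]]) (auto intro!: continuous_intros)
    moreover have "q i = (\<lambda>s. pt w (a0 + s * (te - a0)))" by (rule ext) (simp add: q_def)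
    moreover have "inj_on (q i) {0..1}"
    proof (rule inj_onI)
      fix s u :: real assume s: "s \<in> {0..1}" "u \<in> {0..1}" "q i s = q i u"
      then have "a0 + s * (te - a0) = a0 + u * (te - a0)"
        using pt_eq_iff[OF w, of "a0 + s * (te - a0)" "a0 + u * (te - a0)"] qt(1)[of s] qt(1)[of u] by (auto simp: q_def)
      then show "s = u" using a0_te by simp
    qed
    ultimately show ?thesis by (simp add: arc_def path_def)
  qed
  have qpi: "path_image (q i) = pt w ` {a0..te}" for i
  proof -
    have "(\<lambda>s. a0 + s * (te - a0)) ` {0..1} = {a0..te}"
    proof
      show "(\<lambda>s. a0 + s * (te - a0)) ` {0..1} \<subseteq> {a0..te}" using qt(2) by auto
      show "{a0..te} \<subseteq> (\<lambda>s. a0 + s * (te - a0)) ` {0..1}"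
      proof
        fix t assume "t \<in> {a0..te}"
        then have "(t - a0) / (te - a0) \<in> {0..1}" "t = a0 + (t - a0) / (te - a0) * (te - a0)"
          using frac(1)[OF a0_te(2), of t] a0_te by auto
        then show "t \<in> (\<lambda>s. a0 + s * (te - a0)) ` {0..1}" by blast
      qed
    qed
    moreover have "q i ` {0..1} = pt w ` (\<lambda>s. a0 + s * (te - a0)) ` {0..1}"
      unfolding image_image by (rule image_cong) (simp_all add: q_def)
    ultimately show ?thesis by (simp add: path_image_def)
  qed
  have disk: "k ` T homeomorphic cball (0::complex) 1"
  proof (rule plane_chart_disk[OF chartQ TQ])
    have "0 \<in> T_open" by (simp add: in_box_complex_iff)
    then show "interior T \<noteq> {}" unfolding interior_cbox by blast
  qed auto
  have fr: "x \<in> frontier (k ` T)" if "x \<in> k ` T" "x \<notin> k ` T_open" for x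
    using that closed_T by (simp add: frontier_def int_T)
  have tangle: "tangle E (k ` T) 1 q"
    if E: "circles E = circles D" "\<And>t. 0 \<le> t \<Longrightarrow> t \<le> 1 \<Longrightarrow> curve E (pt w t) = r t"
      and r: "\<And>t. 0 \<le> t \<Longrightarrow> t \<le> 1 \<Longrightarrow> r t \<in> k ` T \<longleftrightarrow> a0 \<le> t \<and> t \<le> te"
        "\<And>t. 0 \<le> t \<Longrightarrow> t \<le> 1 \<Longrightarrow> r t \<in> k ` T_open \<longleftrightarrow> a0 < t \<and> t < te"
      and c: "crossings E \<inter> k ` T \<subseteq> {k 0}" for E r
    unfolding tangle_def
  proof (intro conjI allI impI ballI)
    show "k ` T homeomorphic cball (0::complex) 1" by (rule disk)
    have "k 0 \<notin> frontier (k ` T)" using k0_T by (simp add: frontier_def int_T)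
    moreover have "frontier (k ` T) \<subseteq> k ` T" using closed_T frontier_subset_closed by blast
    moreover have "X \<inter> F = {}" if "a \<notin> F" "F \<subseteq> Y" "X \<inter> Y \<subseteq> {a}" for X Y F :: "complex set" and a
      using that by blast
    ultimately show "crossings E \<inter> frontier (k ` T) = {}" using c by metis
    fix i show "arc (q i)" by (rule qarc)
    have 1: "curve E (q i s) = r (a0 + s * (te - a0))" if "0 \<le> s" "s \<le> 1" for s
      unfolding q_def using E(2)[of "a0 + s * (te - a0)"] qt(1)[OF that] by simp
    have "r a0 \<in> frontier (k ` T)" "r te \<in> frontier (k ` T)"
      using r(1,2)[of a0] r(1,2)[of te] a0_te by (auto intro!: fr)
    then show "curve E (pathstart (q i)) \<in> frontier (k ` T)" "curve E (pathfinish (q i)) \<in> frontier (k ` T)"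
      using 1[of 0] 1[of 1] by (simp_all add: pathstart_def pathfinish_def)
    fix s :: real assume "s \<in> {0<..<1}"
    then have s: "0 < s" "s < 1" by auto
    then have "r (a0 + s * (te - a0)) \<in> k ` T_open" using r(2)[of "a0 + s * (te - a0)"] qt(1)[of s] qti[of s] by simp
    then show "curve E (q i s) \<in> interior (k ` T)" using 1[of s] s by (simp add: int_T)
  next
    show "disjoint_family_on (\<lambda>i. path_image (q i)) {..<1}" by (simp add: disjoint_family_on_def)
    have "{z \<in> circles E. curve E z \<in> k ` T} = pt w ` {a0..te}"
    proof
      show "{z \<in> circles E. curve E z \<in> k ` T} \<subseteq> pt w ` {a0..te}"
      proof
        fix z assume z: "z \<in> {z \<in> circles E. curve E z \<in> k ` T}"
        then have "z \<in> circles D" using E(1) by simp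
        then obtain t where t: "0 \<le> t" "t < 1" "z = pt w t" by (rule circ_cases)
        then have "t \<in> {a0..te}" using z E(2)[of t] r(1)[of t] by simp
        then show "z \<in> pt w ` {a0..te}" using t(3) by blast
      qed
      show "pt w ` {a0..te} \<subseteq> {z \<in> circles E. curve E z \<in> k ` T}"
      proof (rule image_subsetI)
        fix t assume "t \<in> {a0..te}"
        then have t: "0 \<le> t" "t \<le> 1" "a0 \<le> t" "t \<le> te" using a0_te by auto
        then show "pt w t \<in> {z \<in> circles E. curve E z \<in> k ` T}"
          using E(2)[OF t(1,2)] r(1)[OF t(1,2)] pt_circ E(1) by simp
      qed
    qed
    moreover have "(\<Union>i<1. path_image (q i)) = path_image (q 0)" by auto
    ultimately show "{z \<in> circles E. curve E z \<in> k ` T} = (\<Union>i<1. path_image (q i))" by (simp only: qpi)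
  qed
  have "tangle smoothed (k ` T) 1 q"
    by (rule tangle[OF smoothed_simps(1,4) p'_T]) (simp_all add: smoothed_crossings_T)
  moreover have "tangle reduced (k ` T) 1 q"
    by (rule tangle[OF reduced_simps(1,5) p''_T]) (simp_all add: reduced_crossings_T)
  moreover have "curve smoothed (pt w t) = curve reduced (pt w t)" if "t = a0 \<or> t = te" for t
    using smoothed_simps(4)[of t] reduced_simps(5)[of t] p''_eq(2)[of t] a0_te that by auto
  ultimately have "replacement_rel_ends smoothed reduced (k ` T) 1 q q"
    unfolding replacement_rel_ends_def replacement_def using reduced_agree
    by (simp add: pathstart_def pathfinish_def q_def)
  then show ?thesis by blast
qed

lemma reduced_move: "welded_move smoothed reduced"
proof -
  obtain q where q: "replacement_rel_ends smoothed reduced (k ` T) 1 q q" using reduced_replacement by blast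
  have "R1 smoothed reduced \<or> VR1 smoothed reduced"
    unfolding R1_def VR1_def using q smoothed_crossings_T reduced_crossings_T by blast
  then show ?thesis
    unfolding welded_move_def elementary_welded_move_def using smoothed_vld reduced_vld by blast
qed

theorem smoothing_step:
  assumes "2 \<le> n"
  shows "(\<lambda>E F. H_move n E F \<or> welded_move E F)\<^sup>*\<^sup>* D reduced" "welded_knot_diagram reduced"
    "card (crossings reduced) < card (crossings D)"
proof -
  have "(\<lambda>E F. H_move n E F \<or> welded_move E F)\<^sup>*\<^sup>* D smoothed"
    using H_config_reach[OF H_config_smoothed _ assms] by simp
  then show "(\<lambda>E F. H_move n E F \<or> welded_move E F)\<^sup>*\<^sup>* D reduced"
    using reduced_move by (rule_tac rtranclp.rtrancl_into_rtrancl) auto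
  show "welded_knot_diagram reduced" unfolding welded_knot_diagram_def using reduced_vld reduced_simps(3) by simp
  have "crossings reduced \<subset> crossings D" using reduced_crossings x0 by blast
  then show "card (crossings reduced) < card (crossings D)"
    using virtual_link_diagramD(2)[OF vldD] psubset_card_mono by blast
qed

end

text \<open>
  The radii \<open>40\<close> and \<open>50\<close> leave room for all rectangles used: in the straightened coordinates they lie in the
  disk of radius \<open>40\<close>.
\<close>

lemma crossing_reduction:
  assumes n: "2 \<le> n" and D: "welded_knot_diagram D" and x: "x \<in> crossings D"
  shows "\<exists>E. (\<lambda>E F. H_move n E F \<or> welded_move E F)\<^sup>*\<^sup>* D E \<and> welded_knot_diagram E \<and> card (crossings E) < card (crossings D)"
proof -
  have D': "virtual_link_diagram D" "ncomp D = 1" using D by (simp_all add: welded_knot_diagram_def)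
  obtain w k a1 a2 f1 c1 c2 f2 where w: "norm w = 1" and k: "plane_chart (ball 0 50) k" "k 0 = x"
    and f: "arc_time a1 a2 f1" "arc_time c1 c2 f2" and o: "0 < a1" "a2 < c1" "c2 < 1"
    and p1: "\<And>t. t \<in> {a1..a2} \<Longrightarrow> curve D (pt w t) = k (of_real (f1 t))"
    and p2: "\<And>t. t \<in> {c1..c2} \<Longrightarrow> curve D (pt w t) = k (\<i> * of_real (f2 t))"
    and cover: "\<And>t. 0 \<le> t \<Longrightarrow> t \<le> 1 \<Longrightarrow> curve D (pt w t) \<in> k ` ball 0 40 \<Longrightarrow> t \<in> {a1..a2} \<union> {c1..c2}"
    by (rule chart_at_crossing[OF D' x]) blast
  have t1: "\<exists>t\<in>{a1..a2}. f1 t = u" if "-40 \<le> u" "u \<le> 40" for u using arc_timeD(9)[OF f(1) that] .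
  have t2: "\<exists>t\<in>{c1..c2}. f2 t = u" if "-40 \<le> u" "u \<le> 40" for u using arc_timeD(9)[OF f(2) that] .
  obtain a0 b1 b2 where a: "a0 \<in> {a1..a2}" "f1 a0 = -1/8" "b1 \<in> {a1..a2}" "f1 b1 = 1/2" "b2 \<in> {a1..a2}" "f1 b2 = 3/2"
    using t1[of "-1/8"] t1[of "1/2"] t1[of "3/2"] by auto
  obtain s0 d1 d2 where s: "s0 \<in> {c1..c2}" "f2 s0 = -1/4" "d1 \<in> {c1..c2}" "f2 d1 = 1/2" "d2 \<in> {c1..c2}" "f2 d2 = 3/2"
    using t2[of "-1/4"] t2[of "1/2"] t2[of "3/2"] by auto
  interpret crossing_chart D w "straighten -` ball 0 50" "k \<circ> straighten" a1 a2 f1 c1 c2 f2 a0 b1 b2 s0 d1 d2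
  proof
    show "plane_chart (straighten -` ball 0 50) (k \<circ> straighten)"
      by (rule plane_chart_compose[OF k(1) straighten_bij straighten_continuous])
    show "rect (-2) 3 (-1) 4 \<subseteq> straighten -` ball 0 50" using straighten_bound by fastforce
    show "arm1 u \<in> straighten -` ball 0 50" "arm2 u \<in> straighten -` ball 0 50" if "-40 \<le> u" "u \<le> 40" for u
      using that by (simp_all add: straighten_arms norm_mult)
    show "curve D (pt w t) = (k \<circ> straighten) (arm1 (f1 t))" if "t \<in> {a1..a2}" for t
      using p1[OF that] by (simp add: straighten_arms)
    show "curve D (pt w t) = (k \<circ> straighten) (arm2 (f2 t))" if "t \<in> {c1..c2}" for t
      using p2[OF that] by (simp add: straighten_arms)
    show "t \<in> {a1..a2} \<union> {c1..c2}" if "0 \<le> t" "t \<le> 1" "curve D (pt w t) \<in> (k \<circ> straighten) ` rect (-2) 3 (-1) 4" for t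
    proof -
      have "straighten ` rect (-2) 3 (-1) 4 \<subseteq> ball 0 40" using straighten_bound by blast
      then have "(k \<circ> straighten) ` rect (-2) 3 (-1) 4 \<subseteq> k ` ball 0 40" unfolding image_comp[symmetric] by (rule image_mono)
      then show ?thesis using cover[OF that(1,2)] that(3) by blast
    qed
    show "(k \<circ> straighten) 0 \<in> crossings D" using x k(2) by (simp add: straighten_arms)
  qed (use D' w f o a s in simp_all)
  show ?thesis using smoothing_step[OF n] by blast
qed

theorem mainTheorem3:
  fixes n :: nat and D :: diagram
  assumes "n \<ge> 2"
    and "welded_knot_diagram D"
  shows "\<exists>D'. trivial_knot_diagram D' \<and>
           (\<lambda>E F. H_move n E F \<or> welded_move E F)\<^sup>*\<^sup>* D D'"
  using assms(2)
proof (induction "card (crossings D)" arbitrary: D rule: less_induct)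
  case less
  show ?case
  proof (cases "crossings D = {}")
    case True
    then have "trivial_knot_diagram D" unfolding trivial_knot_diagram_def using less.prems by blast
    then show ?thesis by blast
  next
    case False
    then obtain x where "x \<in> crossings D" by blast
    from crossing_reduction[OF assms(1) less.prems this] obtain E where
      E: "(\<lambda>E F. H_move n E F \<or> welded_move E F)\<^sup>*\<^sup>* D E" "welded_knot_diagram E" "card (crossings E) < card (crossings D)"
      by blast
    from less.hyps[OF E(3,2)] obtain D' where "trivial_knot_diagram D'" "(\<lambda>E F. H_move n E F \<or> welded_move E F)\<^sup>*\<^sup>* E D'"
      by blast
    then show ?thesis using rtranclp_trans[OF E(1)] by blast
  qed
qed

end
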